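(* Let $\nu$ be a Radon measure on $G$ satisfying $$\int_G f(k^{-1}xh^{-1})\,d\nu(x)=\Delta_K(k)\Delta_H(h)\int_G f(x)\,d\nu(x)\qquad (k\in K,\ h\in H,\ f\in C_c(G)).$$ Then there is a unique Radon measure $\mu=\dot\nu$ on $K\backslash G/H$ such that $$\int_G f(x)\,d\nu(x)=\int_{K\backslash G/H} Qf\,d\mu=\int_{K\backslash G/H}\int_K\int_H f(kxh)\,dk\,dh\,d\mu(\dot x)\qquad (f\in C_c(G)).$$
   Context: $G$ is a locally compact group and $H,K$ are closed subgroups, with left Haar measures $dx,dh,dk$ on $G,H,K$ (normalized to total mass one on those of the groups that are compact) and modular functions $\Delta_G,\Delta_H,\Delta_K$ (convention: $\int_G f(xy^{-1})\,dx=\Delta_G(y)\int_G f(x)\,dx$, similarly for $H,K$). $K\backslash G/H=\{KxH:x\in G\}$ carries the quotient topology of $q:G\to K\backslash G/H$, $q(x)=\dot x=KxH$. For $f\in C_c(G)$ (continuous, compactly supported), $Qf(KxH)=\int_K\int_H f(kxh)\,dk\,dh$. Standing assumption: $K\backslash G/H$ is a locally compact (Hausdorff) space and $Q$ is a well-defined map from $C_c(G)$ into $C_c(K\backslash G/H)$. *)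

theory Defs
  imports "HOL-Analysis.Analysis" "HOL-Algebra.Coset"
begin

definition locally_compact_group :: "('a, 'm) monoid_scheme \<Rightarrow> 'a topology \<Rightarrow> bool" where
  "locally_compact_group G T \<longleftrightarrow>
     group G \<and> topspace T = carrier G \<and>
     continuous_map (prod_topology T T) T (\<lambda>(x, y). x \<otimes>\<^bsub>G\<^esub> y) \<and>
     continuous_map T T (\<lambda>x. inv\<^bsub>G\<^esub> x) \<and>
     Hausdorff_space T \<and> locally_compact_space T"

definition closed_subgroup :: "'a set \<Rightarrow> ('a, 'm) monoid_scheme \<Rightarrow> 'a topology \<Rightarrow> bool" where
  "closed_subgroup H G T \<longleftrightarrow> subgroup H G \<and> closedin T H"

definition Cc :: "'a topology \<Rightarrow> ('a \<Rightarrow> complex) set" where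
  "Cc X = {f. continuous_map X euclidean f \<and>
              compactin X (X closure_of {x \<in> topspace X. f x \<noteq> 0})}"

definition borel_of :: "'a topology \<Rightarrow> 'a measure" where
  "borel_of X = sigma (topspace X) {U. openin X U}"

text \<open>Radon measures are positive Borel measures, with Folland's regularity conditions: finite on
  compact sets, outer regular on Borel sets and inner regular on open sets.\<close>

definition radon_measure :: "'a topology \<Rightarrow> 'a measure \<Rightarrow> bool" where
  "radon_measure X \<mu> \<longleftrightarrow>
     sets \<mu> = sets (borel_of X) \<and>
     (\<forall>C. compactin X C \<longrightarrow> emeasure \<mu> C < \<infinity>) \<and>
     (\<forall>A \<in> sets \<mu>. emeasure \<mu> A = (INF U \<in> {U. openin X U \<and> A \<subseteq> U}. emeasure \<mu> U)) \<and>
     (\<forall>U. openin X U \<longrightarrow>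
        emeasure \<mu> U = (SUP C \<in> {C. compactin X C \<and> C \<subseteq> U}. emeasure \<mu> C))"

text \<open>The last conjunct is the normalization convention for compact groups. For a closed subgroup
  \<open>H\<close> of \<open>G\<close> the next two notions are used with the group \<open>G\<lparr>carrier := H\<rparr>\<close> and the
  topology \<open>subtopology T H\<close>.\<close>

definition left_haar_measure ::
    "('a, 'm) monoid_scheme \<Rightarrow> 'a topology \<Rightarrow> 'a measure \<Rightarrow> bool" where
  "left_haar_measure G T \<eta>G \<longleftrightarrow>
     radon_measure T \<eta>G \<and> emeasure \<eta>G (topspace T) \<noteq> 0 \<and>
     (\<forall>x \<in> carrier G. \<forall>A \<in> sets \<eta>G. emeasure \<eta>G (x <#\<^bsub>G\<^esub> A) = emeasure \<eta>G A) \<and>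
     (compact_space T \<longrightarrow> emeasure \<eta>G (topspace T) = 1)"

text \<open>This identity determines \<open>\<Delta>\<close> on \<open>carrier G\<close>, as some \<open>f\<close> has a nonzero integral.\<close>

definition modular_function ::
    "('a, 'm) monoid_scheme \<Rightarrow> 'a topology \<Rightarrow> 'a measure \<Rightarrow> ('a \<Rightarrow> real) \<Rightarrow> bool" where
  "modular_function G T \<eta>G \<Delta> \<longleftrightarrow>
     (\<forall>y \<in> carrier G. \<forall>f \<in> Cc T.
        (\<integral>x. f (x \<otimes>\<^bsub>G\<^esub> inv\<^bsub>G\<^esub> y) \<partial>\<eta>G) = complex_of_real (\<Delta> y) * (\<integral>x. f x \<partial>\<eta>G))"

definition double_coset :: "('a, 'm) monoid_scheme \<Rightarrow> 'a set \<Rightarrow> 'a set \<Rightarrow> 'a \<Rightarrow> 'a set" where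
  "double_coset G K H x = (K #>\<^bsub>G\<^esub> x) <#>\<^bsub>G\<^esub> H"

definition double_coset_space ::
    "('a, 'm) monoid_scheme \<Rightarrow> 'a topology \<Rightarrow> 'a set \<Rightarrow> 'a set \<Rightarrow> 'a set topology" where
  "double_coset_space G T K H = topology (\<lambda>\<U>.
     \<U> \<subseteq> double_coset G K H ` carrier G \<and>
     openin T {x \<in> topspace T. double_coset G K H x \<in> \<U>})"

lemma openin_double_coset_space:
  "openin (double_coset_space G T K H) \<U> \<longleftrightarrow>
     \<U> \<subseteq> double_coset G K H ` carrier G \<and> openin T {x \<in> topspace T. double_coset G K H x \<in> \<U>}"
proof -
  let ?q = "double_coset G K H"
  have "istopology (\<lambda>\<U>. \<U> \<subseteq> ?q ` carrier G \<and> openin T {x \<in> topspace T. ?q x \<in> \<U>})"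
    unfolding istopology_def
  proof (intro conjI allI impI)
    fix S U
    assume S: "S \<subseteq> ?q ` carrier G \<and> openin T {x \<in> topspace T. ?q x \<in> S}"
      and U: "U \<subseteq> ?q ` carrier G \<and> openin T {x \<in> topspace T. ?q x \<in> U}"
    have "{x \<in> topspace T. ?q x \<in> S \<inter> U} =
        {x \<in> topspace T. ?q x \<in> S} \<inter> {x \<in> topspace T. ?q x \<in> U}" by auto
    then show "openin T {x \<in> topspace T. ?q x \<in> S \<inter> U}" using S U by auto
    show "S \<inter> U \<subseteq> ?q ` carrier G" using S by auto
  next
    fix \<K>
    assume K: "\<forall>U\<in>\<K>. U \<subseteq> ?q ` carrier G \<and> openin T {x \<in> topspace T. ?q x \<in> U}"
    have "{x \<in> topspace T. ?q x \<in> \<Union>\<K>} = (\<Union>U\<in>\<K>. {x \<in> topspace T. ?q x \<in> U})" by auto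
    then show "openin T {x \<in> topspace T. ?q x \<in> \<Union>\<K>}" using K by auto
    show "\<Union>\<K> \<subseteq> ?q ` carrier G" using K by auto
  qed
  then show ?thesis
    by (simp add: double_coset_space_def topology_inverse')
qed

lemma quotient_map_double_coset:
  assumes "topspace T = carrier G"
  shows "quotient_map T (double_coset_space G T K H) (double_coset G K H)"
proof -
  have "openin (double_coset_space G T K H) (double_coset G K H ` carrier G)"
    unfolding openin_double_coset_space using assms
    by (metis (mono_tags, lifting) Collect_cong Collect_mem_eq image_eqI openin_topspace order_refl)
  then have "topspace (double_coset_space G T K H) = double_coset G K H ` carrier G"
    by (metis openin_double_coset_space openin_subset openin_topspace subset_antisym)
  then show ?thesis
    using assms by (auto simp: quotient_map_def openin_double_coset_space)
qed

definition coset_integral ::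
    "('a, 'm) monoid_scheme \<Rightarrow> 'a measure \<Rightarrow> 'a measure \<Rightarrow> ('a \<Rightarrow> complex) \<Rightarrow> 'a \<Rightarrow> complex" where
  "coset_integral G \<eta>K \<eta>H f x = (\<integral>k. (\<integral>h. f (k \<otimes>\<^bsub>G\<^esub> x \<otimes>\<^bsub>G\<^esub> h) \<partial>\<eta>H) \<partial>\<eta>K)"

text \<open>The value at a double coset is computed at a chosen representative; independence of the
  choice is part of \<open>Q_well_defined\<close>.\<close>

definition Q ::
    "('a, 'm) monoid_scheme \<Rightarrow> 'a measure \<Rightarrow> 'a measure \<Rightarrow> ('a \<Rightarrow> complex) \<Rightarrow> 'a set \<Rightarrow> complex" where
  "Q G \<eta>K \<eta>H f D = coset_integral G \<eta>K \<eta>H f (SOME x. x \<in> D)"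

text \<open>\<open>Q\<close> is a well-defined map from \<open>C\<^sub>c(G)\<close> into the \<open>C\<^sub>c\<close> of the double coset space: the iterated
  integrals converge (a divergent Bochner integral would silently be \<open>0\<close>), they depend only on the
  double coset, and the resulting function on double cosets is continuous with compact support.\<close>

definition Q_well_defined ::
    "('a, 'm) monoid_scheme \<Rightarrow> 'a topology \<Rightarrow> 'a set \<Rightarrow> 'a set \<Rightarrow> 'a measure \<Rightarrow> 'a measure \<Rightarrow> bool" where
  "Q_well_defined G T K H \<eta>K \<eta>H \<longleftrightarrow>
     (\<forall>f \<in> Cc T.
        (\<forall>x \<in> carrier G.
           (\<forall>k \<in> K. integrable \<eta>H (\<lambda>h. f (k \<otimes>\<^bsub>G\<^esub> x \<otimes>\<^bsub>G\<^esub> h))) \<and>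
           integrable \<eta>K (\<lambda>k. \<integral>h. f (k \<otimes>\<^bsub>G\<^esub> x \<otimes>\<^bsub>G\<^esub> h) \<partial>\<eta>H)) \<and>
        (\<forall>x \<in> carrier G. \<forall>y \<in> carrier G. double_coset G K H x = double_coset G K H y \<longrightarrow>
           coset_integral G \<eta>K \<eta>H f x = coset_integral G \<eta>K \<eta>H f y) \<and>
        Q G \<eta>K \<eta>H f \<in> Cc (double_coset_space G T K H))"

end

theory Submission
  imports Defs
begin

text \<open>Write \<open>q(x) = KxH\<close> and \<open>Q f(q(x)) = \<integral>\<^sub>K \<integral>\<^sub>H f(kxh) dh dk\<close>. The measure \<open>\<mu>\<close> is obtained from the
  Riesz representation theorem, applied to the functional \<open>Q f \<mapsto> \<integral> f d\<nu>\<close> on \<open>C\<^sub>c(K\G/H)\<close>. For this to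
  make sense, \<open>Q\<close> must map onto \<open>C\<^sub>c\<close> of the quotient and \<open>\<integral> f d\<nu>\<close> may depend only on \<open>Q f\<close>.

  Surjectivity: for compact \<open>C\<close> in the quotient there is \<open>\<phi> \<ge> 0\<close> in \<open>C\<^sub>c(G)\<close> with \<open>Q \<phi> = 1\<close> on \<open>C\<close>
  (\<open>unit_on_compact\<close>, which uses that \<open>q\<close> is open), and then \<open>\<phi> (g \<circ> q)\<close> is a preimage of any \<open>g\<close>
  supported in \<open>C\<close>.

  Dependence on \<open>Q f\<close> only: this follows from the symmetry
  \<open>\<integral> f (Q g \<circ> q) d\<nu> = \<integral> g (Q f \<circ> q) d\<nu>\<close> (\<open>qavg_symmetric\<close>), by choosing \<open>g\<close> with \<open>Q g = 1\<close> on the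
  image of the support of \<open>f\<close>. The symmetry is a change of variables \<open>x \<mapsto> k\<^sup>-\<^sup>1xh\<^sup>-\<^sup>1\<close> under the
  integral over \<open>K \<times> G \<times> H\<close>: the factor \<open>\<Delta>\<^sub>K(k) \<Delta>\<^sub>H(h)\<close> that \<open>\<nu>\<close> produces is absorbed by the
  substitutions \<open>k \<mapsto> k\<^sup>-\<^sup>1\<close> and \<open>h \<mapsto> h\<^sup>-\<^sup>1\<close>, because \<open>\<integral> F(h\<^sup>-\<^sup>1) \<Delta>(h)\<^sup>-\<^sup>1 dh = \<integral> F(h) dh\<close>
  (\<open>integral_inverse\<close>).

  The exchange of integrals needs care, since the groups need not be \<open>\<sigma>\<close>-compact and the support of
  \<open>(x, k, h) \<mapsto> f(x) g(kxh)\<close> is not visibly compact. For fixed \<open>k\<close> the support in \<open>(x, h)\<close> is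
  compact, which gives the step for \<open>H\<close> (\<open>average_symmetric\<close>). For \<open>K\<close>, continuity of \<open>Q g\<close> and a
  Dini argument allow a cutoff in \<open>k\<close> at the cost of an arbitrarily small error, uniformly for
  \<open>x\<close> in the support of \<open>f\<close> (\<open>uniform_cutoff\<close>). With the cutoff everything is compactly supported,
  and dropping it again at the other end gives one inequality; the other is the same one with \<open>f\<close>
  and \<open>g\<close> exchanged.

  Uniqueness: Radon measures that agree on \<open>C\<^sub>c\<close> are equal (\<open>radon_measure_eqI\<close>), and \<open>Q\<close> is onto.\<close>

section \<open>Compactly supported functions\<close>

text \<open>The cone of non-negative continuous functions with compact support. The support condition
  only asks that the function vanish off some compact set; in a Hausdorff space this is the usual
  condition. Nothing is required off the carrier of the topology.\<close>

definition Cc_nonneg :: "'a topology \<Rightarrow> ('a \<Rightarrow> real) set" where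
  "Cc_nonneg X = {f. continuous_map X euclideanreal f \<and> (\<forall>x\<in>topspace X. 0 \<le> f x) \<and>
     (\<exists>C. compactin X C \<and> (\<forall>x\<in>topspace X - C. f x = 0))}"

lemma Cc_nonnegI:
  assumes "continuous_map X euclideanreal f" "\<And>x. x \<in> topspace X \<Longrightarrow> 0 \<le> f x"
    and "compactin X C" "\<And>x. x \<in> topspace X \<Longrightarrow> x \<notin> C \<Longrightarrow> f x = 0"
  shows "f \<in> Cc_nonneg X"
  using assms by (auto simp: Cc_nonneg_def)

lemma Cc_nonneg_continuous: "f \<in> Cc_nonneg X \<Longrightarrow> continuous_map X euclideanreal f"
  and Cc_nonneg_nonneg: "f \<in> Cc_nonneg X \<Longrightarrow> x \<in> topspace X \<Longrightarrow> 0 \<le> f x"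
  by (auto simp: Cc_nonneg_def)

lemma Cc_nonneg_support:
  assumes "f \<in> Cc_nonneg X"
  obtains C where "compactin X C" "\<And>x. x \<in> topspace X \<Longrightarrow> x \<notin> C \<Longrightarrow> f x = 0"
  using assms by (auto simp: Cc_nonneg_def)

lemma Cc_nonneg_dominated:
  assumes "f \<in> Cc_nonneg X" "continuous_map X euclideanreal g"
    and "\<And>x. x \<in> topspace X \<Longrightarrow> 0 \<le> g x"
    and "\<And>x. x \<in> topspace X \<Longrightarrow> f x = 0 \<Longrightarrow> g x = 0"
  shows "g \<in> Cc_nonneg X"
  using assms by (auto simp: Cc_nonneg_def)

lemma Cc_nonneg_zero: "(\<lambda>x. 0) \<in> Cc_nonneg X"
  by (rule Cc_nonnegI[where C = "{}"]) auto

lemma Cc_nonneg_add: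
  assumes "f \<in> Cc_nonneg X" "g \<in> Cc_nonneg X"
  shows "(\<lambda>x. f x + g x) \<in> Cc_nonneg X"
proof -
  obtain C where C: "compactin X C" "\<And>x. x \<in> topspace X \<Longrightarrow> x \<notin> C \<Longrightarrow> f x = 0"
    using assms(1) Cc_nonneg_support by blast
  obtain D where D: "compactin X D" "\<And>x. x \<in> topspace X \<Longrightarrow> x \<notin> D \<Longrightarrow> g x = 0"
    using assms(2) Cc_nonneg_support by blast
  show ?thesis
  proof (rule Cc_nonnegI)
    show "compactin X (C \<union> D)"
      using C(1) D(1) by (rule compactin_Un)
    show "f x + g x = 0" if "x \<in> topspace X" "x \<notin> C \<union> D" for x
      using C(2)[of x] D(2)[of x] that by simp
  qed (use assms in \<open>simp_all add: continuous_map_add Cc_nonneg_continuous Cc_nonneg_nonneg\<close>)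
qed

lemma Cc_nonneg_mult:
  assumes "f \<in> Cc_nonneg X" "continuous_map X euclideanreal g" "\<And>x. x \<in> topspace X \<Longrightarrow> 0 \<le> g x"
  shows "(\<lambda>x. f x * g x) \<in> Cc_nonneg X"
  by (intro Cc_nonneg_dominated[OF assms(1)] continuous_map_real_mult
      Cc_nonneg_continuous[OF assms(1)]) (use assms in \<open>auto simp: Cc_nonneg_nonneg\<close>)

lemma Cc_nonneg_cmult:
  assumes "f \<in> Cc_nonneg X" "0 \<le> (c::real)"
  shows "(\<lambda>x. c * f x) \<in> Cc_nonneg X"
  using Cc_nonneg_mult[OF assms(1), of "\<lambda>x. c"] assms(2) by (simp add: mult.commute)

lemma Cc_nonneg_min_const:
  assumes "f \<in> Cc_nonneg X" "0 \<le> c"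
  shows "(\<lambda>x. min (f x) c) \<in> Cc_nonneg X"
  by (intro Cc_nonneg_dominated[OF assms(1)] continuous_map_real_min
      Cc_nonneg_continuous[OF assms(1)]) (use assms in \<open>auto simp: Cc_nonneg_nonneg\<close>)

lemma Cc_nonneg_diff_const:
  assumes "f \<in> Cc_nonneg X" "0 \<le> c"
  shows "(\<lambda>x. max (f x - c) 0) \<in> Cc_nonneg X"
  by (intro Cc_nonneg_dominated[OF assms(1)] continuous_map_real_max continuous_map_diff
      Cc_nonneg_continuous[OF assms(1)]) (use assms in \<open>auto simp: Cc_nonneg_nonneg\<close>)

lemma Cc_nonneg_sum:
  assumes "finite F" "\<And>i. i \<in> F \<Longrightarrow> f i \<in> Cc_nonneg X"
  shows "(\<lambda>x. \<Sum>i\<in>F. f i x) \<in> Cc_nonneg X"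
  using assms by (induction rule: finite_induct) (auto intro: Cc_nonneg_zero Cc_nonneg_add)

lemma Cc_nonneg_cong:
  assumes "f \<in> Cc_nonneg X" "\<And>x. x \<in> topspace X \<Longrightarrow> f x = g x"
  shows "g \<in> Cc_nonneg X"
proof (rule Cc_nonneg_dominated[OF assms(1)])
  show "continuous_map X euclideanreal g"
    using continuous_map_eq[OF Cc_nonneg_continuous[OF assms(1)]] assms(2) by blast
  show "0 \<le> g x" if "x \<in> topspace X" for x
    using Cc_nonneg_nonneg[OF assms(1) that] assms(2)[OF that] by simp
  show "g x = 0" if "x \<in> topspace X" "f x = 0" for x
    using assms(2)[OF that(1)] that(2) by simp
qed

lemma compact_bounded_image:
  fixes f :: "'a \<Rightarrow> 'b::real_normed_vector"
  assumes "continuous_map X euclidean f" "compactin X C"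
  obtains M where "0 \<le> M" "\<And>x. x \<in> C \<Longrightarrow> norm (f x) \<le> M"
proof -
  have "compact (f ` C)"
    using image_compactin[OF assms(2,1)] by simp
  then obtain M where "\<forall>y\<in>f ` C. norm y \<le> M"
    using compact_imp_bounded bounded_iff by blast
  then show ?thesis
    using that[of "max M 0"] by (auto simp: le_max_iff_disj)
qed

lemma Cc_nonneg_bounded:
  assumes "f \<in> Cc_nonneg X"
  obtains M where "0 < M" "\<And>x. x \<in> topspace X \<Longrightarrow> f x \<le> M"
proof -
  obtain C where C: "compactin X C" "\<And>x. x \<in> topspace X \<Longrightarrow> x \<notin> C \<Longrightarrow> f x = 0"
    using assms Cc_nonneg_support by blast
  obtain M where M: "0 \<le> M" "\<And>x. x \<in> C \<Longrightarrow> norm (f x) \<le> M"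
    using compact_bounded_image[OF Cc_nonneg_continuous[OF assms] C(1)] by blast
  show ?thesis
  proof (rule that[of "M + 1"])
    show "f x \<le> M + 1" if "x \<in> topspace X" for x
      using M(1) M(2)[of x] C(2)[OF that] by (cases "x \<in> C") auto
  qed (use M(1) in auto)
qed

lemma of_real_Cc_nonneg:
  assumes "Hausdorff_space X" "f \<in> Cc_nonneg X"
  shows "(\<lambda>x. complex_of_real (f x)) \<in> Cc X"
proof -
  obtain C where C: "compactin X C" "\<And>x. x \<in> topspace X \<Longrightarrow> x \<notin> C \<Longrightarrow> f x = 0"
    using assms(2) Cc_nonneg_support by blast
  have "X closure_of {x \<in> topspace X. complex_of_real (f x) \<noteq> 0} \<subseteq> C"
    using C compactin_imp_closedin[OF assms(1)] by (intro closure_of_minimal) auto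
  then have "compactin X (X closure_of {x \<in> topspace X. complex_of_real (f x) \<noteq> 0})"
    using closed_compactin[OF C(1)] by simp
  moreover have "continuous_map X euclidean (complex_of_real \<circ> f)"
    by (rule continuous_map_compose[OF Cc_nonneg_continuous[OF assms(2)]])
      (simp add: continuous_on_of_real)
  ultimately show ?thesis
    by (simp add: Cc_def o_def)
qed

lemma Cc_nonneg_from_Cc:
  assumes "F \<in> Cc X" "continuous_map X euclideanreal f"
    and "\<And>x. x \<in> topspace X \<Longrightarrow> 0 \<le> f x" "\<And>x. x \<in> topspace X \<Longrightarrow> F x = 0 \<Longrightarrow> f x = 0"
  shows "f \<in> Cc_nonneg X"
proof (rule Cc_nonnegI)
  show "compactin X (X closure_of {x \<in> topspace X. F x \<noteq> 0})"
    using assms(1) by (simp add: Cc_def)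
  show "f x = 0" if "x \<in> topspace X" "x \<notin> X closure_of {x \<in> topspace X. F x \<noteq> 0}" for x
    using that assms(4) closure_of_subset[of "{x \<in> topspace X. F x \<noteq> 0}" X] by auto
qed (use assms in auto)

lemma Cc_decompose:
  assumes f: "f \<in> Cc Y"
  obtains a b c d where "a \<in> Cc_nonneg Y" "b \<in> Cc_nonneg Y" "c \<in> Cc_nonneg Y" "d \<in> Cc_nonneg Y"
    "f = (\<lambda>x. complex_of_real (a x) - complex_of_real (b x)
            + \<i> * (complex_of_real (c x) - complex_of_real (d x)))"
proof -
  have fc: "continuous_map Y euclidean f"
    using f by (simp add: Cc_def)
  have "continuous_map Y euclideanreal (Re \<circ> f)" "continuous_map Y euclideanreal (Im \<circ> f)"
    by (rule continuous_map_compose[OF fc], simp add: continuous_on_Re continuous_on_Im)+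
  then have c: "continuous_map Y euclideanreal (\<lambda>x. Re (f x))" "continuous_map Y euclideanreal (\<lambda>x. Im (f x))"
    by (simp_all add: o_def)
  show ?thesis
  proof (rule that)
    show "(\<lambda>x. max (Re (f x)) 0) \<in> Cc_nonneg Y" "(\<lambda>x. max (- Re (f x)) 0) \<in> Cc_nonneg Y"
      "(\<lambda>x. max (Im (f x)) 0) \<in> Cc_nonneg Y" "(\<lambda>x. max (- Im (f x)) 0) \<in> Cc_nonneg Y"
      by (rule Cc_nonneg_from_Cc[OF f]; simp add: c continuous_map_real_max)+
    show "f = (\<lambda>x. complex_of_real (max (Re (f x)) 0) - complex_of_real (max (- Re (f x)) 0)
        + \<i> * (complex_of_real (max (Im (f x)) 0) - complex_of_real (max (- Im (f x)) 0)))"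
      by (auto simp: fun_eq_iff complex_eq_iff max_def)
  qed
qed

lemma compactin_finite_subcover:
  assumes "compactin X C" "\<And>i. i \<in> A \<Longrightarrow> openin X (U i)" "C \<subseteq> (\<Union>i\<in>A. U i)"
  obtains F where "finite F" "F \<subseteq> A" "C \<subseteq> (\<Union>i\<in>F. U i)"
proof -
  have "\<forall>V\<in>U ` A. openin X V"
    using assms(2) by blast
  then obtain \<F> where "finite \<F>" "\<F> \<subseteq> U ` A" "C \<subseteq> \<Union>\<F>"
    using assms(1,3) unfolding compactin_def by meson
  then show ?thesis
    using finite_subset_image that by metis
qed

lemma compactin_superlevel:
  assumes "Hausdorff_space X" "compactin X C" "continuous_map X euclideanreal f"
  shows "compactin X {x \<in> C. a \<le> f x}"
proof -
  have "closedin X {x \<in> topspace X. a \<le> f x}"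
    using assms(3) continuous_map_upper_lower_semicontinuous_le by blast
  then have "closedin X (C \<inter> {x \<in> topspace X. a \<le> f x})"
    using assms compactin_imp_closedin by blast
  moreover have "C \<inter> {x \<in> topspace X. a \<le> f x} = {x \<in> C. a \<le> f x}"
    using compactin_subset_topspace[OF assms(2)] by auto
  ultimately show ?thesis
    using closed_compactin[OF assms(2)] by auto
qed

text \<open>Urysohn's lemma with a support that is a compact subset of \<open>U\<close>.\<close>

lemma Urysohn_Cc:
  assumes lc: "locally_compact_space X" and hd: "Hausdorff_space X"
    and C: "compactin X C" and U: "openin X U" "C \<subseteq> U"
  obtains f D where "f \<in> Cc_nonneg X" "\<And>x. x \<in> topspace X \<Longrightarrow> f x \<le> 1" "\<And>x. x \<in> C \<Longrightarrow> f x = 1"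
    "compactin X D" "D \<subseteq> U" "\<And>x. x \<in> topspace X \<Longrightarrow> x \<notin> D \<Longrightarrow> f x = 0"
proof -
  obtain V L where V: "openin X V" "compactin X L" "C \<subseteq> V" "V \<subseteq> L"
    using lc C locally_compact_space_compact_closed_compact[of X] hd by blast
  have cr: "completely_regular_space X"
    using locally_compact_regular_imp_completely_regular_space lc hd by blast
  have cl: "closedin X (topspace X - (U \<inter> V))"
    using U V by (simp add: openin_Int closedin_diff)
  obtain g where g: "continuous_map X (subtopology euclidean {0..1::real}) g"
      "g ` (topspace X - (U \<inter> V)) \<subseteq> {0}" "g ` C \<subseteq> {1}"
    using Urysohn_completely_regular_compact_closed[OF _ cr C cl, of 0 1] U V
    by (auto simp: disjnt_iff subset_iff)
  then have gc: "continuous_map X euclideanreal g" and gr: "\<And>x. x \<in> topspace X \<Longrightarrow> 0 \<le> g x \<and> g x \<le> 1"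
    by (auto simp: continuous_map_in_subtopology)
  \<comment> \<open>Doubling and truncating moves the support into the compact set where \<open>g\<close> is at least a half.\<close>
  define f where "f = (\<lambda>x. max (2 * g x - 1) 0)"
  define D where "D = {x \<in> L. 1/2 \<le> g x}"
  have g0: "g x = 0" if "x \<in> topspace X" "x \<notin> U \<inter> V" for x
    using g(2) that by auto
  have D: "compactin X D"
    unfolding D_def by (rule compactin_superlevel[OF hd V(2) gc])
  have DU: "D \<subseteq> U"
    using g0 compactin_subset_topspace[OF V(2)] by (force simp: D_def)
  have f0: "f x = 0" if "x \<in> topspace X" "x \<notin> D" for x
    using that g0[of x] V(4) by (cases "x \<in> U \<inter> V") (auto simp: f_def D_def)
  have fC: "f \<in> Cc_nonneg X"
    unfolding f_def using D f0
    by (intro Cc_nonnegI[where C = D] continuous_map_real_max continuous_map_diff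
        continuous_map_real_mult_left gc) (auto simp: f_def)
  have f1: "f x \<le> 1" if "x \<in> topspace X" for x
    using gr[OF that] by (simp add: f_def)
  have fC1: "f x = 1" if "x \<in> C" for x
    using g(3) that by (auto simp: f_def image_subset_iff)
  show ?thesis
    by (rule that[OF fC f1 fC1 D DU f0])
qed

section \<open>Radon measures\<close>

lemma space_borel_of [simp]: "space (borel_of X) = topspace X"
  by (simp add: borel_of_def space_measure_of_conv)

lemma sets_borel_of: "sets (borel_of X) = sigma_sets (topspace X) {U. openin X U}"
  unfolding borel_of_def by (rule sets_measure_of) (auto dest: openin_subset)

lemma radon_sets: "radon_measure X \<mu> \<Longrightarrow> sets \<mu> = sets (borel_of X)"
  by (simp add: radon_measure_def)

lemma radon_space: "radon_measure X \<mu> \<Longrightarrow> space \<mu> = topspace X"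
  using sets_eq_imp_space_eq[OF radon_sets] by simp

lemma radon_open: "radon_measure X \<mu> \<Longrightarrow> openin X U \<Longrightarrow> U \<in> sets \<mu>"
  by (auto simp: radon_sets sets_borel_of)

lemma radon_closed:
  assumes "radon_measure X \<mu>" "closedin X C"
  shows "C \<in> sets \<mu>"
proof -
  have "topspace X - (topspace X - C) \<in> sets \<mu>"
    using assms radon_open[OF assms(1), of "topspace X - C"] radon_space[OF assms(1)]
    by (metis closedin_def sets.compl_sets)
  then show ?thesis
    using closedin_subset[OF assms(2)] by (simp add: double_diff)
qed

lemma radon_compact:
  "radon_measure X \<mu> \<Longrightarrow> Hausdorff_space X \<Longrightarrow> compactin X C \<Longrightarrow> C \<in> sets \<mu>"
  by (simp add: radon_closed compactin_imp_closedin)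

lemma radon_compact_finite: "radon_measure X \<mu> \<Longrightarrow> compactin X C \<Longrightarrow> emeasure \<mu> C < \<infinity>"
  by (simp add: radon_measure_def)

lemma radon_outer:
  "radon_measure X \<mu> \<Longrightarrow> A \<in> sets \<mu> \<Longrightarrow>
     emeasure \<mu> A = (INF U \<in> {U. openin X U \<and> A \<subseteq> U}. emeasure \<mu> U)"
  by (simp add: radon_measure_def)

lemma radon_inner:
  "radon_measure X \<mu> \<Longrightarrow> openin X U \<Longrightarrow>
     emeasure \<mu> U = (SUP C \<in> {C. compactin X C \<and> C \<subseteq> U}. emeasure \<mu> C)"
  by (simp add: radon_measure_def)

lemma radon_continuous_measurable:
  assumes "radon_measure X \<mu>" "continuous_map X euclidean f"
  shows "f \<in> borel_measurable \<mu>"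
proof (rule borel_measurableI)
  fix S :: "'b set"
  assume "open S"
  then have "openin X {x \<in> topspace X. f x \<in> S}"
    using assms(2) openin_continuous_map_preimage by fastforce
  moreover have "f -` S \<inter> space \<mu> = {x \<in> topspace X. f x \<in> S}"
    using radon_space[OF assms(1)] by auto
  ultimately show "f -` S \<inter> space \<mu> \<in> sets \<mu>"
    using radon_open[OF assms(1)] by simp
qed

lemma radon_integrable:
  fixes f :: "'a \<Rightarrow> 'b::{banach, second_countable_topology}"
  assumes "radon_measure X \<mu>" "Hausdorff_space X" "continuous_map X euclidean f"
    and "compactin X C" "\<And>x. x \<in> topspace X \<Longrightarrow> x \<notin> C \<Longrightarrow> f x = 0"
  shows "integrable \<mu> f"
proof -
  obtain M where "\<And>x. x \<in> C \<Longrightarrow> norm (f x) \<le> M"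
    using compact_bounded_image[OF assms(3,4)] by blast
  then show ?thesis
    using assms radon_space[OF assms(1)] radon_compact_finite[OF assms(1,4)]
    by (intro integrableI_bounded_set[where A = C and B = M] radon_compact radon_continuous_measurable)
      auto
qed

lemma radon_integrable_Cc:
  assumes "radon_measure X \<mu>" "Hausdorff_space X" "f \<in> Cc_nonneg X"
  shows "integrable \<mu> f"
  using assms(3) by (rule Cc_nonneg_support)
    (use radon_integrable[OF assms(1,2) Cc_nonneg_continuous[OF assms(3)]] in blast)

lemma radon_integral_mono:
  fixes f :: "'a \<Rightarrow> real"
  assumes "radon_measure X \<mu>" "integrable \<mu> f" "integrable \<mu> g" "\<And>x. x \<in> topspace X \<Longrightarrow> f x \<le> g x"
  shows "(\<integral>x. f x \<partial>\<mu>) \<le> (\<integral>x. g x \<partial>\<mu>)"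
  using assms radon_space[OF assms(1)] by (intro integral_mono) auto

lemma radon_integral_cong:
  assumes "radon_measure X \<mu>" "\<And>x. x \<in> topspace X \<Longrightarrow> f x = g x"
  shows "(\<integral>x. f x \<partial>\<mu>) = (\<integral>x. g x \<partial>\<mu>)"
  using assms radon_space[OF assms(1)] by (intro Bochner_Integration.integral_cong) auto

lemma radon_integral_ge:
  assumes "radon_measure X \<mu>" "Hausdorff_space X" "f \<in> Cc_nonneg X"
    and "compactin X C" "0 \<le> a" "\<And>x. x \<in> C \<Longrightarrow> a \<le> f x"
  shows "a * measure \<mu> C \<le> (\<integral>x. f x \<partial>\<mu>)"
proof -
  have C: "C \<in> sets \<mu>" "emeasure \<mu> C < \<infinity>"
    using radon_compact radon_compact_finite assms by blast+
  have i: "integrable \<mu> (\<lambda>x. a * indicator C x)"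
    using C by (intro integrable_mult_right integrable_real_indicator)
  have "a * measure \<mu> C = (\<integral>x. a * indicator C x \<partial>\<mu>)"
    using C by simp
  also have "\<dots> \<le> (\<integral>x. f x \<partial>\<mu>)"
    using assms by (intro radon_integral_mono[OF assms(1)] radon_integrable_Cc[OF assms(1-3)] i)
      (auto simp: indicator_def Cc_nonneg_nonneg)
  finally show ?thesis .
qed

lemma radon_integral_le:
  assumes "radon_measure X \<mu>" "Hausdorff_space X" "f \<in> Cc_nonneg X"
    and "compactin X C" "\<And>x. x \<in> topspace X \<Longrightarrow> f x \<le> a" "\<And>x. x \<in> topspace X \<Longrightarrow> x \<notin> C \<Longrightarrow> f x = 0"
  shows "(\<integral>x. f x \<partial>\<mu>) \<le> a * measure \<mu> C"
proof -
  have C: "C \<in> sets \<mu>" "emeasure \<mu> C < \<infinity>"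
    using radon_compact radon_compact_finite assms by blast+
  have i: "integrable \<mu> (\<lambda>x. a * indicator C x)"
    using C by (intro integrable_mult_right integrable_real_indicator)
  have "(\<integral>x. f x \<partial>\<mu>) \<le> (\<integral>x. a * indicator C x \<partial>\<mu>)"
    using assms by (intro radon_integral_mono[OF assms(1)] radon_integrable_Cc[OF assms(1-3)] i)
      (auto simp: indicator_def)
  also have "\<dots> = a * measure \<mu> C"
    using C by simp
  finally show ?thesis .
qed

text \<open>A Radon measure is determined by its integrals of functions in \<open>C\<^sub>c\<close>: these bound the measure
  of a compact subset of an open \<open>U\<close>, inner regularity gives the measure of \<open>U\<close>, and outer
  regularity that of all Borel sets.\<close>

lemma radon_measure_eqI:
  assumes lc: "locally_compact_space X" and hd: "Hausdorff_space X"
    and \<mu>: "radon_measure X \<mu>" and \<eta>: "radon_measure X \<eta>"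
    and eq: "\<And>f. f \<in> Cc_nonneg X \<Longrightarrow> (\<integral>x. f x \<partial>\<mu>) = (\<integral>x. f x \<partial>\<eta>)"
  shows "\<mu> = \<eta>"
proof (rule measure_eqI)
  have le: "emeasure \<mu> U \<le> emeasure \<eta> U"
    if m: "radon_measure X \<mu>" "radon_measure X \<eta>"
      and e: "\<And>f. f \<in> Cc_nonneg X \<Longrightarrow> (\<integral>x. f x \<partial>\<mu>) = (\<integral>x. f x \<partial>\<eta>)" and U: "openin X U"
    for \<mu> \<eta> U
    unfolding radon_inner[OF m(1) U]
  proof (rule SUP_least, clarify)
    fix C assume C: "compactin X C" "C \<subseteq> U"
    obtain f D where f: "f \<in> Cc_nonneg X" "\<And>x. x \<in> topspace X \<Longrightarrow> f x \<le> 1" "\<And>x. x \<in> C \<Longrightarrow> f x = 1"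
      and D: "compactin X D" "D \<subseteq> U" "\<And>x. x \<in> topspace X \<Longrightarrow> x \<notin> D \<Longrightarrow> f x = 0"
      using Urysohn_Cc[OF lc hd C(1) U C(2)] by blast
    have "measure \<mu> C \<le> (\<integral>x. f x \<partial>\<mu>)"
      using radon_integral_ge[OF m(1) hd f(1) C(1), of 1] f(3) by auto
    also have "\<dots> \<le> measure \<eta> D"
      using radon_integral_le[OF m(2) hd f(1) D(1), of 1] f(2) D(3) e[OF f(1)] by auto
    finally have "emeasure \<mu> C \<le> emeasure \<eta> D"
      using radon_compact_finite[OF m(1) C(1)] radon_compact_finite[OF m(2) D(1)]
      by (simp add: emeasure_eq_ennreal_measure ennreal_leI)
    also have "\<dots> \<le> emeasure \<eta> U"
      using D(2) radon_open[OF m(2) U] by (rule emeasure_mono)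
    finally show "emeasure \<mu> C \<le> emeasure \<eta> U" .
  qed
  then have open_eq: "emeasure \<mu> U = emeasure \<eta> U" if "openin X U" for U
    using \<mu> \<eta> eq that by (intro antisym le) auto
  show "sets \<mu> = sets \<eta>"
    using radon_sets \<mu> \<eta> by blast
  show "emeasure \<mu> A = emeasure \<eta> A" if "A \<in> sets \<mu>" for A
    using that radon_outer[OF \<mu> that] radon_outer[OF \<eta>, of A] radon_sets[OF \<mu>] radon_sets[OF \<eta>]
    by (simp add: open_eq cong: INF_cong_simp)
qed

text \<open>Inner regularity for continuous densities: although \<open>X\<close> need not be \<open>\<sigma>\<close>-compact, the mass of
  an integrable non-negative continuous function is carried by compact sets up to any \<open>\<epsilon>\<close>.\<close>

lemma radon_cutoff:
  assumes lc: "locally_compact_space X" and hd: "Hausdorff_space X" and \<mu>: "radon_measure X \<mu>"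
    and u: "continuous_map X euclideanreal u" "\<And>x. x \<in> topspace X \<Longrightarrow> 0 \<le> u x" "integrable \<mu> u"
    and e: "0 < e"
  obtains \<theta> where "\<theta> \<in> Cc_nonneg X" "\<And>x. x \<in> topspace X \<Longrightarrow> \<theta> x \<le> 1"
    "(\<integral>x. u x \<partial>\<mu>) - (\<integral>x. \<theta> x * u x \<partial>\<mu>) < e"
proof -
  note sp = radon_space[OF \<mu>]
  \<comment> \<open>The lower bound makes \<open>U n\<close> a set of finite measure, the upper bound controls \<open>u\<close> on the part
    of \<open>U n\<close> that an inner compact approximation misses.\<close>
  define U where "U = (\<lambda>n::nat. {x \<in> topspace X. 1 / real (Suc n) < u x} \<inter> {x \<in> topspace X. u x < real (Suc n)})"
  have oU: "openin X (U n)" for n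
    using u(1) continuous_map_upper_lower_semicontinuous_lt[of X u] by (auto simp: U_def)
  then have mU: "U n \<in> sets \<mu>" for n
    using radon_open[OF \<mu>] by blast
  have conv: "(\<lambda>n. \<integral>x. indicator (U n) x * u x \<partial>\<mu>) \<longlonglongrightarrow> (\<integral>x. u x \<partial>\<mu>)"
  proof (rule integral_dominated_convergence[where w = u])
    show "AE x in \<mu>. (\<lambda>n. indicator (U n) x * u x) \<longlonglongrightarrow> u x"
    proof (rule AE_I2)
      fix x assume x: "x \<in> space \<mu>"
      show "(\<lambda>n. indicator (U n) x * u x) \<longlonglongrightarrow> u x"
      proof (cases "u x = 0")
        case False
        then have pos: "0 < u x"
          using u(2) x sp by force
        have "\<forall>\<^sub>F n in sequentially. 1 / real (Suc n) < u x"
          using order_tendstoD(2)[OF LIMSEQ_Suc[OF lim_const_over_n[of 1]]] pos by simp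
        moreover have "\<forall>\<^sub>F n in sequentially. u x < real (Suc n)"
          using eventually_gt_at_top[of "nat \<lceil>u x\<rceil>"] by eventually_elim linarith
        ultimately have "\<forall>\<^sub>F n in sequentially. indicator (U n) x * u x = u x"
          by eventually_elim (use x sp in \<open>auto simp: U_def\<close>)
        then show ?thesis
          by (rule tendsto_eventually)
      qed simp
    qed
    show "AE x in \<mu>. norm (indicator (U n) x * u x) \<le> u x" for n
      using u(2) sp by (intro AE_I2) (auto simp: indicator_def)
  qed (use u mU radon_continuous_measurable[OF \<mu> u(1)] in auto)
  have "\<forall>\<^sub>F n in sequentially. dist (\<integral>x. indicator (U n) x * u x \<partial>\<mu>) (\<integral>x. u x \<partial>\<mu>) < e / 2"
    by (rule tendstoD[OF conv]) (use e in simp)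
  then obtain n where "dist (\<integral>x. indicator (U n) x * u x \<partial>\<mu>) (\<integral>x. u x \<partial>\<mu>) < e / 2"
    using eventually_sequentially by auto
  then have n: "(\<integral>x. u x \<partial>\<mu>) - (\<integral>x. indicator (U n) x * u x \<partial>\<mu>) < e / 2"
    unfolding dist_real_def by linarith
  have iUu: "integrable \<mu> (\<lambda>x. indicator (U n) x * u x)"
    using integrable_real_mult_indicator[OF mU u(3)] by (simp add: mult.commute)
  have [measurable]: "u \<in> borel_measurable \<mu>"
    by (rule radon_continuous_measurable[OF \<mu> u(1)])
  have "{x \<in> space \<mu>. 1 / real (Suc n) \<le> u x} \<in> sets \<mu>"
    by measurable
  then have "emeasure \<mu> (U n) \<le> emeasure \<mu> {x \<in> space \<mu>. 1 / real (Suc n) \<le> u x}"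
    using sp by (intro emeasure_mono) (auto simp: U_def)
  also have "\<dots> \<le> ennreal (1 / (1 / real (Suc n)) * (\<integral>x. u x \<partial>\<mu>))"
    using u(2) sp by (intro integral_Markov_inequality[OF u(3)] AE_I2) auto
  also have "\<dots> < \<infinity>"
    by simp
  finally have fin: "emeasure \<mu> (U n) < \<infinity>" .
  define d where "d = e / 2 / real (Suc n)"
  have d: "0 < d"
    using e by (simp add: d_def)
  obtain C where C: "compactin X C" "C \<subseteq> U n" "measure \<mu> (U n) < measure \<mu> C + d"
  proof (cases "measure \<mu> (U n) < d")
    case True
    then show ?thesis
      using that[of "{}"] by simp
  next
    case False
    have "ennreal (measure \<mu> (U n) - d) < emeasure \<mu> (U n)"
      using False fin d by (simp add: emeasure_eq_ennreal_measure ennreal_less_iff)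
    then obtain C where C: "compactin X C" "C \<subseteq> U n" "ennreal (measure \<mu> (U n) - d) < emeasure \<mu> C"
      using radon_inner[OF \<mu> oU[of n]] by (auto simp: less_SUP_iff)
    then have "measure \<mu> (U n) - d < measure \<mu> C"
      using False radon_compact_finite[OF \<mu> C(1)]
      by (simp add: emeasure_eq_ennreal_measure ennreal_less_iff)
    then show ?thesis
      using that C by simp
  qed
  have mC: "C \<in> sets \<mu>" and fC: "emeasure \<mu> C < \<infinity>"
    using radon_compact[OF \<mu> hd] radon_compact_finite[OF \<mu>] C(1) by blast+
  have UC: "measure \<mu> (U n - C) \<le> d"
  proof -
    have "measure \<mu> (U n) < measure \<mu> C + d"
      by (rule C(3))
    moreover have "measure \<mu> (U n - C) = measure \<mu> (U n) - measure \<mu> C"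
      using C(2) mC mU fin by (intro measure_Diff) auto
    ultimately show ?thesis
      by simp
  qed
  obtain \<theta> D where \<theta>: "\<theta> \<in> Cc_nonneg X" "\<And>x. x \<in> topspace X \<Longrightarrow> \<theta> x \<le> 1" "\<And>x. x \<in> C \<Longrightarrow> \<theta> x = 1"
    using Urysohn_Cc[OF lc hd C(1) oU C(2)] by metis
  have i\<theta>: "integrable \<mu> (\<lambda>x. \<theta> x * u x)"
    by (intro radon_integrable_Cc[OF \<mu> hd] Cc_nonneg_mult \<theta> u)
  have iUC: "integrable \<mu> (\<lambda>x. real (Suc n) * indicator (U n - C) x)"
    using mU mC fin emeasure_mono[of "U n - C" "U n" \<mu>]
    by (intro integrable_mult_right integrable_real_indicator) (auto simp: order_le_less_trans)
  have "(\<integral>x. indicator (U n) x * u x \<partial>\<mu>)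
      \<le> (\<integral>x. \<theta> x * u x + real (Suc n) * indicator (U n - C) x \<partial>\<mu>)"
  proof (rule radon_integral_mono[OF \<mu> iUu])
    show "integrable \<mu> (\<lambda>x. \<theta> x * u x + real (Suc n) * indicator (U n - C) x)"
      using i\<theta> iUC by simp
    show "indicator (U n) x * u x \<le> \<theta> x * u x + real (Suc n) * indicator (U n - C) x"
      if "x \<in> topspace X" for x
      using \<theta>(3)[of x] mult_nonneg_nonneg[OF Cc_nonneg_nonneg[OF \<theta>(1) that] u(2)[OF that]]
      by (auto simp: indicator_def U_def)
  qed
  also have "\<dots> = (\<integral>x. \<theta> x * u x \<partial>\<mu>) + real (Suc n) * measure \<mu> (U n - C)"
    using i\<theta> iUC mU mC sets.sets_into_space[OF mU] by (simp add: Int_absorb2 subset_trans)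
  also have "\<dots> \<le> (\<integral>x. \<theta> x * u x \<partial>\<mu>) + e / 2"
  proof -
    have "real (Suc n) * d = e / 2"
      by (simp add: d_def del: of_nat_Suc)
    then show ?thesis
      using mult_left_mono[OF UC of_nat_0_le_iff[of "Suc n"]] by argo
  qed
  finally have "(\<integral>x. u x \<partial>\<mu>) - (\<integral>x. \<theta> x * u x \<partial>\<mu>) < e"
    using n by linarith
  with \<theta>(1,2) show ?thesis
    by (rule that)
qed

section \<open>Integrals depending on a parameter\<close>

lemma continuous_map_real_locallyI:
  assumes "\<And>x e. x \<in> topspace X \<Longrightarrow> 0 < e \<Longrightarrow> \<exists>U. openin X U \<and> x \<in> U \<and> (\<forall>y\<in>U. \<bar>f y - f x\<bar> < e)"
  shows "continuous_map X euclideanreal f"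
  unfolding continuous_map_upper_lower_semicontinuous_lt
proof (intro conjI allI)
  fix a
  show "openin X {x \<in> topspace X. a < f x}"
  proof (subst openin_subopen, clarify)
    fix x assume x: "x \<in> topspace X" "a < f x"
    then obtain U where U: "openin X U" "x \<in> U" "\<forall>y\<in>U. \<bar>f y - f x\<bar> < f x - a"
      using assms[of x "f x - a"] by auto
    moreover have "U \<subseteq> {x \<in> topspace X. a < f x}"
      using openin_subset[OF U(1)] U(3) by force
    ultimately show "\<exists>T. openin X T \<and> x \<in> T \<and> T \<subseteq> {x \<in> topspace X. a < f x}"
      by blast
  qed
  show "openin X {x \<in> topspace X. f x < a}"
  proof (subst openin_subopen, clarify)
    fix x assume x: "x \<in> topspace X" "f x < a"
    then obtain U where U: "openin X U" "x \<in> U" "\<forall>y\<in>U. \<bar>f y - f x\<bar> < a - f x"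
      using assms[of x "a - f x"] by auto
    moreover have "U \<subseteq> {x \<in> topspace X. f x < a}"
      using openin_subset[OF U(1)] U(3) by force
    ultimately show "\<exists>T. openin X T \<and> x \<in> T \<and> T \<subseteq> {x \<in> topspace X. f x < a}"
      by blast
  qed
qed

lemma continuous_map_slice:
  assumes "continuous_map (prod_topology X Y) Z (\<lambda>p. F (fst p) (snd p))" "x \<in> topspace X"
  shows "continuous_map Y Z (F x)"
proof -
  have "continuous_map Y (prod_topology X Y) (\<lambda>y. (x, y))"
    using assms(2) by (simp add: continuous_map_paired)
  from continuous_map_compose[OF this assms(1)] show ?thesis
    by (simp add: o_def)
qed

lemma continuous_map_swap_args:
  assumes "continuous_map (prod_topology X Y) Z (\<lambda>p. F (fst p) (snd p))"
  shows "continuous_map (prod_topology Y X) Z (\<lambda>p. F (snd p) (fst p))"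
proof -
  have "continuous_map (prod_topology Y X) (prod_topology X Y) (\<lambda>p. (snd p, fst p))"
    by (simp add: continuous_map_paired continuous_map_fst continuous_map_snd)
  from continuous_map_compose[OF this assms] show ?thesis
    by (simp add: o_def)
qed

lemma continuous_map_uniform_on_compact:
  fixes F :: "'a \<Rightarrow> 'b \<Rightarrow> real"
  assumes F: "continuous_map (prod_topology X Y) euclideanreal (\<lambda>p. F (fst p) (snd p))"
    and C: "compactin Y C" and x0: "x0 \<in> topspace X" and e: "0 < e"
  obtains U where "openin X U" "x0 \<in> U" "\<And>x y. x \<in> U \<Longrightarrow> y \<in> C \<Longrightarrow> \<bar>F x y - F x0 y\<bar> < e"
proof -
  have "continuous_map (prod_topology X Y) euclideanreal (\<lambda>p. F x0 (snd p))"
    using continuous_map_compose[OF continuous_map_snd continuous_map_slice[OF F x0]]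
    by (simp add: o_def)
  then have "continuous_map (prod_topology X Y) euclideanreal
      (\<lambda>p. \<bar>F (fst p) (snd p) - F x0 (snd p)\<bar>)"
    by (intro continuous_map_real_abs continuous_map_diff F)
  then have W: "openin (prod_topology X Y)
      {p \<in> topspace (prod_topology X Y). \<bar>F (fst p) (snd p) - F x0 (snd p)\<bar> < e}" (is "openin _ ?W")
    by (rule continuous_map_upper_lower_semicontinuous_lt[THEN iffD1, THEN conjunct2, rule_format])
  moreover have "{x0} \<times> C \<subseteq> ?W"
    using x0 e compactin_subset_topspace[OF C] by auto
  ultimately obtain U V where UV: "openin X U" "x0 \<in> U" "C \<subseteq> V" "U \<times> V \<subseteq> ?W"
    using tube_lemma_right[OF W C x0] by blast
  show ?thesis
  proof (rule that[OF UV(1,2)])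
    fix x y assume "x \<in> U" "y \<in> C"
    then have "(x, y) \<in> ?W"
      using UV by blast
    then show "\<bar>F x y - F x0 y\<bar> < e"
      by simp
  qed
qed

lemma radon_integral_diff_le:
  fixes f g :: "'a \<Rightarrow> real"
  assumes "radon_measure X \<mu>" "Hausdorff_space X" "integrable \<mu> f" "integrable \<mu> g" "compactin X C"
    and "\<And>x. x \<in> topspace X \<Longrightarrow> \<bar>f x - g x\<bar> \<le> a * indicator C x"
  shows "\<bar>(\<integral>x. f x \<partial>\<mu>) - (\<integral>x. g x \<partial>\<mu>)\<bar> \<le> a * measure \<mu> C"
proof -
  have C: "C \<in> sets \<mu>" "emeasure \<mu> C < \<infinity>"
    using radon_compact radon_compact_finite assms by blast+
  have i: "integrable \<mu> (\<lambda>x. a * indicator C x)"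
    using C by (intro integrable_mult_right integrable_real_indicator)
  have "\<bar>(\<integral>x. f x \<partial>\<mu>) - (\<integral>x. g x \<partial>\<mu>)\<bar> = \<bar>\<integral>x. f x - g x \<partial>\<mu>\<bar>"
    using assms by simp
  also have "\<dots> \<le> (\<integral>x. \<bar>f x - g x\<bar> \<partial>\<mu>)"
    by (rule integral_abs_bound)
  also have "\<dots> \<le> (\<integral>x. a * indicator C x \<partial>\<mu>)"
    using assms(3,4) by (intro radon_integral_mono[OF assms(1) _ i assms(6)]) auto
  also have "\<dots> = a * measure \<mu> C"
    using C by simp
  finally show ?thesis .
qed

lemma continuous_map_parametric_integral:
  fixes F :: "'a \<Rightarrow> 'b \<Rightarrow> real"
  assumes \<eta>: "radon_measure Y \<eta>" and hd: "Hausdorff_space Y"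
    and F: "continuous_map (prod_topology X Y) euclideanreal (\<lambda>p. F (fst p) (snd p))"
    and loc: "\<And>x. x \<in> topspace X \<Longrightarrow> \<exists>U C. openin X U \<and> x \<in> U \<and> compactin Y C \<and>
      (\<forall>u\<in>U. \<forall>y\<in>topspace Y - C. F u y = 0)"
  shows "continuous_map X euclideanreal (\<lambda>x. \<integral>y. F x y \<partial>\<eta>)"
proof (rule continuous_map_real_locallyI)
  fix x0 and e :: real assume x0: "x0 \<in> topspace X" and e: "0 < e"
  obtain U C where U: "openin X U" "x0 \<in> U" and C: "compactin Y C"
    and z: "\<And>u y. u \<in> U \<Longrightarrow> y \<in> topspace Y \<Longrightarrow> y \<notin> C \<Longrightarrow> F u y = 0"
    using loc[OF x0] by blast
  define d where "d = e / (measure \<eta> C + 1)"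
  have m: "0 < measure \<eta> C + 1"
    by (simp add: add_nonneg_pos)
  then have d: "0 < d"
    using e by (simp add: d_def)
  obtain V where V: "openin X V" "x0 \<in> V" "\<And>x y. x \<in> V \<Longrightarrow> y \<in> C \<Longrightarrow> \<bar>F x y - F x0 y\<bar> < d"
    using continuous_map_uniform_on_compact[OF F C x0 d] by blast
  have int: "integrable \<eta> (F x)" if "x \<in> U" for x
    using continuous_map_slice[OF F] openin_subset[OF U(1)] that z
    by (intro radon_integrable[OF \<eta> hd _ C]) auto
  have "\<bar>(\<integral>y. F x y \<partial>\<eta>) - (\<integral>y. F x0 y \<partial>\<eta>)\<bar> < e" if x: "x \<in> U \<inter> V" for x
  proof -
    have "\<bar>(\<integral>y. F x y \<partial>\<eta>) - (\<integral>y. F x0 y \<partial>\<eta>)\<bar> \<le> d * measure \<eta> C"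
    proof (rule radon_integral_diff_le[OF \<eta> hd int int C])
      show "\<bar>F x y - F x0 y\<bar> \<le> d * indicator C y" if "y \<in> topspace Y" for y
        using z[of x y] z[of x0 y] V(3)[of x y] x U(2) that by (cases "y \<in> C") auto
    qed (use x U in auto)
    also have "\<dots> < d * (measure \<eta> C + 1)"
      using d by simp
    also have "\<dots> = e"
      using m by (simp add: d_def)
    finally show ?thesis .
  qed
  then show "\<exists>U. openin X U \<and> x0 \<in> U \<and> (\<forall>x\<in>U. \<bar>(\<integral>y. F x y \<partial>\<eta>) - (\<integral>y. F x0 y \<partial>\<eta>)\<bar> < e)"
    using U V by (intro exI[of _ "U \<inter> V"]) auto
qed

lemma continuous_map_parametric_integral_compact:
  fixes F :: "'a \<Rightarrow> 'b \<Rightarrow> real"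
  assumes "radon_measure Y \<eta>" "Hausdorff_space Y"
    and "continuous_map (prod_topology X Y) euclideanreal (\<lambda>p. F (fst p) (snd p))"
    and "compactin Y C" "\<And>x y. x \<in> topspace X \<Longrightarrow> y \<in> topspace Y \<Longrightarrow> y \<notin> C \<Longrightarrow> F x y = 0"
  shows "continuous_map X euclideanreal (\<lambda>x. \<integral>y. F x y \<partial>\<eta>)"
  using assms by (intro continuous_map_parametric_integral) auto

text \<open>Fubini's theorem for a continuous function with compact support. No \<open>\<sigma>\<close>-finiteness and no
  product measure is needed: the function is uniformly close to a finite sum
  \<open>\<Sum>i. 1\<^sub>B\<^sub>i(x) F(x\<^sub>i, y)\<close> for a Borel partition \<open>B\<^sub>i\<close> of the compact set of relevant \<open>x\<close>.\<close>

lemma radon_integral_swap: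
  fixes F :: "'a \<Rightarrow> 'b \<Rightarrow> real"
  assumes \<mu>: "radon_measure X \<mu>" and hX: "Hausdorff_space X"
    and \<eta>: "radon_measure Y \<eta>" and hY: "Hausdorff_space Y"
    and F: "continuous_map (prod_topology X Y) euclideanreal (\<lambda>p. F (fst p) (snd p))"
    and C: "compactin X C" and D: "compactin Y D"
    and zC: "\<And>x y. x \<in> topspace X \<Longrightarrow> y \<in> topspace Y \<Longrightarrow> x \<notin> C \<Longrightarrow> F x y = 0"
    and zD: "\<And>x y. x \<in> topspace X \<Longrightarrow> y \<in> topspace Y \<Longrightarrow> y \<notin> D \<Longrightarrow> F x y = 0"
  shows "(\<integral>x. (\<integral>y. F x y \<partial>\<eta>) \<partial>\<mu>) = (\<integral>y. (\<integral>x. F x y \<partial>\<mu>) \<partial>\<eta>)"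
proof -
  note F' = continuous_map_swap_args[OF F]
  have CX: "C \<subseteq> topspace X"
    by (rule compactin_subset_topspace[OF C])
  have mC: "C \<in> sets \<mu>" "emeasure \<mu> C < \<infinity>"
    using radon_compact[OF \<mu> hX C] radon_compact_finite[OF \<mu> C] by auto
  have iF: "integrable \<eta> (F x)" if "x \<in> topspace X" for x
    using zD that by (intro radon_integrable[OF \<eta> hY continuous_map_slice[OF F that] D]) auto
  have iF': "integrable \<mu> (\<lambda>x. F x y)" if "y \<in> topspace Y" for y
    using zC that by (intro radon_integrable[OF \<mu> hX continuous_map_slice[OF F' that] C]) auto
  have iX: "integrable \<mu> (\<lambda>x. \<integral>y. F x y \<partial>\<eta>)"
  proof (rule radon_integrable[OF \<mu> hX _ C])
    show "continuous_map X euclideanreal (\<lambda>x. \<integral>y. F x y \<partial>\<eta>)"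
      using zD by (rule continuous_map_parametric_integral_compact[OF \<eta> hY F D])
    show "(\<integral>y. F x y \<partial>\<eta>) = 0" if "x \<in> topspace X" "x \<notin> C" for x
      using radon_integral_cong[OF \<eta>, of "F x" "\<lambda>y. 0"] zC that by simp
  qed
  have iY: "integrable \<eta> (\<lambda>y. \<integral>x. F x y \<partial>\<mu>)"
  proof (rule radon_integrable[OF \<eta> hY _ D])
    show "continuous_map Y euclideanreal (\<lambda>y. \<integral>x. F x y \<partial>\<mu>)"
      using zC by (intro continuous_map_parametric_integral_compact[OF \<mu> hX F' C])
    show "(\<integral>x. F x y \<partial>\<mu>) = 0" if "y \<in> topspace Y" "y \<notin> D" for y
      using radon_integral_cong[OF \<mu>, of "\<lambda>x. F x y" "\<lambda>x. 0"] zD that by simp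
  qed
  have le: "\<bar>(\<integral>x. (\<integral>y. F x y \<partial>\<eta>) \<partial>\<mu>) - (\<integral>y. (\<integral>x. F x y \<partial>\<mu>) \<partial>\<eta>)\<bar>
      \<le> 2 * (measure \<mu> C * measure \<eta> D) * e" if e: "0 < e" for e
  proof -
    have "\<exists>U. openin X U \<and> x \<in> U \<and> (\<forall>z\<in>U. \<forall>y\<in>D. \<bar>F z y - F x y\<bar> < e)" if "x \<in> C" for x
      using continuous_map_uniform_on_compact[OF F D _ e] that CX by (metis subsetD)
    then obtain U where U: "\<And>x. x \<in> C \<Longrightarrow> openin X (U x)" "\<And>x. x \<in> C \<Longrightarrow> x \<in> U x"
      and Ue: "\<And>x z y. x \<in> C \<Longrightarrow> z \<in> U x \<Longrightarrow> y \<in> D \<Longrightarrow> \<bar>F z y - F x y\<bar> < e"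
      by metis
    have cov: "C \<subseteq> (\<Union>x\<in>C. U x)"
      using U(2) by blast
    obtain C0 where C0: "finite C0" "C0 \<subseteq> C" "C \<subseteq> (\<Union>x\<in>C0. U x)"
      by (rule compactin_finite_subcover[OF C U(1) cov])
    obtain p and n :: nat where p: "C0 = p ` {i. i < n}"
      using finite_imp_nat_seg_image_inj_on[OF C0(1)] by metis
    define B where "B = disjointed (\<lambda>i. C \<inter> U (p i))"
    have pC: "p i \<in> C" if "i < n" for i
      using p C0(2) that by auto
    have BU: "B i \<subseteq> C \<inter> U (p i)" for i
      unfolding B_def by (rule disjointed_subset)
    have UB: "(\<Union>i\<in>{0..<n}. B i) = C"
      using p C0(3) unfolding B_def finite_UN_disjointed_eq by fastforce
    have mB: "B i \<in> sets \<mu>" "emeasure \<mu> (B i) < \<infinity>" if "i < n" for i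
    proof -
      have "C \<inter> U (p j) \<in> sets \<mu>" if "j < n" for j
        using mC(1) radon_open[OF \<mu> U(1)[OF pC[OF that]]] by auto
      then show "B i \<in> sets \<mu>"
        using that unfolding B_def disjointed_def by (intro sets.Diff sets.finite_UN) auto
      show "emeasure \<mu> (B i) < \<infinity>"
        using emeasure_mono[of "B i" C \<mu>] BU[of i] mC by (auto intro: order_le_less_trans)
    qed
    define S where "S = (\<lambda>x y. \<Sum>i<n. indicator (B i) x * F (p i) y)"
    have S_le: "\<bar>F x y - S x y\<bar> \<le> e * indicator C x * indicator D y"
      if x: "x \<in> topspace X" and y: "y \<in> topspace Y" for x y
    proof (cases "x \<in> C")
      case True
      then obtain i where i: "i < n" "x \<in> B i"
        using UB by auto
      have uniq: "j = i" if "x \<in> B j" for j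
        using disjoint_family_disjointed[of "\<lambda>i. C \<inter> U (p i)"] i(2) that
        by (auto simp: B_def disjoint_family_on_def)
      have "indicator (B j) x * F (p j) y = (if j = i then F (p i) y else 0)" for j
      proof (cases "j = i")
        case False
        then have "x \<notin> B j"
          using uniq by blast
        then show ?thesis
          using False by simp
      qed (simp add: i(2))
      then have "S x y = (\<Sum>j<n. if j = i then F (p i) y else 0)"
        unfolding S_def by (rule sum.cong[OF refl])
      also have "\<dots> = F (p i) y"
        using i(1) by simp
      finally have "S x y = F (p i) y" .
      then show ?thesis
        using Ue[OF pC[OF i(1)], of x y] BU[of i] i True zD[OF x y] zD[of "p i" y] pC[OF i(1)] CX y
        by (cases "y \<in> D") auto
    next
      case False
      then have "S x y = 0"
        using BU unfolding S_def by (intro sum.neutral) (auto simp: indicator_def)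
      then show ?thesis
        using zC[OF x y False] False by simp
    qed
    define c where "c = (\<lambda>i. \<integral>y. F (p i) y \<partial>\<eta>)"
    have iB: "integrable \<mu> (\<lambda>x. indicator (B i) x * a)" if "i < n" for i and a :: real
      using mB[OF that] by (intro integrable_mult_left integrable_real_indicator)
    have iFp: "integrable \<eta> (\<lambda>y. a * F (p i) y)" if "i < n" for i a
      using iF[of "p i"] pC[OF that] CX by auto
    have SX: "(\<integral>y. S x y \<partial>\<eta>) = (\<Sum>i<n. indicator (B i) x * c i)" for x
      unfolding S_def c_def using iFp by (subst Bochner_Integration.integral_sum) auto
    have SY: "(\<integral>x. S x y \<partial>\<mu>) = (\<Sum>i<n. measure \<mu> (B i) * F (p i) y)" for y
      unfolding S_def using iB mB by (subst Bochner_Integration.integral_sum) auto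
    have iSX: "integrable \<eta> (S x)" for x
      unfolding S_def using iFp by (intro Bochner_Integration.integrable_sum) auto
    have iSY: "integrable \<mu> (\<lambda>x. S x y)" for y
      unfolding S_def using iB by (intro Bochner_Integration.integrable_sum) auto
    have iSXX: "integrable \<mu> (\<lambda>x. \<integral>y. S x y \<partial>\<eta>)"
      unfolding SX using iB by (intro Bochner_Integration.integrable_sum) auto
    have iSYY: "integrable \<eta> (\<lambda>y. \<integral>x. S x y \<partial>\<mu>)"
      unfolding SY using iFp by (intro Bochner_Integration.integrable_sum) auto
    have SS: "(\<integral>x. (\<integral>y. S x y \<partial>\<eta>) \<partial>\<mu>) = (\<integral>y. (\<integral>x. S x y \<partial>\<mu>) \<partial>\<eta>)"
    proof -
      have "(\<integral>x. (\<integral>y. S x y \<partial>\<eta>) \<partial>\<mu>) = (\<Sum>i<n. measure \<mu> (B i) * c i)"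
        unfolding SX using iB mB by (subst Bochner_Integration.integral_sum) auto
      also have "\<dots> = (\<integral>y. (\<integral>x. S x y \<partial>\<mu>) \<partial>\<eta>)"
        unfolding SY c_def using iFp by (subst Bochner_Integration.integral_sum) auto
      finally show ?thesis .
    qed
    have 1: "\<bar>(\<integral>x. (\<integral>y. F x y \<partial>\<eta>) \<partial>\<mu>) - (\<integral>x. (\<integral>y. S x y \<partial>\<eta>) \<partial>\<mu>)\<bar> \<le> (e * measure \<eta> D) * measure \<mu> C"
    proof (rule radon_integral_diff_le[OF \<mu> hX iX iSXX C])
      fix x assume x: "x \<in> topspace X"
      have "\<bar>(\<integral>y. F x y \<partial>\<eta>) - (\<integral>y. S x y \<partial>\<eta>)\<bar> \<le> (e * indicator C x) * measure \<eta> D"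
        using S_le[OF x] by (intro radon_integral_diff_le[OF \<eta> hY iF[OF x] iSX D]) auto
      then show "\<bar>(\<integral>y. F x y \<partial>\<eta>) - (\<integral>y. S x y \<partial>\<eta>)\<bar> \<le> e * measure \<eta> D * indicator C x"
        by (simp add: mult_ac)
    qed
    have 2: "\<bar>(\<integral>y. (\<integral>x. F x y \<partial>\<mu>) \<partial>\<eta>) - (\<integral>y. (\<integral>x. S x y \<partial>\<mu>) \<partial>\<eta>)\<bar> \<le> (e * measure \<mu> C) * measure \<eta> D"
    proof (rule radon_integral_diff_le[OF \<eta> hY iY iSYY D])
      fix y assume y: "y \<in> topspace Y"
      have "\<bar>(\<integral>x. F x y \<partial>\<mu>) - (\<integral>x. S x y \<partial>\<mu>)\<bar> \<le> (e * indicator D y) * measure \<mu> C"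
        using S_le[OF _ y]
        by (intro radon_integral_diff_le[OF \<mu> hX iF'[OF y] iSY C]) (auto simp: mult_ac)
      then show "\<bar>(\<integral>x. F x y \<partial>\<mu>) - (\<integral>x. S x y \<partial>\<mu>)\<bar> \<le> e * measure \<mu> C * indicator D y"
        by (simp add: mult_ac)
    qed
    show ?thesis
      using 1 2 unfolding SS by (simp add: mult_ac)
  qed
  define m where "m = 2 * (measure \<mu> C * measure \<eta> D)"
  have m: "0 \<le> m"
    by (simp add: m_def)
  have "\<bar>(\<integral>x. (\<integral>y. F x y \<partial>\<eta>) \<partial>\<mu>) - (\<integral>y. (\<integral>x. F x y \<partial>\<mu>) \<partial>\<eta>)\<bar> \<le> 0 + d" if d: "0 < d" for d
  proof -
    have "\<bar>(\<integral>x. (\<integral>y. F x y \<partial>\<eta>) \<partial>\<mu>) - (\<integral>y. (\<integral>x. F x y \<partial>\<mu>) \<partial>\<eta>)\<bar> \<le> m * (d / (m + 1))"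
      using le[of "d / (m + 1)"] m d unfolding m_def[symmetric] by simp
    also have "\<dots> \<le> d"
      using m d by (simp add: field_simps)
    finally show ?thesis
      by simp
  qed
  then have "\<bar>(\<integral>x. (\<integral>y. F x y \<partial>\<eta>) \<partial>\<mu>) - (\<integral>y. (\<integral>x. F x y \<partial>\<mu>) \<partial>\<eta>)\<bar> \<le> 0"
    by (rule field_le_epsilon)
  then show ?thesis
    by simp
qed

section \<open>The Riesz representation theorem\<close>

text \<open>A positive linear functional on \<open>C\<^sub>c\<close> of a locally compact Hausdorff space, given by its
  values on the cone of non-negative functions.\<close>

locale positive_functional =
  fixes X :: "'a topology" and I :: "('a \<Rightarrow> real) \<Rightarrow> real"
  assumes lc: "locally_compact_space X" and hd: "Hausdorff_space X"
    and I_add: "\<And>f g. f \<in> Cc_nonneg X \<Longrightarrow> g \<in> Cc_nonneg X \<Longrightarrow> I (\<lambda>x. f x + g x) = I f + I g"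
    and I_cmult: "\<And>f c. f \<in> Cc_nonneg X \<Longrightarrow> 0 \<le> c \<Longrightarrow> I (\<lambda>x. c * f x) = c * I f"
    and I_mono: "\<And>f g. f \<in> Cc_nonneg X \<Longrightarrow> g \<in> Cc_nonneg X \<Longrightarrow>
      (\<And>x. x \<in> topspace X \<Longrightarrow> f x \<le> g x) \<Longrightarrow> I f \<le> I g"
begin

lemma I_cong:
  assumes "f \<in> Cc_nonneg X" "\<And>x. x \<in> topspace X \<Longrightarrow> f x = g x"
  shows "I f = I g"
  using assms Cc_nonneg_cong[OF assms] by (intro antisym I_mono) auto

lemma I_zero:
  assumes "f \<in> Cc_nonneg X" "\<And>x. x \<in> topspace X \<Longrightarrow> f x = 0"
  shows "I f = 0"
proof -
  have "I f = I (\<lambda>x. 0 * f x)"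
    using assms by (intro I_cong) auto
  also have "\<dots> = 0"
    using I_cmult[OF assms(1), of 0] by simp
  finally show ?thesis .
qed

lemma I_nonneg:
  assumes "f \<in> Cc_nonneg X"
  shows "0 \<le> I f"
  using I_mono[OF Cc_nonneg_zero assms] I_zero[OF Cc_nonneg_zero] Cc_nonneg_nonneg[OF assms] by simp

text \<open>The functions \<open>0 \<le> f \<le> 1\<close> in \<open>C\<^sub>c\<close> that vanish off \<open>U\<close>.\<close>

definition below :: "'a set \<Rightarrow> ('a \<Rightarrow> real) set" where
  "below U = {f \<in> Cc_nonneg X. (\<forall>x\<in>topspace X. f x \<le> 1) \<and> (\<forall>x\<in>topspace X - U. f x = 0)}"

text \<open>The measure of an open set, and the outer measure it induces. The functions in the
  supremum vanish off \<open>U\<close>, but their supports need not lie in \<open>U\<close>; this does not change the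
  supremum, by the lemma \<open>below_shrink\<close>.\<close>

definition open_content :: "'a set \<Rightarrow> ennreal" where
  "open_content U = (SUP f \<in> below U. ennreal (I f))"

definition outer :: "'a set \<Rightarrow> ennreal" where
  "outer E = (INF U \<in> {U. openin X U \<and> E \<subseteq> U}. open_content U)"

lemma zero_below: "(\<lambda>x. 0) \<in> below U"
  by (auto simp: below_def Cc_nonneg_zero)

lemma open_content_upper: "f \<in> below U \<Longrightarrow> ennreal (I f) \<le> open_content U"
  unfolding open_content_def by (rule SUP_upper)

lemma open_content_mono: "U \<subseteq> V \<Longrightarrow> open_content U \<le> open_content V"
  unfolding open_content_def by (intro SUP_subset_mono) (auto simp: below_def)

lemma outer_le_open_content: "openin X U \<Longrightarrow> E \<subseteq> U \<Longrightarrow> outer E \<le> open_content U"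
  unfolding outer_def by (rule INF_lower) simp

lemma outer_mono: "E \<subseteq> F \<Longrightarrow> outer E \<le> outer F"
  unfolding outer_def by (rule INF_superset_mono) auto

lemma outer_open: "openin X U \<Longrightarrow> outer U = open_content U"
  unfolding outer_def by (intro antisym INF_lower INF_greatest open_content_mono) auto

lemma outer_empty: "outer {} = 0"
proof -
  have "I f = 0" if "f \<in> below {}" for f
    using that by (intro I_zero) (auto simp: below_def)
  then have "open_content {} \<le> 0"
    unfolding open_content_def by (intro SUP_least) simp
  then show ?thesis
    using outer_open[OF openin_empty] by simp
qed

text \<open>Replacing \<open>f\<close> by \<open>max (f - d) 0\<close> with small \<open>d\<close> moves the support into the compact subset
  \<open>{f \<ge> d}\<close> of \<open>U\<close> and changes \<open>I f\<close> by little.\<close>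

lemma below_shrink:
  assumes f: "f \<in> below U" and e: "0 < e"
  obtains g C where "g \<in> Cc_nonneg X" "\<And>x. x \<in> topspace X \<Longrightarrow> g x \<le> 1" "compactin X C" "C \<subseteq> U"
    "\<And>x. x \<in> topspace X \<Longrightarrow> x \<notin> C \<Longrightarrow> g x = 0" "I f \<le> I g + e"
proof -
  have fC: "f \<in> Cc_nonneg X" and f1: "\<And>x. x \<in> topspace X \<Longrightarrow> f x \<le> 1"
    and fU: "\<And>x. x \<in> topspace X \<Longrightarrow> x \<notin> U \<Longrightarrow> f x = 0"
    using f by (auto simp: below_def)
  obtain D where D: "compactin X D" "\<And>x. x \<in> topspace X \<Longrightarrow> x \<notin> D \<Longrightarrow> f x = 0"
    using Cc_nonneg_support[OF fC] by blast
  have DX: "D \<subseteq> topspace X"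
    using D(1) by (rule compactin_subset_topspace)
  obtain h where h: "h \<in> Cc_nonneg X" "\<And>x. x \<in> D \<Longrightarrow> h x = 1"
    using Urysohn_Cc[OF lc hd D(1) openin_topspace DX] by metis
  define d where "d = e / (I h + 1)"
  have h1: "0 < I h + 1"
    using I_nonneg[OF h(1)] by simp
  then have d: "0 < d"
    using e by (simp add: d_def)
  define g where "g = (\<lambda>x. max (f x - d) 0)"
  define C where "C = {x \<in> D. d \<le> f x}"
  have g: "g \<in> Cc_nonneg X"
    unfolding g_def using d by (intro Cc_nonneg_diff_const fC) simp
  show ?thesis
  proof (rule that[OF g])
    show "g x \<le> 1" if "x \<in> topspace X" for x
      using f1[OF that] d by (simp add: g_def)
    show "compactin X C"
      unfolding C_def by (rule compactin_superlevel[OF hd D(1) Cc_nonneg_continuous[OF fC]])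
    show "C \<subseteq> U"
      using fU DX d by (force simp: C_def)
    show "g x = 0" if "x \<in> topspace X" "x \<notin> C" for x
      using that D(2)[OF that(1)] d by (cases "x \<in> D") (auto simp: C_def g_def)
    have dh: "(\<lambda>x. d * h x) \<in> Cc_nonneg X"
      using d by (intro Cc_nonneg_cmult h) simp
    have "I f \<le> I (\<lambda>x. g x + d * h x)"
    proof (rule I_mono[OF fC Cc_nonneg_add[OF g dh]])
      show "f x \<le> g x + d * h x" if "x \<in> topspace X" for x
        using D(2)[OF that] h(2)[of x] Cc_nonneg_nonneg[OF dh that]
        by (cases "x \<in> D") (auto simp: g_def)
    qed
    also have "\<dots> = I g + d * I h"
      using I_add[OF g dh] I_cmult[OF h(1)] d by simp
    also have "d * I h \<le> d * (I h + 1)"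
      using d by simp
    also have "d * (I h + 1) = e"
      using h1 by (simp add: d_def)
    finally show "I f \<le> I g + e"
      by simp
  qed
qed

text \<open>Finite subadditivity. In place of a partition of unity, the induction splits
  \<open>f = f g + f (1 - g)\<close>, where \<open>g\<close> is \<open>1\<close> on the part of the support outside one of the open sets.\<close>

lemma I_le_sum_open_content:
  assumes "finite F" "\<And>i. i \<in> F \<Longrightarrow> openin X (U i)" "compactin X C" "C \<subseteq> (\<Union>i\<in>F. U i)"
    and "f \<in> Cc_nonneg X" "\<And>x. x \<in> topspace X \<Longrightarrow> f x \<le> 1"
    and "\<And>x. x \<in> topspace X \<Longrightarrow> x \<notin> C \<Longrightarrow> f x = 0"
  shows "ennreal (I f) \<le> (\<Sum>i\<in>F. open_content (U i))"
  using assms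
proof (induction F arbitrary: C f rule: finite_induct)
  case empty
  then show ?case
    using I_zero[of f] by auto
next
  case (insert j F)
  note f = insert.prems(4)
  have oj: "openin X (U j)" and oF: "openin X (\<Union>i\<in>F. U i)"
    using insert.prems(1) by auto
  have cl: "closedin X (C - U j)"
    using compactin_imp_closedin[OF hd insert.prems(2)] oj by (rule closedin_diff)
  have C': "compactin X (C - U j)"
    using closed_compactin[OF insert.prems(2) _ cl] by auto
  have "C - U j \<subseteq> (\<Union>i\<in>F. U i)"
    using insert.prems(3) by auto
  then obtain g D where g: "g \<in> Cc_nonneg X" "\<And>x. x \<in> topspace X \<Longrightarrow> g x \<le> 1"
      "\<And>x. x \<in> C - U j \<Longrightarrow> g x = 1" "compactin X D" "D \<subseteq> (\<Union>i\<in>F. U i)"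
      "\<And>x. x \<in> topspace X \<Longrightarrow> x \<notin> D \<Longrightarrow> g x = 0"
    using Urysohn_Cc[OF lc hd C' oF] by metis
  have f1: "(\<lambda>x. f x * g x) \<in> Cc_nonneg X"
    by (intro Cc_nonneg_mult f Cc_nonneg_continuous g(1) Cc_nonneg_nonneg[OF g(1)])
  have f2: "(\<lambda>x. f x * (1 - g x)) \<in> Cc_nonneg X"
    using g(2) by (intro Cc_nonneg_mult f continuous_map_diff continuous_map_canonical_const
        Cc_nonneg_continuous[OF g(1)]) auto
  have "ennreal (I (\<lambda>x. f x * g x)) \<le> (\<Sum>i\<in>F. open_content (U i))"
  proof (rule insert.IH[OF _ g(4,5) f1])
    show "f x * g x \<le> 1" if "x \<in> topspace X" for x
      using insert.prems(5)[OF that] g(2)[OF that] Cc_nonneg_nonneg[OF f that] Cc_nonneg_nonneg[OF g(1) that]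
      by (simp add: mult_le_one)
  qed (use insert.prems(1) g(6) in auto)
  moreover have "(\<lambda>x. f x * (1 - g x)) \<in> below (U j)"
  proof -
    have "f x * (1 - g x) \<le> 1" if "x \<in> topspace X" for x
      using insert.prems(5)[OF that] g(2)[OF that] Cc_nonneg_nonneg[OF f that] Cc_nonneg_nonneg[OF g(1) that]
      by (simp add: mult_le_one)
    moreover have "f x * (1 - g x) = 0" if "x \<in> topspace X" "x \<notin> U j" for x
      using insert.prems(6)[OF that(1)] g(3)[of x] that by (cases "x \<in> C") auto
    ultimately show ?thesis
      using f2 by (auto simp: below_def)
  qed
  then have "ennreal (I (\<lambda>x. f x * (1 - g x))) \<le> open_content (U j)"
    by (rule open_content_upper)
  moreover have "I f = I (\<lambda>x. f x * g x) + I (\<lambda>x. f x * (1 - g x))"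
    using I_add[OF f1 f2] by (simp add: algebra_simps)
  ultimately show ?case
    using insert.hyps I_nonneg[OF f1] I_nonneg[OF f2]
    by (simp add: add.commute[of "open_content (U j)"] add_mono)
qed

lemma open_content_UN_le:
  fixes U :: "nat \<Rightarrow> 'a set"
  assumes "\<And>i. openin X (U i)"
  shows "open_content (\<Union>i. U i) \<le> (\<Sum>i. open_content (U i))"
  unfolding open_content_def[of "\<Union>i. U i"]
proof (rule SUP_least, rule ennreal_le_epsilon)
  fix f and e :: real assume f: "f \<in> below (\<Union>i. U i)" and e: "0 < e"
  obtain g C where g: "g \<in> Cc_nonneg X" "\<And>x. x \<in> topspace X \<Longrightarrow> g x \<le> 1" "compactin X C" "C \<subseteq> (\<Union>i. U i)"
    "\<And>x. x \<in> topspace X \<Longrightarrow> x \<notin> C \<Longrightarrow> g x = 0" "I f \<le> I g + e"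
    using below_shrink[OF f e] by blast
  obtain F where F: "finite F" "C \<subseteq> (\<Union>i\<in>F. U i)"
    by (rule compactin_finite_subcover[OF g(3) assms g(4)])
  have "ennreal (I f) \<le> ennreal (I g) + ennreal e"
    using g(6) I_nonneg[OF g(1)] e by (metis ennreal_leI ennreal_plus less_imp_le)
  also have "ennreal (I g) \<le> (\<Sum>i\<in>F. open_content (U i))"
    using assms by (intro I_le_sum_open_content[OF F(1) _ g(3) F(2) g(1)] g) auto
  also have "\<dots> \<le> (\<Sum>i. open_content (U i))"
    by (rule sum_le_suminf[OF summableI F(1)]) auto
  finally show "ennreal (I f) \<le> (\<Sum>i. open_content (U i)) + ennreal e"
    by (simp add: add_right_mono)
qed

lemma outer_UN_le:
  fixes A :: "nat \<Rightarrow> 'a set"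
  assumes "\<And>i. A i \<subseteq> topspace X"
  shows "outer (\<Union>i. A i) \<le> (\<Sum>i. outer (A i))"
proof (rule ennreal_le_epsilon)
  fix e :: real assume fin: "(\<Sum>i. outer (A i)) < top_class.top" and e: "0 < e"
  have "\<exists>U. openin X U \<and> A i \<subseteq> U \<and> open_content U \<le> outer (A i) + ennreal (e * (1/2) ^ Suc i)" for i
  proof -
    have "outer (A i) \<noteq> \<infinity>"
      using fin by (auto simp: less_top dest!: ennreal_suminf_lessD)
    then have "\<exists>U\<in>{U. openin X U \<and> A i \<subseteq> U}. open_content U < outer (A i) + ennreal (e * (1/2) ^ Suc i)"
      using e by (intro INF_approx_ennreal[OF _ outer_def]) auto
    then show ?thesis
      by (auto intro: less_imp_le)
  qed
  then obtain U where U: "\<And>i. openin X (U i)" "\<And>i. A i \<subseteq> U i"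
      "\<And>i. open_content (U i) \<le> outer (A i) + ennreal (e * (1/2) ^ Suc i)"
    by metis
  have "outer (\<Union>i. A i) \<le> open_content (\<Union>i. U i)"
    using U by (intro outer_le_open_content) auto
  also have "\<dots> \<le> (\<Sum>i. open_content (U i))"
    by (rule open_content_UN_le[OF U(1)])
  also have "\<dots> \<le> (\<Sum>i. outer (A i) + ennreal (e * (1/2) ^ Suc i))"
    by (intro suminf_le summableI U(3))
  also have "\<dots> = (\<Sum>i. outer (A i)) + (\<Sum>i. ennreal (e * (1/2) ^ Suc i))"
    by (intro suminf_add[symmetric] summableI)
  also have "(\<Sum>i. ennreal (e * (1/2) ^ Suc i)) = ennreal e"
    using sums_mult[OF power_half_series, of e] e by (intro suminf_ennreal_eq) auto
  finally show "outer (\<Union>i. A i) \<le> (\<Sum>i. outer (A i)) + ennreal e" .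
qed

lemma outer_measure_space_outer: "outer_measure_space (Pow (topspace X)) outer"
  using outer_empty outer_mono outer_UN_le
  by (auto simp: outer_measure_space_def positive_def increasing_def countably_subadditive_def
      image_subset_iff)

lemma open_content_split:
  assumes W: "openin X W" and U: "openin X U"
  shows "open_content (W \<inter> U) + outer (W - U) \<le> open_content W"
proof -
  have "ennreal (I f) + outer (W - U) \<le> open_content W" if f: "f \<in> below (W \<inter> U)" for f
  proof (rule ennreal_le_epsilon)
    fix e :: real assume e: "0 < e"
    obtain g C where g: "g \<in> Cc_nonneg X" "\<And>x. x \<in> topspace X \<Longrightarrow> g x \<le> 1" "compactin X C" "C \<subseteq> W \<inter> U"
      "\<And>x. x \<in> topspace X \<Longrightarrow> x \<notin> C \<Longrightarrow> g x = 0" "I f \<le> I g + e"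
      using below_shrink[OF f e] by blast
    have oC: "openin X (W - C)"
      using W compactin_imp_closedin[OF hd g(3)] by (rule openin_diff)
    have "ennreal (I g) + ennreal (I h) \<le> open_content W" if h: "h \<in> below (W - C)" for h
    proof -
      have hC: "h \<in> Cc_nonneg X"
        using h by (simp add: below_def)
      have "g x + h x \<le> 1 \<and> (x \<notin> W \<longrightarrow> g x + h x = 0)" if "x \<in> topspace X" for x
        using that h g(2)[OF that] g(4) g(5)[OF that] by (cases "x \<in> C") (auto simp: below_def)
      then have "(\<lambda>x. g x + h x) \<in> below W"
        using Cc_nonneg_add[OF g(1) hC] by (auto simp: below_def)
      then have "ennreal (I g + I h) \<le> open_content W"
        using I_add[OF g(1) hC] open_content_upper by metis
      then show ?thesis
        using I_nonneg[OF g(1)] I_nonneg[OF hC] by simp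
    qed
    then have gW: "ennreal (I g) + open_content (W - C) \<le> open_content W"
      unfolding open_content_def[of "W - C"] using zero_below
      by (subst ennreal_SUP_add_right) (auto intro!: SUP_least)
    have "ennreal (I f) + outer (W - U) \<le> (ennreal (I g) + ennreal e) + open_content (W - C)"
    proof (rule add_mono)
      show "ennreal (I f) \<le> ennreal (I g) + ennreal e"
        using g(6) I_nonneg[OF g(1)] e by (metis ennreal_leI ennreal_plus less_imp_le)
      show "outer (W - U) \<le> open_content (W - C)"
        using g(4) by (intro outer_le_open_content[OF oC]) auto
    qed
    also have "\<dots> = (ennreal (I g) + open_content (W - C)) + ennreal e"
      by (simp add: ac_simps)
    also have "\<dots> \<le> open_content W + ennreal e"
      using gW by (rule add_right_mono)
    finally show "ennreal (I f) + outer (W - U) \<le> open_content W + ennreal e" .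
  qed
  then show ?thesis
    unfolding open_content_def[of "W \<inter> U"] using zero_below
    by (subst ennreal_SUP_add_left[symmetric]) (auto intro!: SUP_least)
qed

lemma open_in_lambda_system:
  assumes U: "openin X U"
  shows "U \<in> lambda_system (topspace X) (Pow (topspace X)) outer"
proof -
  have "outer (U \<inter> E) + outer ((topspace X - U) \<inter> E) = outer E" if E: "E \<subseteq> topspace X" for E
  proof (rule antisym)
    show "outer (U \<inter> E) + outer ((topspace X - U) \<inter> E) \<le> outer E"
      unfolding outer_def[of E]
    proof (rule INF_greatest, clarify)
      fix W assume W: "openin X W" "E \<subseteq> W"
      have "outer (U \<inter> E) \<le> open_content (W \<inter> U)"
        using W U by (intro outer_le_open_content openin_Int) auto
      moreover have "outer ((topspace X - U) \<inter> E) \<le> outer (W - U)"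
        using W(2) by (intro outer_mono) auto
      ultimately show "outer (U \<inter> E) + outer ((topspace X - U) \<inter> E) \<le> open_content W"
        using open_content_split[OF W(1) U] add_mono order_trans by blast
    qed
    have sub: "subadditive (Pow (topspace X)) outer"
      using outer_measure_space_outer
      by (intro ring_of_sets.countably_subadditive_subadditive[OF ring_of_sets_Pow])
        (auto simp: outer_measure_space_def)
    have "outer ((U \<inter> E) \<union> ((topspace X - U) \<inter> E)) \<le> outer (U \<inter> E) + outer ((topspace X - U) \<inter> E)"
      using E by (intro subadditiveD[OF sub]) auto
    moreover have "(U \<inter> E) \<union> ((topspace X - U) \<inter> E) = E"
      using E by auto
    ultimately show "outer E \<le> outer (U \<inter> E) + outer ((topspace X - U) \<inter> E)"
      by simp
  qed
  then show ?thesis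
    using openin_subset[OF U] by (auto simp: lambda_system_def)
qed

lemma measure_space_outer: "measure_space (topspace X) (sets (borel_of X)) outer"
proof -
  interpret P: sigma_algebra "topspace X" "Pow (topspace X)"
    by (rule sigma_algebra_Pow)
  have ms: "measure_space (topspace X) (lambda_system (topspace X) (Pow (topspace X)) outer) outer"
    by (rule P.caratheodory_lemma[OF outer_measure_space_outer])
  have "sets (borel_of X) \<subseteq> lambda_system (topspace X) (Pow (topspace X)) outer"
    unfolding sets_borel_of using ms open_in_lambda_system
    by (intro sigma_algebra.sigma_sets_subset) (auto simp: measure_space_def)
  moreover have "sigma_algebra (topspace X) (sets (borel_of X))"
    using sets.sigma_algebra_axioms[of "borel_of X"] by simp
  ultimately show ?thesis
    using measure_down[OF ms] by blast
qed

lemma outer_compact_le: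
  assumes C: "compactin X C" and f: "f \<in> Cc_nonneg X" and ge: "\<And>x. x \<in> C \<Longrightarrow> 1 \<le> f x"
  shows "outer C \<le> ennreal (I f)"
proof (rule ennreal_le_epsilon)
  fix e :: real assume e: "0 < e"
  have If: "0 \<le> I f"
    by (rule I_nonneg[OF f])
  \<comment> \<open>On the open set \<open>{f > 1/t}\<close>, which contains \<open>C\<close> as \<open>t > 1\<close>, every competitor is at most \<open>t f\<close>.\<close>
  define t where "t = 1 + e / (I f + 1)"
  have t: "1 < t"
    using e If by (simp add: t_def)
  have tI: "t * I f \<le> I f + e"
    using e If by (simp add: t_def field_simps)
  define U where "U = {x \<in> topspace X. 1 / t < f x}"
  have U: "openin X U"
    unfolding U_def using Cc_nonneg_continuous[OF f] continuous_map_upper_lower_semicontinuous_lt by blast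
  have "1 / t < f x" if "x \<in> C" for x
    using ge[OF that] t by (smt (verit) divide_less_eq_1_pos)
  then have CU: "C \<subseteq> U"
    using compactin_subset_topspace[OF C] by (auto simp: U_def)
  have tf: "(\<lambda>x. t * f x) \<in> Cc_nonneg X"
    using t by (intro Cc_nonneg_cmult f) simp
  have "open_content U \<le> ennreal (t * I f)"
    unfolding open_content_def
  proof (rule SUP_least, rule ennreal_leI)
    fix g assume g: "g \<in> below U"
    then have gC: "g \<in> Cc_nonneg X"
      by (simp add: below_def)
    have "I g \<le> I (\<lambda>x. t * f x)"
    proof (rule I_mono[OF gC tf])
      fix x assume x: "x \<in> topspace X"
      show "g x \<le> t * f x"
      proof (cases "x \<in> U")
        case True
        then have "1 < t * f x"
          using t by (simp add: U_def field_simps)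
        then show ?thesis
          using g x by (auto simp: below_def intro: order_trans)
      next
        case False
        then show ?thesis
          using g x Cc_nonneg_nonneg[OF tf x] by (auto simp: below_def)
      qed
    qed
    then show "I g \<le> t * I f"
      using I_cmult[OF f] t by simp
  qed
  then have "outer C \<le> ennreal (t * I f)"
    using outer_le_open_content[OF U CU] by (rule order_trans[rotated])
  also have "\<dots> \<le> ennreal (I f) + ennreal e"
    using tI If e by (metis ennreal_leI ennreal_plus less_imp_le)
  finally show "outer C \<le> ennreal (I f) + ennreal e" .
qed

lemma I_le_outer:
  assumes "f \<in> Cc_nonneg X" "\<And>x. x \<in> topspace X \<Longrightarrow> f x \<le> 1"
    and "\<And>x. x \<in> topspace X \<Longrightarrow> x \<notin> C \<Longrightarrow> f x = 0"
  shows "ennreal (I f) \<le> outer C"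
  unfolding outer_def
proof (rule INF_greatest, clarify)
  fix U assume "C \<subseteq> U"
  then show "ennreal (I f) \<le> open_content U"
    using assms by (intro open_content_upper) (auto simp: below_def)
qed

lemma open_content_inner:
  assumes U: "openin X U"
  shows "open_content U = (SUP C \<in> {C. compactin X C \<and> C \<subseteq> U}. outer C)"
proof (rule antisym)
  show "(SUP C \<in> {C. compactin X C \<and> C \<subseteq> U}. outer C) \<le> open_content U"
    using outer_le_open_content[OF U] by (intro SUP_least) auto
  show "open_content U \<le> (SUP C \<in> {C. compactin X C \<and> C \<subseteq> U}. outer C)"
    unfolding open_content_def
  proof (rule SUP_least, rule ennreal_le_epsilon)
    fix f and e :: real assume f: "f \<in> below U" and e: "0 < e"
    obtain g C where g: "g \<in> Cc_nonneg X" "\<And>x. x \<in> topspace X \<Longrightarrow> g x \<le> 1" "compactin X C" "C \<subseteq> U"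
      "\<And>x. x \<in> topspace X \<Longrightarrow> x \<notin> C \<Longrightarrow> g x = 0" "I f \<le> I g + e"
      using below_shrink[OF f e] by blast
    have "ennreal (I f) \<le> ennreal (I g) + ennreal e"
      using g(6) I_nonneg[OF g(1)] e by (metis ennreal_leI ennreal_plus less_imp_le)
    also have "ennreal (I g) \<le> outer C"
      using g(1,2,5) by (rule I_le_outer)
    also have "outer C \<le> (SUP C \<in> {C. compactin X C \<and> C \<subseteq> U}. outer C)"
      using g(3,4) by (intro SUP_upper) auto
    finally show "ennreal (I f) \<le> (SUP C \<in> {C. compactin X C \<and> C \<subseteq> U}. outer C) + ennreal e"
      by (simp add: add_right_mono)
  qed
qed

text \<open>Slicing \<open>f\<close> into layers of height \<open>d\<close> squeezes the value of any additive functional that is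
  compatible with a set function \<open>m\<close> on compact sets.\<close>

lemma layer_bounds:
  fixes J :: "('a \<Rightarrow> real) \<Rightarrow> real" and m :: "'a set \<Rightarrow> real"
  assumes J_add: "\<And>f g. f \<in> Cc_nonneg X \<Longrightarrow> g \<in> Cc_nonneg X \<Longrightarrow> J (\<lambda>x. f x + g x) = J f + J g"
    and J_le: "\<And>f C a. f \<in> Cc_nonneg X \<Longrightarrow> compactin X C \<Longrightarrow> 0 < a \<Longrightarrow> (\<And>x. x \<in> topspace X \<Longrightarrow> f x \<le> a) \<Longrightarrow>
        (\<And>x. x \<in> topspace X \<Longrightarrow> x \<notin> C \<Longrightarrow> f x = 0) \<Longrightarrow> J f \<le> a * m C"
    and J_ge: "\<And>f C a. f \<in> Cc_nonneg X \<Longrightarrow> compactin X C \<Longrightarrow> 0 < a \<Longrightarrow> (\<And>x. x \<in> C \<Longrightarrow> a \<le> f x) \<Longrightarrow> a * m C \<le> J f"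
    and m0: "m {} = 0"
    and f: "f \<in> Cc_nonneg X" and B: "compactin X B" "\<And>x. x \<in> topspace X \<Longrightarrow> x \<notin> B \<Longrightarrow> f x = 0"
    and d: "0 < d"
  defines "L \<equiv> \<lambda>j::nat. {x \<in> B. real j * d \<le> f x}"
  shows "d * (\<Sum>j<N. m (L (Suc j))) \<le> J (\<lambda>x. min (f x) (real N * d))
    \<and> J (\<lambda>x. min (f x) (real N * d)) \<le> d * (\<Sum>j<N. m (L j))"
proof (induction N)
  case 0
  have c: "(\<lambda>x. min (f x) 0) \<in> Cc_nonneg X"
    using Cc_nonneg_min_const[OF f, of 0] by simp
  have "J (\<lambda>x. min (f x) 0) \<le> 1 * m {}"
    using Cc_nonneg_nonneg[OF f] by (intro J_le[OF c]) (auto simp: min_absorb2)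
  moreover have "1 * m {} \<le> J (\<lambda>x. min (f x) 0)"
    by (intro J_ge[OF c]) auto
  ultimately show ?case
    using m0 by simp
next
  case (Suc N)
  define g where "g = (\<lambda>x. min (max (f x - real N * d) 0) d)"
  have g: "g \<in> Cc_nonneg X"
    unfolding g_def using d by (intro Cc_nonneg_min_const Cc_nonneg_diff_const f) auto
  have fN: "(\<lambda>x. min (f x) (real N * d)) \<in> Cc_nonneg X"
    using d by (intro Cc_nonneg_min_const f) simp
  have L: "compactin X (L j)" for j
    unfolding L_def by (rule compactin_superlevel[OF hd B(1) Cc_nonneg_continuous[OF f]])
  have "(\<lambda>x. min (f x) (real (Suc N) * d)) = (\<lambda>x. min (f x) (real N * d) + g x)"
    using d by (auto simp: g_def fun_eq_iff min_def max_def algebra_simps)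
  then have sum: "J (\<lambda>x. min (f x) (real (Suc N) * d)) = J (\<lambda>x. min (f x) (real N * d)) + J g"
    using J_add[OF fN g] by simp
  have "J g \<le> d * m (L N)"
  proof (rule J_le[OF g L d])
    show "g x \<le> d" for x
      by (simp add: g_def)
    have "0 \<le> real N * d"
      using d by simp
    then show "g x = 0" if "x \<in> topspace X" "x \<notin> L N" for x
      using that B(2)[OF that(1)] d by (cases "x \<in> B") (auto simp: g_def L_def)
  qed
  moreover have "d * m (L (Suc N)) \<le> J g"
    by (rule J_ge[OF g L d]) (auto simp: g_def L_def algebra_simps)
  ultimately show ?case
    using Suc.IH unfolding sum by (simp add: distrib_left)
qed

theorem riesz_representation:
  shows "\<exists>\<mu>. radon_measure X \<mu> \<and> (\<forall>f\<in>Cc_nonneg X. (\<integral>x. f x \<partial>\<mu>) = I f)"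
proof -
  define \<mu> where "\<mu> = measure_of (topspace X) (sets (borel_of X)) outer"
  have sa: "sigma_algebra (topspace X) (sets (borel_of X))"
    using measure_space_outer by (simp add: measure_space_def)
  have sets: "sets \<mu> = sets (borel_of X)"
    unfolding \<mu>_def by (rule sigma_algebra.sets_measure_of_eq[OF sa])
  have em: "emeasure \<mu> A = outer A" if "A \<in> sets (borel_of X)" for A
    unfolding \<mu>_def using measure_space_outer that
    by (intro emeasure_measure_of_sigma) (auto simp: measure_space_def)
  have bo: "U \<in> sets (borel_of X)" if "openin X U" for U
    using that by (auto simp: sets_borel_of)
  have bc: "C \<in> sets (borel_of X)" if "compactin X C" for C
  proof -
    have "closedin X C"
      by (rule compactin_imp_closedin[OF hd that])
    then have "topspace X - (topspace X - C) \<in> sets (borel_of X)"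
      using bo[of "topspace X - C"] sets.compl_sets[of _ "borel_of X"] by (auto simp: closedin_def)
    then show ?thesis
      using compactin_subset_topspace[OF that] by (simp add: double_diff)
  qed
  have fin: "outer C < \<infinity>" if C: "compactin X C" for C
  proof -
    obtain f where "f \<in> Cc_nonneg X" "\<And>x. x \<in> C \<Longrightarrow> f x = 1"
      using Urysohn_Cc[OF lc hd C openin_topspace compactin_subset_topspace[OF C]] by metis
    then have "outer C \<le> ennreal (I f)"
      using outer_compact_le[OF C] by simp
    then show ?thesis
      by (simp add: order_le_less_trans)
  qed
  have radon: "radon_measure X \<mu>"
    unfolding radon_measure_def
  proof (intro conjI allI impI ballI)
    show "emeasure \<mu> C < \<infinity>" if "compactin X C" for C
      using em[OF bc] fin that by simp
    show "emeasure \<mu> A = (INF U \<in> {U. openin X U \<and> A \<subseteq> U}. emeasure \<mu> U)" if "A \<in> sets \<mu>" for A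
    proof -
      have "(INF U \<in> {U. openin X U \<and> A \<subseteq> U}. emeasure \<mu> U) = (INF U \<in> {U. openin X U \<and> A \<subseteq> U}. open_content U)"
        by (rule INF_cong) (auto simp: em bo outer_open)
      then show ?thesis
        using that by (simp add: em sets outer_def)
    qed
    show "emeasure \<mu> U = (SUP C \<in> {C. compactin X C \<and> C \<subseteq> U}. emeasure \<mu> C)" if "openin X U" for U
    proof -
      have "(SUP C \<in> {C. compactin X C \<and> C \<subseteq> U}. emeasure \<mu> C) = (SUP C \<in> {C. compactin X C \<and> C \<subseteq> U}. outer C)"
        by (rule SUP_cong) (auto simp: em bc)
      then show ?thesis
        using that by (simp add: em bo outer_open open_content_inner)
    qed
  qed (rule sets)
  have mC: "ennreal (measure \<mu> C) = outer C" if "compactin X C" for C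
    using em[OF bc[OF that]] fin[OF that] emeasure_eq_ennreal_measure[of \<mu> C] by (simp add: less_top)
  have I_le: "I f \<le> a * measure \<mu> C"
    if f: "f \<in> Cc_nonneg X" and C: "compactin X C" and a: "0 < a"
      and le: "\<And>x. x \<in> topspace X \<Longrightarrow> f x \<le> a"
      and z: "\<And>x. x \<in> topspace X \<Longrightarrow> x \<notin> C \<Longrightarrow> f x = 0" for f C a
  proof -
    have f': "(\<lambda>x. (1 / a) * f x) \<in> Cc_nonneg X"
      using a by (intro Cc_nonneg_cmult f) simp
    have "ennreal (I (\<lambda>x. (1 / a) * f x)) \<le> outer C"
      using a le z by (intro I_le_outer[OF f']) (auto simp: field_simps)
    then have "(1 / a) * I f \<le> measure \<mu> C"
      using I_cmult[OF f, of "1 / a"] a mC[OF C] by (metis ennreal_le_iff measure_nonneg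
          divide_nonneg_nonneg less_imp_le zero_le_one)
    then show ?thesis
      using a by (simp add: field_simps)
  qed
  have I_ge: "a * measure \<mu> C \<le> I f"
    if f: "f \<in> Cc_nonneg X" and C: "compactin X C" and a: "0 < a"
      and ge: "\<And>x. x \<in> C \<Longrightarrow> a \<le> f x" for f C a
  proof -
    have f': "(\<lambda>x. (1 / a) * f x) \<in> Cc_nonneg X"
      using a by (intro Cc_nonneg_cmult f) simp
    have "outer C \<le> ennreal (I (\<lambda>x. (1 / a) * f x))"
      using a ge by (intro outer_compact_le[OF C f']) (auto simp: field_simps)
    then have "measure \<mu> C \<le> (1 / a) * I f"
      using I_cmult[OF f, of "1 / a"] a mC[OF C] I_nonneg[OF f'] by (metis ennreal_le_iff
          divide_nonneg_nonneg less_imp_le zero_le_one)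
    then show ?thesis
      using a by (simp add: field_simps)
  qed
  have int_eq: "(\<integral>x. f x \<partial>\<mu>) = I f" if f: "f \<in> Cc_nonneg X" for f
  proof -
    obtain B where B: "compactin X B" "\<And>x. x \<in> topspace X \<Longrightarrow> x \<notin> B \<Longrightarrow> f x = 0"
      using Cc_nonneg_support[OF f] by blast
    obtain M where M: "0 < M" "\<And>x. x \<in> topspace X \<Longrightarrow> f x \<le> M"
      using Cc_nonneg_bounded[OF f] by blast
    have le: "\<bar>(\<integral>x. f x \<partial>\<mu>) - I f\<bar> \<le> d * measure \<mu> B" if d: "0 < d" for d
    proof -
      define L where "L = (\<lambda>j::nat. {x \<in> B. real j * d \<le> f x})"
      obtain N where N: "M < real N * d"
        using ex_less_of_nat_mult[OF d] by blast
      have fN: "f x = min (f x) (real N * d)" if "x \<in> topspace X" for x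
        using M(2)[OF that] N by simp
      have "I f = I (\<lambda>x. min (f x) (real N * d))"
        by (rule I_cong[OF f fN])
      moreover have "(\<integral>x. f x \<partial>\<mu>) = (\<integral>x. min (f x) (real N * d) \<partial>\<mu>)"
        by (rule radon_integral_cong[OF radon fN])
      moreover have "d * (\<Sum>j<N. measure \<mu> (L (Suc j))) \<le> I (\<lambda>x. min (f x) (real N * d))
          \<and> I (\<lambda>x. min (f x) (real N * d)) \<le> d * (\<Sum>j<N. measure \<mu> (L j))"
        unfolding L_def using f B d
        by (intro layer_bounds[of I "measure \<mu>"] I_add I_le I_ge) auto
      moreover have "d * (\<Sum>j<N. measure \<mu> (L (Suc j))) \<le> (\<integral>x. min (f x) (real N * d) \<partial>\<mu>)
          \<and> (\<integral>x. min (f x) (real N * d) \<partial>\<mu>) \<le> d * (\<Sum>j<N. measure \<mu> (L j))"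
        unfolding L_def using f B d
        by (intro layer_bounds[of "integral\<^sup>L \<mu>" "measure \<mu>"] radon_integral_le[OF radon hd]
            radon_integral_ge[OF radon hd] Bochner_Integration.integral_add radon_integrable_Cc[OF radon hd]) auto
      moreover have "d * (\<Sum>j<N. measure \<mu> (L j)) - d * (\<Sum>j<N. measure \<mu> (L (Suc j))) \<le> d * measure \<mu> B"
      proof -
        have "(\<Sum>j<N. measure \<mu> (L j)) - (\<Sum>j<N. measure \<mu> (L (Suc j))) = measure \<mu> (L 0) - measure \<mu> (L N)"
          using sum_lessThan_telescope'[of "\<lambda>j. measure \<mu> (L j)" N] by (simp only: sum_subtractf)
        moreover have "L 0 = B"
          using Cc_nonneg_nonneg[OF f] compactin_subset_topspace[OF B(1)] by (auto simp: L_def)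
        ultimately have "(\<Sum>j<N. measure \<mu> (L j)) - (\<Sum>j<N. measure \<mu> (L (Suc j))) \<le> measure \<mu> B"
          by simp
        then show ?thesis
          using d by (simp flip: right_diff_distrib)
      qed
      ultimately show ?thesis
        by linarith
    qed
    have "\<bar>(\<integral>x. f x \<partial>\<mu>) - I f\<bar> \<le> 0 + e" if e: "0 < e" for e
    proof -
      have m: "0 < measure \<mu> B + 1"
        by (simp add: add_nonneg_pos)
      have "e / (measure \<mu> B + 1) * measure \<mu> B \<le> e"
        using e m by (simp add: field_simps)
      then show ?thesis
        using le[of "e / (measure \<mu> B + 1)"] e m by simp
    qed
    then have "\<bar>(\<integral>x. f x \<partial>\<mu>) - I f\<bar> \<le> 0"
      by (rule field_le_epsilon)
    then show ?thesis
      by simp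
  qed
  show ?thesis
    using radon int_eq by blast
qed

end

section \<open>Haar measure and the modular function\<close>

text \<open>A locally compact Hausdorff group with topology \<open>T\<close>.\<close>

locale lc_group =
  fixes G :: "('a, 'm) monoid_scheme" (structure) and T :: "'a topology"
  assumes lcg: "locally_compact_group G T"

sublocale lc_group \<subseteq> group G
  using lcg by (simp add: locally_compact_group_def)

context lc_group
begin

lemma tspace: "topspace T = carrier G" and hd: "Hausdorff_space T" and lc: "locally_compact_space T"
  using lcg by (auto simp: locally_compact_group_def)

lemma continuous_mult:
  assumes "continuous_map Z T f" "continuous_map Z T g"
  shows "continuous_map Z T (\<lambda>z. f z \<otimes> g z)"
proof -
  have "continuous_map (prod_topology T T) T (\<lambda>(x, y). x \<otimes> y)"
    using lcg by (simp add: locally_compact_group_def)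
  from continuous_map_compose[OF continuous_map_pairedI[OF assms] this] show ?thesis
    by (simp add: o_def)
qed

lemma continuous_inv:
  assumes "continuous_map Z T f"
  shows "continuous_map Z T (\<lambda>z. inv (f z))"
  using continuous_map_compose[OF assms, of T "m_inv G"] lcg
  by (simp add: locally_compact_group_def o_def)

lemma continuous_const: "c \<in> carrier G \<Longrightarrow> continuous_map Z T (\<lambda>z. c)"
  by (simp add: tspace)

lemma continuous_ident: "continuous_map T T (\<lambda>x. x)"
  by simp

lemmas group_continuous = continuous_mult continuous_inv continuous_const continuous_ident

lemma compactin_carrier: "compactin T C \<Longrightarrow> C \<subseteq> carrier G"
  using compactin_subset_topspace tspace by metis

lemma compactin_inv:
  assumes "compactin T C"
  shows "compactin T (m_inv G ` C)"
  using image_compactin[OF assms continuous_inv[OF continuous_ident]] .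

lemma compactin_mult:
  assumes "compactin T C" "compactin T D"
  shows "compactin T ((\<lambda>p. fst p \<otimes> snd p) ` (C \<times> D))"
proof (rule image_compactin)
  show "compactin (prod_topology T T) (C \<times> D)"
    using assms by (simp add: compactin_Times)
  show "continuous_map (prod_topology T T) T (\<lambda>p. fst p \<otimes> snd p)"
    by (intro continuous_mult continuous_map_fst continuous_map_snd)
qed

lemma Cc_nonneg_translate:
  assumes f: "f \<in> Cc_nonneg T" and y: "y \<in> carrier G"
  shows "(\<lambda>x. f (y \<otimes> x)) \<in> Cc_nonneg T" and "(\<lambda>x. f (x \<otimes> y)) \<in> Cc_nonneg T"
proof -
  obtain C where C: "compactin T C" "\<And>x. x \<in> carrier G \<Longrightarrow> x \<notin> C \<Longrightarrow> f x = 0"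
    using Cc_nonneg_support[OF f] tspace by metis
  have cl: "continuous_map T T (\<lambda>x. z \<otimes> x)" "continuous_map T T (\<lambda>x. x \<otimes> z)" if "z \<in> carrier G" for z
    using that by (intro group_continuous; simp)+
  show "(\<lambda>x. f (y \<otimes> x)) \<in> Cc_nonneg T"
  proof (rule Cc_nonnegI)
    show "continuous_map T euclideanreal (\<lambda>x. f (y \<otimes> x))"
      using continuous_map_compose[OF cl(1)[OF y] Cc_nonneg_continuous[OF f]] by (simp add: o_def)
    show "compactin T ((\<lambda>x. inv y \<otimes> x) ` C)"
      using y by (intro image_compactin[OF C(1) cl(1)]) simp
    show "f (y \<otimes> x) = 0" if x: "x \<in> topspace T" "x \<notin> (\<lambda>x. inv y \<otimes> x) ` C" for x
    proof (rule C(2))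
      show "y \<otimes> x \<notin> C"
      proof
        assume "y \<otimes> x \<in> C"
        then have "inv y \<otimes> (y \<otimes> x) \<in> (\<lambda>x. inv y \<otimes> x) ` C"
          by blast
        then show False
          using x y by (simp add: tspace flip: m_assoc)
      qed
    qed (use x y in \<open>simp add: tspace\<close>)
  qed (use Cc_nonneg_nonneg[OF f] y in \<open>simp add: tspace\<close>)
  show "(\<lambda>x. f (x \<otimes> y)) \<in> Cc_nonneg T"
  proof (rule Cc_nonnegI)
    show "continuous_map T euclideanreal (\<lambda>x. f (x \<otimes> y))"
      using continuous_map_compose[OF cl(2)[OF y] Cc_nonneg_continuous[OF f]] by (simp add: o_def)
    show "compactin T ((\<lambda>x. x \<otimes> inv y) ` C)"
      using y by (intro image_compactin[OF C(1) cl(2)]) simp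
    show "f (x \<otimes> y) = 0" if x: "x \<in> topspace T" "x \<notin> (\<lambda>x. x \<otimes> inv y) ` C" for x
    proof (rule C(2))
      show "x \<otimes> y \<notin> C"
      proof
        assume "x \<otimes> y \<in> C"
        then have "(x \<otimes> y) \<otimes> inv y \<in> (\<lambda>x. x \<otimes> inv y) ` C"
          by blast
        then show False
          using x y by (simp add: tspace m_assoc)
      qed
    qed (use x y in \<open>simp add: tspace\<close>)
  qed (use Cc_nonneg_nonneg[OF f] y in \<open>simp add: tspace\<close>)
qed

lemma closed_subgroup_lc_group:
  assumes "closed_subgroup H G T"
  shows "lc_group (G\<lparr>carrier := H\<rparr>) (subtopology T H)"
proof
  have H: "subgroup H G" and cl: "closedin T H"
    using assms by (auto simp: closed_subgroup_def)
  have sub: "H \<subseteq> carrier G"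
    using H by (rule subgroup.subset)
  have "continuous_map (prod_topology (subtopology T H) (subtopology T H)) T (\<lambda>p. fst p \<otimes> snd p)"
    by (intro continuous_mult continuous_map_into_fulltopology[OF continuous_map_fst]
        continuous_map_into_fulltopology[OF continuous_map_snd])
  then have m: "continuous_map (prod_topology (subtopology T H) (subtopology T H)) (subtopology T H)
      (\<lambda>(x, y). x \<otimes> y)"
    using subgroup.m_closed[OF H] by (auto simp: continuous_map_in_subtopology split_def)
  have "continuous_map (subtopology T H) T (\<lambda>x. inv x)"
    by (intro continuous_inv continuous_map_from_subtopology continuous_ident)
  then have "continuous_map (subtopology T H) (subtopology T H) (\<lambda>x. inv x)"
    using subgroup.m_inv_closed[OF H] by (auto simp: continuous_map_in_subtopology)
  then have i: "continuous_map (subtopology T H) (subtopology T H) (\<lambda>x. inv\<^bsub>G\<lparr>carrier := H\<rparr>\<^esub> x)"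
    by (rule continuous_map_eq) (simp add: m_inv_consistent[OF H])
  show "locally_compact_group (G\<lparr>carrier := H\<rparr>) (subtopology T H)"
    using subgroup_imp_group[OF H] sub m i Hausdorff_space_subtopology[OF hd]
      locally_compact_space_closed_subset[OF lc cl]
    by (auto simp: locally_compact_group_def tspace)
qed

end

text \<open>A locally compact group with a left Haar measure.\<close>

locale haar_group = lc_group +
  fixes \<eta> :: "'a measure"
  assumes haar: "left_haar_measure G T \<eta>"
begin

lemma radon: "radon_measure T \<eta>"
  using haar by (simp add: left_haar_measure_def)

lemma haar_space: "space \<eta> = carrier G"
  using radon_space[OF radon] tspace by simp

lemma l_coset_preimage:
  assumes "y \<in> carrier G" "A \<subseteq> carrier G"
  shows "{x \<in> carrier G. y \<otimes> x \<in> A} = inv y <# A"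
proof -
  have "x \<in> inv y <# A" if "x \<in> carrier G" "y \<otimes> x \<in> A" for x
  proof -
    have "x = inv y \<otimes> (y \<otimes> x)"
      using that assms by (simp flip: m_assoc)
    then show ?thesis
      using that by (auto simp: l_coset_def)
  qed
  then show ?thesis
    using assms by (auto simp: l_coset_def simp flip: m_assoc)
qed

lemma measurable_translate:
  assumes "y \<in> carrier G"
  shows "(\<lambda>x. y \<otimes> x) \<in> measurable \<eta> \<eta>"
proof -
  have "(\<lambda>x. y \<otimes> x) \<in> measurable \<eta> (borel_of T)"
    unfolding borel_of_def
  proof (rule measurable_measure_of)
    fix U assume "U \<in> {U. openin T U}"
    then have "openin T {x \<in> topspace T. y \<otimes> x \<in> U}"
      using assms openin_continuous_map_preimage[OF continuous_mult[OF continuous_const continuous_ident]]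
      by simp
    moreover have "{x \<in> topspace T. y \<otimes> x \<in> U} = (\<lambda>x. y \<otimes> x) -` U \<inter> space \<eta>"
      by (auto simp: tspace haar_space)
    ultimately show "(\<lambda>x. y \<otimes> x) -` U \<inter> space \<eta> \<in> sets \<eta>"
      using radon_open[OF radon] by metis
  qed (use assms in \<open>auto simp: tspace haar_space dest!: openin_subset\<close>)
  then show ?thesis
    using measurable_cong_sets[OF refl radon_sets[OF radon]] by blast
qed

lemma integral_translate:
  assumes y: "y \<in> carrier G" and f: "continuous_map T euclideanreal f"
  shows "(\<integral>x. f (y \<otimes> x) \<partial>\<eta>) = (\<integral>x. f x \<partial>\<eta>)"
proof -
  note m = measurable_translate[OF y]
  have "distr \<eta> \<eta> (\<lambda>x. y \<otimes> x) = \<eta>"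
  proof (rule measure_eqI)
    fix A assume "A \<in> sets (distr \<eta> \<eta> (\<lambda>x. y \<otimes> x))"
    then have A: "A \<in> sets \<eta>"
      by simp
    then have Ac: "A \<subseteq> carrier G"
      using sets.sets_into_space haar_space by metis
    have "emeasure (distr \<eta> \<eta> (\<lambda>x. y \<otimes> x)) A = emeasure \<eta> ((\<lambda>x. y \<otimes> x) -` A \<inter> space \<eta>)"
      by (rule emeasure_distr[OF m A])
    also have "(\<lambda>x. y \<otimes> x) -` A \<inter> space \<eta> = inv y <# A"
      unfolding l_coset_preimage[OF y Ac, symmetric] by (auto simp: haar_space)
    also have "emeasure \<eta> (inv y <# A) = emeasure \<eta> A"
      using haar y A by (simp add: left_haar_measure_def)
    finally show "emeasure (distr \<eta> \<eta> (\<lambda>x. y \<otimes> x)) A = emeasure \<eta> A" .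
  qed simp
  then have "(\<integral>x. f x \<partial>\<eta>) = (\<integral>x. f x \<partial>distr \<eta> \<eta> (\<lambda>x. y \<otimes> x))"
    by simp
  also have "\<dots> = (\<integral>x. f (y \<otimes> x) \<partial>\<eta>)"
    by (rule integral_distr[OF m radon_continuous_measurable[OF radon f]])
  finally show ?thesis
    by simp
qed

text \<open>Non-empty open sets have positive Haar measure: finitely many translates cover any given
  compact set, so a null open set would make all compact sets null, and then the whole group.\<close>

lemma open_positive:
  assumes U: "openin T U" "u \<in> U"
  shows "emeasure \<eta> U \<noteq> 0"
proof
  assume 0: "emeasure \<eta> U = 0"
  have Uc: "U \<subseteq> carrier G"
    using openin_subset[OF U(1)] tspace by simp
  then have u: "u \<in> carrier G"
    using U by auto
  have "emeasure \<eta> C = 0" if C: "compactin T C" for C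
  proof -
    \<comment> \<open>The translate of \<open>U\<close> that carries \<open>u\<close> to \<open>c\<close>.\<close>
    define V where "V = (\<lambda>c. {x \<in> carrier G. (u \<otimes> inv c) \<otimes> x \<in> U})"
    have Cc: "C \<subseteq> carrier G"
      by (rule compactin_carrier[OF C])
    have oV: "openin T (V c)" if "c \<in> carrier G" for c
    proof -
      have "continuous_map T T (\<lambda>x. (u \<otimes> inv c) \<otimes> x)"
        using that u by (intro group_continuous) auto
      from openin_continuous_map_preimage[OF this U(1)] show ?thesis
        by (simp add: V_def tspace)
    qed
    have nV: "emeasure \<eta> (V c) = 0" if "c \<in> carrier G" for c
    proof -
      have "V c = inv (u \<otimes> inv c) <# U"
        unfolding V_def using that u Uc by (intro l_coset_preimage) auto
      then show ?thesis
        using haar 0 radon_open[OF radon U(1)] that u by (simp add: left_haar_measure_def)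
    qed
    have cV: "c \<in> V c" if "c \<in> C" for c
      using that Cc u U(2) by (auto simp: V_def m_assoc)
    have oVC: "openin T (V c)" if "c \<in> C" for c
      using oV that Cc by blast
    have cov: "C \<subseteq> (\<Union>c\<in>C. V c)"
      using cV by blast
    obtain D where D: "finite D" "D \<subseteq> C" "C \<subseteq> (\<Union>c\<in>D. V c)"
      by (rule compactin_finite_subcover[OF C oVC cov])
    have "emeasure \<eta> C \<le> emeasure \<eta> (\<Union>c\<in>D. V c)"
      using D(2) Cc oV radon_open[OF radon]
      by (intro emeasure_mono[OF D(3)] sets.finite_UN[OF D(1)]) auto
    also have "\<dots> \<le> (\<Sum>c\<in>D. emeasure \<eta> (V c))"
      using D(2) Cc oV radon_open[OF radon] by (intro emeasure_subadditive_finite[OF D(1)]) auto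
    also have "\<dots> = 0"
      using D(2) Cc nV by (intro sum.neutral) auto
    finally show ?thesis
      by simp
  qed
  then have "emeasure \<eta> (topspace T) \<le> 0"
    unfolding radon_inner[OF radon openin_topspace] by (intro SUP_least) auto
  then show False
    using haar by (simp add: left_haar_measure_def)
qed

lemma integral_positive:
  assumes f: "continuous_map T euclideanreal f" "\<And>x. x \<in> carrier G \<Longrightarrow> 0 \<le> f x" "integrable \<eta> f"
    and x: "x \<in> carrier G" "0 < f x"
  shows "0 < (\<integral>x. f x \<partial>\<eta>)"
proof -
  define U where "U = {x \<in> topspace T. 0 < f x}"
  have U: "openin T U"
    unfolding U_def using f(1) continuous_map_upper_lower_semicontinuous_lt by blast
  have "(\<integral>x. f x \<partial>\<eta>) \<noteq> 0"
  proof
    assume "(\<integral>x. f x \<partial>\<eta>) = 0"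
    then have "AE x in \<eta>. f x = 0"
      using integral_nonneg_eq_0_iff_AE[OF f(3)] f(2) haar_space by (auto intro: AE_I2)
    then have "AE x in \<eta>. x \<notin> U"
      by eventually_elim (simp add: U_def)
    then have "U \<in> null_sets \<eta>"
      using AE_iff_null_sets[OF radon_open[OF radon U]] by simp
    moreover have "x \<in> U"
      using x by (simp add: U_def tspace)
    ultimately show False
      using open_positive[OF U] by auto
  qed
  moreover have "0 \<le> (\<integral>x. f x \<partial>\<eta>)"
    using f(2) haar_space by (intro Bochner_Integration.integral_nonneg) auto
  ultimately show ?thesis
    by simp
qed

lemma integral_positive_Cc:
  assumes "f \<in> Cc_nonneg T" "x \<in> carrier G" "0 < f x"
  shows "0 < (\<integral>x. f x \<partial>\<eta>)"
  using assms Cc_nonneg_nonneg[OF assms(1)] tspace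
  by (intro integral_positive[OF Cc_nonneg_continuous[OF assms(1)]] radon_integrable_Cc[OF radon hd]) auto

end

text \<open>In addition, the modular function; only its values on the carrier matter.\<close>

locale modular_group = haar_group +
  fixes \<Delta> :: "'a \<Rightarrow> real"
  assumes modular: "modular_function G T \<eta> \<Delta>"
begin

lemma modular_Cc:
  assumes "f \<in> Cc_nonneg T" "y \<in> carrier G"
  shows "(\<integral>x. f (x \<otimes> inv y) \<partial>\<eta>) = \<Delta> y * (\<integral>x. f x \<partial>\<eta>)"
proof -
  have "complex_of_real (\<integral>x. f (x \<otimes> inv y) \<partial>\<eta>) = complex_of_real (\<Delta> y * (\<integral>x. f x \<partial>\<eta>))"
    using modular of_real_Cc_nonneg[OF hd assms(1)] assms(2)
    by (auto simp: modular_function_def simp flip: integral_complex_of_real)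
  then show ?thesis
    by (simp only: of_real_eq_iff)
qed

lemma bump:
  obtains f where "f \<in> Cc_nonneg T" "f \<one> = 1"
proof -
  have "compactin T {\<one>}" "{\<one>} \<subseteq> topspace T"
    by (simp_all add: tspace)
  then show ?thesis
    using Urysohn_Cc[OF lc hd _ openin_topspace] that by (metis singletonI)
qed

lemma modular_pos:
  assumes y: "y \<in> carrier G"
  shows "0 < \<Delta> y"
proof -
  obtain f where f: "f \<in> Cc_nonneg T" "f \<one> = 1"
    by (rule bump)
  have "0 < (\<integral>x. f (x \<otimes> inv y) \<partial>\<eta>)"
    using y f by (intro integral_positive_Cc[of _ y] Cc_nonneg_translate) auto
  moreover have "0 < (\<integral>x. f x \<partial>\<eta>)"
    using f by (intro integral_positive_Cc[of _ \<one>]) auto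
  ultimately show ?thesis
    using modular_Cc[OF f(1) y] by (simp add: zero_less_mult_iff)
qed

lemma modular_mult:
  assumes y: "y \<in> carrier G" and z: "z \<in> carrier G"
  shows "\<Delta> (y \<otimes> z) = \<Delta> y * \<Delta> z"
proof -
  obtain f where f: "f \<in> Cc_nonneg T" "f \<one> = 1"
    by (rule bump)
  have p: "0 < (\<integral>x. f x \<partial>\<eta>)"
    using f by (intro integral_positive_Cc[of _ \<one>]) auto
  have fy: "(\<lambda>x. f (x \<otimes> inv y)) \<in> Cc_nonneg T"
    using y by (intro Cc_nonneg_translate f) simp
  have "\<Delta> (y \<otimes> z) * (\<integral>x. f x \<partial>\<eta>) = (\<integral>x. f (x \<otimes> inv (y \<otimes> z)) \<partial>\<eta>)"
    using y z by (intro modular_Cc[OF f(1), symmetric]) simp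
  also have "\<dots> = (\<integral>x. f (x \<otimes> inv z \<otimes> inv y) \<partial>\<eta>)"
    using y z by (intro radon_integral_cong[OF radon]) (simp add: inv_mult_group m_assoc tspace)
  also have "\<dots> = \<Delta> z * (\<Delta> y * (\<integral>x. f x \<partial>\<eta>))"
    using modular_Cc[OF fy z] modular_Cc[OF f(1) y] by simp
  finally show ?thesis
    using p by simp
qed

lemma modular_one: "\<Delta> \<one> = 1"
  using modular_mult[of \<one> \<one>] modular_pos[of \<one>] by simp

lemma modular_inv: "y \<in> carrier G \<Longrightarrow> \<Delta> (inv y) * \<Delta> y = 1"
  using modular_mult[of "inv y" y] modular_one by simp

lemma modular_continuous: "continuous_map T euclideanreal \<Delta>"
proof -
  obtain f where f: "f \<in> Cc_nonneg T" "f \<one> = 1"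
    by (rule bump)
  have p: "0 < (\<integral>x. f x \<partial>\<eta>)"
    using f by (intro integral_positive_Cc[of _ \<one>]) auto
  obtain S where S: "compactin T S" "\<And>x. x \<in> carrier G \<Longrightarrow> x \<notin> S \<Longrightarrow> f x = 0"
    using Cc_nonneg_support[OF f(1)] tspace by metis
  have "continuous_map (prod_topology T T) T (\<lambda>p. snd p \<otimes> inv (fst p))"
    by (intro continuous_mult continuous_inv continuous_map_fst continuous_map_snd)
  from continuous_map_compose[OF this Cc_nonneg_continuous[OF f(1)]]
  have c: "continuous_map (prod_topology T T) euclideanreal (\<lambda>p. f (snd p \<otimes> inv (fst p)))"
    by (simp add: o_def)
  have "continuous_map T euclideanreal (\<lambda>y. \<integral>x. f (x \<otimes> inv y) \<partial>\<eta>)"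
  proof (rule continuous_map_parametric_integral[OF radon hd c])
    fix y assume "y \<in> topspace T"
    then obtain U L where U: "openin T U" "y \<in> U" "compactin T L" "U \<subseteq> L"
      using lc unfolding locally_compact_space_def by blast
    have "f (x \<otimes> inv u) = 0" if u: "u \<in> U" and x: "x \<in> carrier G"
      "x \<notin> (\<lambda>p. fst p \<otimes> snd p) ` (S \<times> L)" for u x
    proof (rule S(2))
      have uc: "u \<in> carrier G"
        using u U compactin_carrier by blast
      then show "x \<otimes> inv u \<in> carrier G"
        using x by simp
      show "x \<otimes> inv u \<notin> S"
      proof
        assume s: "x \<otimes> inv u \<in> S"
        have "x = fst (x \<otimes> inv u, u) \<otimes> snd (x \<otimes> inv u, u)"
          using x uc by (simp add: m_assoc)
        then show False
          using s x(2) u U(4) by blast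
      qed
    qed
    then show "\<exists>U C. openin T U \<and> y \<in> U \<and> compactin T C \<and> (\<forall>u\<in>U. \<forall>x\<in>topspace T - C. f (x \<otimes> inv u) = 0)"
      using U(1,2) compactin_mult[OF S(1) U(3)] tspace by blast
  qed
  then have "continuous_map T euclideanreal (\<lambda>y. (\<integral>x. f (x \<otimes> inv y) \<partial>\<eta>) / (\<integral>x. f x \<partial>\<eta>))"
    using p by (intro continuous_map_real_divide continuous_map_canonical_const) auto
  then show ?thesis
    by (rule continuous_map_eq) (use p modular_Cc[OF f(1)] tspace in auto)
qed

text \<open>The inverse of left Haar measure has density \<open>1/\<Delta>\<close>. Instead of appealing to uniqueness of
  Haar measure, the iterated integrals of \<open>f(x) g(y\<^sup>-\<^sup>1x)/\<Delta>(y)\<close> are evaluated in both orders: one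
  gives \<open>\<integral>f/\<Delta>\<close> times the left-hand side, the other \<open>\<integral>f/\<Delta>\<close> times the right-hand side.\<close>

theorem integral_inverse:
  assumes g: "g \<in> Cc_nonneg T"
  shows "(\<integral>x. g (inv x) / \<Delta> x \<partial>\<eta>) = (\<integral>x. g x \<partial>\<eta>)"
proof -
  obtain f where f: "f \<in> Cc_nonneg T" "f \<one> = 1"
    by (rule bump)
  obtain S where S: "compactin T S" "\<And>x. x \<in> carrier G \<Longrightarrow> x \<notin> S \<Longrightarrow> f x = 0"
    using Cc_nonneg_support[OF f(1)] tspace by metis
  obtain R where R: "compactin T R" "\<And>x. x \<in> carrier G \<Longrightarrow> x \<notin> R \<Longrightarrow> g x = 0"
    using Cc_nonneg_support[OF g] tspace by metis
  define D where "D = (\<lambda>p. fst p \<otimes> snd p) ` (S \<times> m_inv G ` R)"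
  have D: "compactin T D"
    unfolding D_def by (intro compactin_mult compactin_inv S R)
  have nz: "\<Delta> x \<noteq> 0" if "x \<in> carrier G" for x
    using modular_pos[OF that] by simp
  define m where "m = (\<lambda>x. f x * (1 / \<Delta> x))"
  have m: "m \<in> Cc_nonneg T"
    unfolding m_def using nz modular_pos tspace
    by (intro Cc_nonneg_mult f continuous_map_real_divide continuous_map_canonical_const
        modular_continuous) (auto intro: less_imp_le)
  have mpos: "0 < (\<integral>x. m x \<partial>\<eta>)"
    by (rule integral_positive_Cc[OF m, of \<one>]) (auto simp: m_def f modular_one)
  note cf = Cc_nonneg_continuous[OF f(1)] and cg = Cc_nonneg_continuous[OF g]
  have comp: "continuous_map Z euclideanreal (\<lambda>z. k (p z))"
    if "continuous_map Z T p" "continuous_map T euclideanreal k"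
    for Z :: "('a \<times> 'a) topology" and p and k :: "'a \<Rightarrow> real"
    using continuous_map_compose[OF that] by (simp add: o_def)
  have comp1: "continuous_map T euclideanreal (\<lambda>z. k (p z))"
    if "continuous_map T T p" "continuous_map T euclideanreal k" for p and k :: "'a \<Rightarrow> real"
    using continuous_map_compose[OF that] by (simp add: o_def)
  have nzp: "\<Delta> (fst p) \<noteq> 0" "\<Delta> (snd p) \<noteq> 0" if "p \<in> topspace (prod_topology T T)" for p
    using that nz by (auto simp: tspace)
  have c1: "continuous_map (prod_topology T T) euclideanreal
      (\<lambda>p. f (fst p) * g (inv (snd p) \<otimes> fst p) / \<Delta> (snd p))"
    by (intro continuous_map_real_divide continuous_map_real_mult comp[OF _ cf] comp[OF _ cg]
        comp[OF _ modular_continuous] continuous_mult continuous_inv continuous_map_fst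
        continuous_map_snd nzp)
  have c2: "continuous_map (prod_topology T T) euclideanreal
      (\<lambda>p. f (fst p \<otimes> snd p) * g (snd p) / \<Delta> (fst p))"
    by (intro continuous_map_real_divide continuous_map_real_mult comp[OF _ cf] comp[OF _ cg]
        comp[OF _ modular_continuous] continuous_mult continuous_map_fst continuous_map_snd nzp)
  have inner: "(\<integral>y. g (inv y \<otimes> x) / \<Delta> y \<partial>\<eta>) = (\<integral>y. g (inv y) / \<Delta> y \<partial>\<eta>) / \<Delta> x" if x: "x \<in> carrier G" for x
  proof -
    have "continuous_map T euclideanreal (\<lambda>y. g (inv y \<otimes> x) / \<Delta> y)"
      using x nz tspace by (intro continuous_map_real_divide comp1[OF _ cg] modular_continuous
          group_continuous) auto
    from integral_translate[OF x this]
    have "(\<integral>y. g (inv y \<otimes> x) / \<Delta> y \<partial>\<eta>) = (\<integral>y. g (inv (x \<otimes> y) \<otimes> x) / \<Delta> (x \<otimes> y) \<partial>\<eta>)"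
      by simp
    also have "\<dots> = (\<integral>y. (g (inv y) / \<Delta> y) / \<Delta> x \<partial>\<eta>)"
      using x by (intro radon_integral_cong[OF radon])
        (simp add: inv_mult_group m_assoc tspace modular_mult mult.commute)
    finally show ?thesis
      by (simp only: integral_divide_zero)
  qed
  have "(\<integral>x. m x \<partial>\<eta>) * (\<integral>y. g (inv y) / \<Delta> y \<partial>\<eta>)
      = (\<integral>x. m x * (\<integral>y. g (inv y) / \<Delta> y \<partial>\<eta>) \<partial>\<eta>)"
    by simp
  also have "\<dots> = (\<integral>x. (\<integral>y. f x * g (inv y \<otimes> x) / \<Delta> y \<partial>\<eta>) \<partial>\<eta>)"
  proof (rule radon_integral_cong[OF radon])
    fix x assume "x \<in> topspace T"
    then have x: "x \<in> carrier G"
      by (simp add: tspace)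
    have "(\<integral>y. f x * g (inv y \<otimes> x) / \<Delta> y \<partial>\<eta>) = f x * (\<integral>y. g (inv y \<otimes> x) / \<Delta> y \<partial>\<eta>)"
      by (simp flip: times_divide_eq_right)
    then show "m x * (\<integral>y. g (inv y) / \<Delta> y \<partial>\<eta>) = (\<integral>y. f x * g (inv y \<otimes> x) / \<Delta> y \<partial>\<eta>)"
      using inner[OF x] by (simp add: m_def)
  qed
  also have "\<dots> = (\<integral>y. (\<integral>x. f x * g (inv y \<otimes> x) / \<Delta> y \<partial>\<eta>) \<partial>\<eta>)"
  proof (rule radon_integral_swap[OF radon hd radon hd c1 S(1) D])
    show "f x * g (inv y \<otimes> x) / \<Delta> y = 0" if "x \<in> topspace T" "y \<in> topspace T" "x \<notin> S" for x y
      using S(2) that by (simp add: tspace)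
    show "f x * g (inv y \<otimes> x) / \<Delta> y = 0" if x: "x \<in> topspace T" and y: "y \<in> topspace T" "y \<notin> D" for x y
    proof (cases "x \<in> S \<and> inv y \<otimes> x \<in> R")
      case True
      have "y = x \<otimes> inv (inv y \<otimes> x)"
        using x y by (simp add: tspace inv_mult_group flip: m_assoc)
      then have "y \<in> D"
        unfolding D_def using True by (intro image_eqI[of _ _ "(x, inv (inv y \<otimes> x))"]) auto
      then show ?thesis
        using y by simp
    next
      case False
      then show ?thesis
        using S(2)[of x] R(2)[of "inv y \<otimes> x"] x y by (auto simp: tspace)
    qed
  qed
  also have "\<dots> = (\<integral>y. (\<integral>x. f (y \<otimes> x) * g x / \<Delta> y \<partial>\<eta>) \<partial>\<eta>)"
  proof (rule radon_integral_cong[OF radon])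
    fix y assume "y \<in> topspace T"
    then have y: "y \<in> carrier G"
      by (simp add: tspace)
    have "continuous_map T euclideanreal (\<lambda>x. f x * g (inv y \<otimes> x) / \<Delta> y)"
      using continuous_map_slice[OF continuous_map_swap_args[OF c1], of y] y by (simp add: tspace)
    then have "(\<integral>x. f x * g (inv y \<otimes> x) / \<Delta> y \<partial>\<eta>) = (\<integral>x. f (y \<otimes> x) * g (inv y \<otimes> (y \<otimes> x)) / \<Delta> y \<partial>\<eta>)"
      by (rule integral_translate[OF y, symmetric])
    also have "\<dots> = (\<integral>x. f (y \<otimes> x) * g x / \<Delta> y \<partial>\<eta>)"
      using y by (intro radon_integral_cong[OF radon]) (simp add: tspace flip: m_assoc)
    finally show "(\<integral>x. f x * g (inv y \<otimes> x) / \<Delta> y \<partial>\<eta>) = (\<integral>x. f (y \<otimes> x) * g x / \<Delta> y \<partial>\<eta>)" .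
  qed
  also have "\<dots> = (\<integral>x. (\<integral>y. f (y \<otimes> x) * g x / \<Delta> y \<partial>\<eta>) \<partial>\<eta>)"
  proof (rule radon_integral_swap[OF radon hd radon hd c2 D R(1)])
    show "f (y \<otimes> x) * g x / \<Delta> y = 0" if "y \<in> topspace T" "x \<in> topspace T" "x \<notin> R" for x y
      using R(2) that by (simp add: tspace)
    show "f (y \<otimes> x) * g x / \<Delta> y = 0" if y: "y \<in> topspace T" and x: "x \<in> topspace T" and yD: "y \<notin> D" for x y
    proof (cases "y \<otimes> x \<in> S \<and> x \<in> R")
      case True
      have "y = (y \<otimes> x) \<otimes> inv x"
        using x y by (simp add: tspace m_assoc)
      then have "y \<in> D"
        unfolding D_def using True by (intro image_eqI[of _ _ "(y \<otimes> x, inv x)"]) auto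
      then show ?thesis
        using yD by simp
    next
      case False
      then show ?thesis
        using S(2)[of "y \<otimes> x"] R(2)[of x] x y by (auto simp: tspace)
    qed
  qed
  also have "\<dots> = (\<integral>x. (\<integral>y. m y \<partial>\<eta>) * g x \<partial>\<eta>)"
  proof (rule radon_integral_cong[OF radon])
    fix x assume "x \<in> topspace T"
    then have x: "x \<in> carrier G"
      by (simp add: tspace)
    have "(\<integral>y. f (y \<otimes> x) * g x / \<Delta> y \<partial>\<eta>) = (\<integral>y. (\<Delta> x * g x) * m (y \<otimes> x) \<partial>\<eta>)"
      using x nz by (intro radon_integral_cong[OF radon]) (simp add: m_def tspace modular_mult)
    also have "\<dots> = (\<Delta> x * g x) * (\<integral>y. m (y \<otimes> x) \<partial>\<eta>)"
      by (rule integral_mult_right_zero)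
    also have "(\<integral>y. m (y \<otimes> x) \<partial>\<eta>) = \<Delta> (inv x) * (\<integral>y. m y \<partial>\<eta>)"
      using modular_Cc[OF m, of "inv x"] x by simp
    also have "\<Delta> x * g x * (\<Delta> (inv x) * (\<integral>y. m y \<partial>\<eta>)) = (\<Delta> (inv x) * \<Delta> x) * ((\<integral>y. m y \<partial>\<eta>) * g x)"
      by (simp add: mult_ac)
    also have "\<dots> = (\<integral>y. m y \<partial>\<eta>) * g x"
      using modular_inv[OF x] by simp
    finally show "(\<integral>y. f (y \<otimes> x) * g x / \<Delta> y \<partial>\<eta>) = (\<integral>y. m y \<partial>\<eta>) * g x" .
  qed
  also have "\<dots> = (\<integral>x. m x \<partial>\<eta>) * (\<integral>x. g x \<partial>\<eta>)"
    by simp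
  finally show ?thesis
    using mpos by simp
qed

end

section \<open>Averaging over a closed subgroup\<close>

text \<open>A closed subgroup \<open>L\<close> with left Haar measure \<open>\<eta>\<close> and modular function \<open>\<Delta>\<close>. The sublocale \<open>M\<close>
  regards \<open>L\<close> as a locally compact group of its own.\<close>

locale closed_subgroup_haar = lc_group +
  fixes L :: "'a set" and \<eta> :: "'a measure" and \<Delta> :: "'a \<Rightarrow> real"
  assumes cs: "closed_subgroup L G T"
    and haar_L: "left_haar_measure (G\<lparr>carrier := L\<rparr>) (subtopology T L) \<eta>"
    and modular_L: "modular_function (G\<lparr>carrier := L\<rparr>) (subtopology T L) \<eta> \<Delta>"
begin

sublocale M: modular_group "G\<lparr>carrier := L\<rparr>" "subtopology T L" \<eta> \<Delta>
  by (intro modular_group.intro haar_group.intro haar_group_axioms.intro modular_group_axioms.intro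
      closed_subgroup_lc_group cs haar_L modular_L)

lemma sub: "subgroup L G" and closed_L: "closedin T L" and subset: "L \<subseteq> carrier G"
  using cs subgroup.subset by (auto simp: closed_subgroup_def)

lemma L_carrier: "h \<in> L \<Longrightarrow> h \<in> carrier G" and L_inv: "h \<in> L \<Longrightarrow> inv h \<in> L" and L_one: "\<one> \<in> L"
  using subset subgroup.m_inv_closed[OF sub] subgroup.one_closed[OF sub] by auto

lemma Int_L [simp]: "topspace T \<inter> L = L" "carrier G \<inter> L = L"
  using subset tspace by auto

lemma topspace_L: "topspace (subtopology T L) = L"
  by simp

lemma space_L: "space \<eta> = L"
  using radon_space[OF M.radon] topspace_L by simp

lemma continuous_L_ident: "continuous_map (subtopology T L) T (\<lambda>x. x)"
  by (intro continuous_map_from_subtopology continuous_ident)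

lemma compactin_L: "compactin T C \<Longrightarrow> compactin (subtopology T L) (C \<inter> L)"
  using closed_Int_compactin[OF closed_L] by (auto simp: compactin_subtopology Int_commute)

lemma Cc_nonneg_restrict:
  assumes "f \<in> Cc_nonneg T"
  shows "f \<in> Cc_nonneg (subtopology T L)"
proof -
  obtain C where C: "compactin T C" "\<And>x. x \<in> topspace T \<Longrightarrow> x \<notin> C \<Longrightarrow> f x = 0"
    using Cc_nonneg_support[OF assms] by blast
  show ?thesis
  proof (rule Cc_nonnegI[OF _ _ compactin_L[OF C(1)]])
    show "continuous_map (subtopology T L) euclideanreal f"
      by (intro continuous_map_from_subtopology Cc_nonneg_continuous assms)
  qed (use C(2) Cc_nonneg_nonneg[OF assms] L_carrier tspace in auto)
qed

lemma \<Delta>_pos: "h \<in> L \<Longrightarrow> 0 < \<Delta> h"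
  using M.modular_pos by simp

lemma \<Delta>_one: "\<Delta> \<one> = 1"
  using M.modular_one by simp

lemma inverse_integral_L:
  assumes "g \<in> Cc_nonneg (subtopology T L)"
  shows "(\<integral>h. g (inv h) / \<Delta> h \<partial>\<eta>) = (\<integral>h. g h \<partial>\<eta>)"
proof -
  have "(\<integral>h. g (inv h) / \<Delta> h \<partial>\<eta>) = (\<integral>h. g (inv\<^bsub>G\<lparr>carrier := L\<rparr>\<^esub> h) / \<Delta> h \<partial>\<eta>)"
    by (intro radon_integral_cong[OF M.radon]) (simp add: m_inv_consistent[OF sub])
  also have "\<dots> = (\<integral>h. g h \<partial>\<eta>)"
    by (rule M.integral_inverse[OF assms])
  finally show ?thesis .
qed

lemma Cc_nonneg_inverse_L:
  assumes g: "g \<in> Cc_nonneg (subtopology T L)"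
  shows "(\<lambda>h. g (inv h)) \<in> Cc_nonneg (subtopology T L)"
proof -
  obtain C where C: "compactin (subtopology T L) C" "\<And>x. x \<in> L \<Longrightarrow> x \<notin> C \<Longrightarrow> g x = 0"
    using Cc_nonneg_support[OF g] topspace_L by metis
  have "continuous_map (subtopology T L) T (\<lambda>x. inv x)"
    by (intro continuous_inv continuous_L_ident)
  then have i: "continuous_map (subtopology T L) (subtopology T L) (\<lambda>x. inv x)"
    using L_inv by (auto simp: continuous_map_in_subtopology)
  show ?thesis
  proof (rule Cc_nonnegI)
    show "continuous_map (subtopology T L) euclideanreal (\<lambda>h. g (inv h))"
      using continuous_map_compose[OF i Cc_nonneg_continuous[OF g]] by (simp add: o_def)
    show "compactin (subtopology T L) ((\<lambda>x. inv x) ` C)"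
      by (rule image_compactin[OF C(1) i])
    show "g (inv h) = 0" if "h \<in> topspace (subtopology T L)" "h \<notin> (\<lambda>x. inv x) ` C" for h
    proof (rule C(2))
      have h: "h \<in> L"
        using that topspace_L by simp
      then show "inv h \<in> L"
        by (rule L_inv)
      show "inv h \<notin> C"
        using that(2) inv_inv[OF L_carrier[OF h]] by (metis imageI)
    qed
  qed (use Cc_nonneg_nonneg[OF g] topspace_L L_inv in simp)
qed

text \<open>The function \<open>x \<mapsto> \<integral> f(xh) dh\<close>. It is continuous and constant on left cosets of \<open>L\<close>, but its
  support is compact only modulo \<open>L\<close>.\<close>

definition average :: "('a \<Rightarrow> real) \<Rightarrow> 'a \<Rightarrow> real" where
  "average f x = (\<integral>h. f (x \<otimes> h) \<partial>\<eta>)"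

lemma Cc_nonneg_orbit:
  assumes "f \<in> Cc_nonneg T" "x \<in> carrier G"
  shows "(\<lambda>h. f (x \<otimes> h)) \<in> Cc_nonneg (subtopology T L)"
  by (intro Cc_nonneg_restrict Cc_nonneg_translate assms)

lemma integrable_orbit:
  assumes "f \<in> Cc_nonneg T" "x \<in> carrier G"
  shows "integrable \<eta> (\<lambda>h. f (x \<otimes> h))"
  by (rule radon_integrable_Cc[OF M.radon M.hd Cc_nonneg_orbit[OF assms]])

lemma average_nonneg:
  assumes "f \<in> Cc_nonneg T" "x \<in> carrier G"
  shows "0 \<le> average f x"
  unfolding average_def using Cc_nonneg_nonneg[OF Cc_nonneg_orbit[OF assms]] topspace_L space_L
  by (intro Bochner_Integration.integral_nonneg) auto

lemma average_pos:
  assumes "f \<in> Cc_nonneg T" "x \<in> carrier G" "0 < f x"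
  shows "0 < average f x"
  unfolding average_def using assms L_one
  by (intro M.integral_positive_Cc[OF Cc_nonneg_orbit, of _ _ \<one>]) auto

lemma continuous_prod_mult:
  "continuous_map (prod_topology T (subtopology T L)) T (\<lambda>p. fst p \<otimes> snd p)"
  by (intro continuous_mult continuous_map_fst continuous_map_into_fulltopology[OF continuous_map_snd])

lemma continuous_prod_mult':
  "continuous_map (prod_topology (subtopology T L) T) T (\<lambda>p. fst p \<otimes> snd p)"
  by (intro continuous_mult continuous_map_snd continuous_map_into_fulltopology[OF continuous_map_fst])

lemma mem_quotient_set:
  assumes "x \<in> carrier G" "h \<in> carrier G" "x \<in> A" "x \<otimes> h \<in> B"
  shows "h \<in> (\<lambda>p. fst p \<otimes> snd p) ` (m_inv G ` A \<times> B)"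
proof (rule image_eqI)
  show "h = fst (inv x, x \<otimes> h) \<otimes> snd (inv x, x \<otimes> h)"
    using assms(1,2) by (simp flip: m_assoc)
qed (use assms in auto)

lemma average_continuous:
  assumes f: "f \<in> Cc_nonneg T"
  shows "continuous_map T euclideanreal (average f)"
proof -
  obtain S where S: "compactin T S" "\<And>x. x \<in> carrier G \<Longrightarrow> x \<notin> S \<Longrightarrow> f x = 0"
    using Cc_nonneg_support[OF f] tspace by metis
  have c: "continuous_map (prod_topology T (subtopology T L)) euclideanreal (\<lambda>p. f (fst p \<otimes> snd p))"
    using continuous_map_compose[OF continuous_prod_mult Cc_nonneg_continuous[OF f]]
    by (simp add: o_def)
  show ?thesis
    unfolding average_def
  proof (rule continuous_map_parametric_integral[OF M.radon M.hd c])
    fix x assume "x \<in> topspace T"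
    then obtain U C where U: "openin T U" "x \<in> U" "compactin T C" "U \<subseteq> C"
      using lc unfolding locally_compact_space_def by blast
    define D where "D = (\<lambda>p. fst p \<otimes> snd p) ` (m_inv G ` C \<times> S) \<inter> L"
    have D: "compactin (subtopology T L) D"
      unfolding D_def by (intro compactin_L compactin_mult compactin_inv U S)
    have "f (u \<otimes> h) = 0" if u: "u \<in> U" and h: "h \<in> L" "h \<notin> D" for u h
    proof (rule S(2))
      have uc: "u \<in> carrier G" "h \<in> carrier G"
        using u U compactin_carrier h(1) L_carrier by blast+
      then show "u \<otimes> h \<in> carrier G"
        by simp
      show "u \<otimes> h \<notin> S"
        using mem_quotient_set[OF uc, of C S] u U(4) h by (auto simp: D_def)
    qed
    then show "\<exists>U C. openin T U \<and> x \<in> U \<and> compactin (subtopology T L) C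
        \<and> (\<forall>u\<in>U. \<forall>h\<in>topspace (subtopology T L) - C. f (u \<otimes> h) = 0)"
      using U(1,2) D topspace_L by blast
  qed
qed

text \<open>Averaging is symmetric with respect to a measure that transforms under right translation by
  \<open>L\<close> with the character \<open>\<Delta>\<close>.\<close>

lemma average_symmetric:
  assumes \<nu>: "radon_measure T \<nu>"
    and inv_\<nu>: "\<And>f h. f \<in> Cc_nonneg T \<Longrightarrow> h \<in> L \<Longrightarrow> (\<integral>x. f (x \<otimes> inv h) \<partial>\<nu>) = \<Delta> h * (\<integral>x. f x \<partial>\<nu>)"
    and f: "f \<in> Cc_nonneg T" and g: "g \<in> Cc_nonneg T"
  shows "(\<integral>x. f x * average g x \<partial>\<nu>) = (\<integral>x. g x * average f x \<partial>\<nu>)"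
proof -
  define P where "P = (\<lambda>f g h. \<integral>x. f x * g (x \<otimes> h) \<partial>\<nu> :: real)"
  have *: "(\<integral>x. f x * average g x \<partial>\<nu>) = (\<integral>h. P f g h \<partial>\<eta>) \<and> P f g \<in> Cc_nonneg (subtopology T L)"
    if f: "f \<in> Cc_nonneg T" and g: "g \<in> Cc_nonneg T" for f g
  proof -
    obtain S where S: "compactin T S" "\<And>x. x \<in> carrier G \<Longrightarrow> x \<notin> S \<Longrightarrow> f x = 0"
      using Cc_nonneg_support[OF f] tspace by metis
    obtain R where R: "compactin T R" "\<And>x. x \<in> carrier G \<Longrightarrow> x \<notin> R \<Longrightarrow> g x = 0"
      using Cc_nonneg_support[OF g] tspace by metis
    define D where "D = (\<lambda>p. fst p \<otimes> snd p) ` (m_inv G ` S \<times> R) \<inter> L"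
    have D: "compactin (subtopology T L) D"
      unfolding D_def by (intro compactin_L compactin_mult compactin_inv S R)
    have cfst: "continuous_map (prod_topology T (subtopology T L)) euclideanreal (\<lambda>p. f (fst p))"
      using continuous_map_compose[OF continuous_map_fst Cc_nonneg_continuous[OF f]]
      by (simp add: o_def)
    have cm: "continuous_map (prod_topology T (subtopology T L)) euclideanreal (\<lambda>p. g (fst p \<otimes> snd p))"
      using continuous_map_compose[OF continuous_prod_mult Cc_nonneg_continuous[OF g]]
      by (simp add: o_def)
    have c: "continuous_map (prod_topology T (subtopology T L)) euclideanreal
        (\<lambda>p. f (fst p) * g (fst p \<otimes> snd p))"
      by (rule continuous_map_real_mult[OF cfst cm])
    have z1: "f x * g (x \<otimes> h) = 0" if "x \<in> topspace T" "x \<notin> S" for x h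
      using S(2) that by (simp add: tspace)
    have z2: "f x * g (x \<otimes> h) = 0" if x: "x \<in> topspace T" and h: "h \<in> topspace (subtopology T L)" "h \<notin> D" for x h
    proof (cases "x \<in> S \<and> x \<otimes> h \<in> R")
      case True
      have "x \<in> carrier G" "h \<in> carrier G"
        using x h L_carrier topspace_L by (auto simp: tspace)
      then show ?thesis
        using mem_quotient_set[of x h S R] True h topspace_L by (auto simp: D_def)
    next
      case False
      then show ?thesis
        using S(2)[of x] R(2)[of "x \<otimes> h"] x h L_carrier topspace_L by (auto simp: tspace)
    qed
    have "(\<integral>x. f x * average g x \<partial>\<nu>) = (\<integral>x. (\<integral>h. f x * g (x \<otimes> h) \<partial>\<eta>) \<partial>\<nu>)"
      unfolding average_def by simp
    also have "\<dots> = (\<integral>h. P f g h \<partial>\<eta>)"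
      unfolding P_def by (rule radon_integral_swap[OF \<nu> hd M.radon M.hd c S(1) D]) (use z1 z2 in auto)
    finally have 1: "(\<integral>x. f x * average g x \<partial>\<nu>) = (\<integral>h. P f g h \<partial>\<eta>)" .
    have 2: "P f g \<in> Cc_nonneg (subtopology T L)"
    proof (rule Cc_nonnegI[OF _ _ D])
      show "continuous_map (subtopology T L) euclideanreal (P f g)"
        unfolding P_def
        by (rule continuous_map_parametric_integral_compact[OF \<nu> hd continuous_map_swap_args[OF c] S(1)])
          (use z1 in auto)
      show "0 \<le> P f g h" if "h \<in> topspace (subtopology T L)" for h
        unfolding P_def using that radon_space[OF \<nu>] Cc_nonneg_nonneg[OF f] Cc_nonneg_nonneg[OF g]
          L_carrier topspace_L by (intro Bochner_Integration.integral_nonneg) (auto simp: tspace)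
      show "P f g h = 0" if "h \<in> topspace (subtopology T L)" "h \<notin> D" for h
        using radon_integral_cong[OF \<nu>, of "\<lambda>x. f x * g (x \<otimes> h)" "\<lambda>x. 0"] z2 that by (simp add: P_def)
    qed
    show ?thesis
      using 1 2 by blast
  qed
  have flip: "P f g h = P g f (inv h) / \<Delta> h" if h: "h \<in> L" for h
  proof -
    have hc: "h \<in> carrier G"
      using h by (rule L_carrier)
    have gh: "(\<lambda>x. g (x \<otimes> h)) \<in> Cc_nonneg T"
      by (rule Cc_nonneg_translate(2)[OF g hc])
    have "(\<lambda>x. f x * g (x \<otimes> h)) \<in> Cc_nonneg T"
      by (rule Cc_nonneg_mult[OF f Cc_nonneg_continuous[OF gh] Cc_nonneg_nonneg[OF gh]])
    from inv_\<nu>[OF this h]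
    have "\<Delta> h * P f g h = (\<integral>x. f (x \<otimes> inv h) * g (x \<otimes> inv h \<otimes> h) \<partial>\<nu>)"
      by (simp add: P_def)
    also have "\<dots> = P g f (inv h)"
      unfolding P_def using hc by (intro radon_integral_cong[OF \<nu>]) (simp add: tspace m_assoc)
    finally show ?thesis
      using \<Delta>_pos[OF h] by (simp add: field_simps)
  qed
  have "(\<integral>x. f x * average g x \<partial>\<nu>) = (\<integral>h. P f g h \<partial>\<eta>)"
    using *[OF f g] by blast
  also have "\<dots> = (\<integral>h. P g f (inv h) / \<Delta> h \<partial>\<eta>)"
    using flip topspace_L by (intro radon_integral_cong[OF M.radon]) auto
  also have "\<dots> = (\<integral>h. P g f h \<partial>\<eta>)"
    using *[OF g f] by (intro inverse_integral_L) blast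
  also have "\<dots> = (\<integral>x. g x * average f x \<partial>\<nu>)"
    using *[OF g f] by simp
  finally show ?thesis .
qed

end

section \<open>Double cosets\<close>

text \<open>The double coset space of two closed subgroups, with a Radon measure \<open>\<nu>\<close> on \<open>G\<close> that is
  quasi-invariant with factor \<open>\<Delta>\<^sub>K \<Delta>\<^sub>H\<close>.\<close>

locale double_coset_setting =
  lc_group G T +
  H: closed_subgroup_haar G T H \<eta>H \<Delta>H +
  K: closed_subgroup_haar G T K \<eta>K \<Delta>K
  for G :: "('a, 'm) monoid_scheme" (structure) and T H K \<eta>H \<eta>K \<Delta>H \<Delta>K +
  fixes \<nu> :: "'a measure"
  assumes lcX: "locally_compact_space (double_coset_space G T K H)"
    and hdX: "Hausdorff_space (double_coset_space G T K H)"
    and wd: "Q_well_defined G T K H \<eta>K \<eta>H"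
    and \<nu>: "radon_measure T \<nu>"
    and inv_\<nu>: "\<forall>k \<in> K. \<forall>h \<in> H. \<forall>f \<in> Cc T.
           (\<integral>x. f (inv k \<otimes> x \<otimes> inv h) \<partial>\<nu>) = complex_of_real (\<Delta>K k * \<Delta>H h) * (\<integral>x. f x \<partial>\<nu>)"
begin

abbreviation X where "X \<equiv> double_coset_space G T K H"
abbreviation q where "q \<equiv> double_coset G K H"

lemma quotient_q: "quotient_map T X q"
  by (rule quotient_map_double_coset[OF tspace])

lemma continuous_q: "continuous_map T X q"
  using quotient_q by (rule quotient_imp_continuous_map)

lemma topspace_X: "topspace X = q ` carrier G"
  using quotient_imp_surjective_map[OF quotient_q] tspace by simp

lemma mem_q: "y \<in> q x \<longleftrightarrow> (\<exists>k\<in>K. \<exists>h\<in>H. y = k \<otimes> x \<otimes> h)"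
  by (auto simp: double_coset_def r_coset_def set_mult_def)

lemma q_mult:
  assumes x: "x \<in> carrier G" and k: "k \<in> K" and h: "h \<in> H"
  shows "q (k \<otimes> x \<otimes> h) = q x"
proof -
  have kc: "k \<in> carrier G" and hc: "h \<in> carrier G"
    using k h K.L_carrier H.L_carrier by auto
  have "\<exists>k''\<in>K. \<exists>h''\<in>H. k' \<otimes> (k \<otimes> x \<otimes> h) \<otimes> h' = k'' \<otimes> x \<otimes> h''" if "k' \<in> K" "h' \<in> H" for k' h'
  proof (intro bexI)
    show "k' \<otimes> (k \<otimes> x \<otimes> h) \<otimes> h' = (k' \<otimes> k) \<otimes> x \<otimes> (h \<otimes> h')"
      using that x kc hc K.L_carrier H.L_carrier by (simp add: m_assoc)
  qed (use that k h subgroup.m_closed[OF K.sub] subgroup.m_closed[OF H.sub] in auto)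
  moreover have "\<exists>k''\<in>K. \<exists>h''\<in>H. k' \<otimes> x \<otimes> h' = k'' \<otimes> (k \<otimes> x \<otimes> h) \<otimes> h''" if k': "k' \<in> K" and h': "h' \<in> H" for k' h'
  proof (intro bexI)
    have c: "k' \<in> carrier G" "h' \<in> carrier G"
      using k' h' K.L_carrier H.L_carrier by auto
    have "(k' \<otimes> inv k) \<otimes> (k \<otimes> x \<otimes> h) \<otimes> (inv h \<otimes> h') = k' \<otimes> (inv k \<otimes> k) \<otimes> x \<otimes> (h \<otimes> inv h) \<otimes> h'"
      using c x kc hc by (simp only: m_assoc inv_closed m_closed)
    also have "\<dots> = k' \<otimes> x \<otimes> h'"
      using c x kc hc by simp
    finally show "k' \<otimes> x \<otimes> h' = (k' \<otimes> inv k) \<otimes> (k \<otimes> x \<otimes> h) \<otimes> (inv h \<otimes> h')"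
      by simp
  qed (use k' h' k h K.L_inv H.L_inv subgroup.m_closed[OF K.sub] subgroup.m_closed[OF H.sub] in auto)
  ultimately show ?thesis
    by (auto simp: mem_q)
qed

lemma q_eq:
  assumes "x \<in> carrier G" "y \<in> q x"
  shows "y \<in> carrier G" "q y = q x"
  using assms q_mult[OF assms(1)] K.L_carrier H.L_carrier by (auto simp: mem_q)

lemma q_refl:
  assumes "x \<in> carrier G"
  shows "x \<in> q x"
  using assms K.L_one H.L_one by (auto simp: mem_q intro!: bexI[of _ \<one>])

lemma open_q:
  assumes U: "openin T U"
  shows "openin X (q ` U)"
proof -
  have Uc: "U \<subseteq> carrier G"
    using openin_subset[OF U] tspace by simp
  have "{x \<in> topspace T. q x \<in> q ` U} = (\<Union>k\<in>K. \<Union>h\<in>H. {x \<in> topspace T. k \<otimes> x \<otimes> h \<in> U})"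
  proof (intro equalityI subsetI)
    fix x assume "x \<in> {x \<in> topspace T. q x \<in> q ` U}"
    then obtain u where x: "x \<in> carrier G" "u \<in> U" "q x = q u"
      by (auto simp: tspace)
    then have "u \<in> q x"
      using q_refl Uc by auto
    then obtain k h where "k \<in> K" "h \<in> H" "k \<otimes> x \<otimes> h \<in> U"
      using x(2) unfolding mem_q by blast
    then show "x \<in> (\<Union>k\<in>K. \<Union>h\<in>H. {x \<in> topspace T. k \<otimes> x \<otimes> h \<in> U})"
      using x(1) by (auto simp: tspace)
  next
    fix x assume "x \<in> (\<Union>k\<in>K. \<Union>h\<in>H. {x \<in> topspace T. k \<otimes> x \<otimes> h \<in> U})"
    then obtain k h where *: "k \<in> K" "h \<in> H" "x \<in> carrier G" "k \<otimes> x \<otimes> h \<in> U"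
      by (auto simp: tspace)
    then have "q x = q (k \<otimes> x \<otimes> h)"
      using q_mult by simp
    then show "x \<in> {x \<in> topspace T. q x \<in> q ` U}"
      using * by (auto simp: tspace)
  qed
  moreover have "openin T {x \<in> topspace T. k \<otimes> x \<otimes> h \<in> U}" if "k \<in> K" "h \<in> H" for k h
  proof (rule openin_continuous_map_preimage[OF _ U])
    show "continuous_map T T (\<lambda>x. k \<otimes> x \<otimes> h)"
      using that K.L_carrier H.L_carrier by (intro group_continuous) auto
  qed
  ultimately have "openin T {x \<in> topspace T. q x \<in> q ` U}"
    by (auto intro!: openin_Union)
  then show ?thesis
    using Uc by (auto simp: openin_double_coset_space)
qed

text \<open>As \<open>q\<close> is open and \<open>G\<close> locally compact, compact sets of double cosets are covered by images of
  compact sets.\<close>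

lemma compact_lift:
  assumes C: "compactin X C"
  obtains D where "compactin T D" "C \<subseteq> q ` D"
proof -
  have "\<forall>x\<in>carrier G. \<exists>U L. openin T U \<and> compactin T L \<and> x \<in> U \<and> U \<subseteq> L"
    using lc by (simp add: locally_compact_space_def tspace)
  then obtain U L where UL: "\<And>x. x \<in> carrier G \<Longrightarrow> openin T (U x)"
    "\<And>x. x \<in> carrier G \<Longrightarrow> compactin T (L x)" "\<And>x. x \<in> carrier G \<Longrightarrow> x \<in> U x"
    "\<And>x. x \<in> carrier G \<Longrightarrow> U x \<subseteq> L x"
    by metis
  have cov: "C \<subseteq> (\<Union>x\<in>carrier G. q ` U x)"
  proof
    fix D assume "D \<in> C"
    then obtain x where "x \<in> carrier G" "D = q x"
      using compactin_subset_topspace[OF C] topspace_X by auto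
    then show "D \<in> (\<Union>x\<in>carrier G. q ` U x)"
      using UL(3) by blast
  qed
  obtain F where F: "finite F" "F \<subseteq> carrier G" "C \<subseteq> (\<Union>x\<in>F. q ` U x)"
    by (rule compactin_finite_subcover[OF C open_q[OF UL(1)] cov])
  show ?thesis
  proof (rule that)
    show "compactin T (\<Union>x\<in>F. L x)"
      using F(1,2) UL(2) by (intro compactin_Union) auto
    show "C \<subseteq> q ` (\<Union>x\<in>F. L x)"
      using F(2,3) UL(4) by blast
  qed
qed

text \<open>The real double average \<open>x \<mapsto> \<integral>\<integral> f(kxh) dh dk\<close> as a function on the group.\<close>

definition qavg :: "('a \<Rightarrow> real) \<Rightarrow> 'a \<Rightarrow> real" where
  "qavg f x = (\<integral>k. H.average f (k \<otimes> x) \<partial>\<eta>K)"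

lemma some_mem:
  assumes "x \<in> carrier G"
  shows "(SOME y. y \<in> q x) \<in> carrier G" "q (SOME y. y \<in> q x) = q x"
  using q_eq[OF assms] someI[of "\<lambda>y. y \<in> q x", OF q_refl[OF assms]] by auto

lemma integrable_coset_integral:
  assumes "f \<in> Cc T" "x \<in> carrier G"
  shows "integrable \<eta>K (\<lambda>k. \<integral>h. f (k \<otimes> x \<otimes> h) \<partial>\<eta>H)"
  using wd[unfolded Q_well_defined_def, THEN bspec, OF assms(1)] assms(2) by blast

lemma Q_in_Cc: "f \<in> Cc T \<Longrightarrow> Q G \<eta>K \<eta>H f \<in> Cc X"
  using wd[unfolded Q_well_defined_def, THEN bspec] by blast

lemma coset_integral_cong:
  assumes "f \<in> Cc T" "x \<in> carrier G" "y \<in> carrier G" "q x = q y"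
  shows "coset_integral G \<eta>K \<eta>H f x = coset_integral G \<eta>K \<eta>H f y"
  using wd[unfolded Q_well_defined_def, THEN bspec, OF assms(1)] assms(2-4) by blast

lemma Q_q:
  assumes "f \<in> Cc T" "x \<in> carrier G"
  shows "Q G \<eta>K \<eta>H f (q x) = coset_integral G \<eta>K \<eta>H f x"
  unfolding Q_def by (rule coset_integral_cong[OF assms(1) some_mem(1)[OF assms(2)] assms(2) some_mem(2)[OF assms(2)]])

lemma coset_integral_of_real:
  "coset_integral G \<eta>K \<eta>H (\<lambda>x. complex_of_real (f x)) x = complex_of_real (qavg f x)"
  by (simp add: coset_integral_def qavg_def H.average_def)

lemma integrable_average:
  assumes f: "f \<in> Cc_nonneg T" and x: "x \<in> carrier G"
  shows "integrable \<eta>K (\<lambda>k. H.average f (k \<otimes> x))"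
proof -
  have "integrable \<eta>K (\<lambda>k. \<integral>h. complex_of_real (f (k \<otimes> x \<otimes> h)) \<partial>\<eta>H)"
    by (rule integrable_coset_integral[OF of_real_Cc_nonneg[OF hd f] x])
  then show ?thesis
    by (simp add: H.average_def complex_of_real_integrable_eq)
qed

lemma qavg_nonneg:
  assumes f: "f \<in> Cc_nonneg T" and x: "x \<in> carrier G"
  shows "0 \<le> qavg f x"
  unfolding qavg_def using x f H.average_nonneg K.L_carrier K.space_L
  by (intro Bochner_Integration.integral_nonneg) auto

lemma Q_real_Cc:
  assumes f: "f \<in> Cc_nonneg T"
  shows "(\<lambda>D. Re (Q G \<eta>K \<eta>H (\<lambda>x. complex_of_real (f x)) D)) \<in> Cc_nonneg X" (is "?g \<in> _")
    and "\<And>x. x \<in> carrier G \<Longrightarrow> Q G \<eta>K \<eta>H (\<lambda>x. complex_of_real (f x)) (q x) = complex_of_real (qavg f x)"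
proof -
  note fc = of_real_Cc_nonneg[OF hd f]
  show Qx: "Q G \<eta>K \<eta>H (\<lambda>x. complex_of_real (f x)) (q x) = complex_of_real (qavg f x)"
    if "x \<in> carrier G" for x
    using Q_q[OF fc that] by (simp add: coset_integral_of_real)
  have QC: "Q G \<eta>K \<eta>H (\<lambda>x. complex_of_real (f x)) \<in> Cc X"
    by (rule Q_in_Cc[OF fc])
  show "?g \<in> Cc_nonneg X"
  proof (rule Cc_nonneg_from_Cc[OF QC])
    have "continuous_map X euclideanreal (Re \<circ> Q G \<eta>K \<eta>H (\<lambda>x. complex_of_real (f x)))"
      using QC by (intro continuous_map_compose[of _ euclidean]) (auto simp: Cc_def continuous_on_Re)
    then show "continuous_map X euclideanreal ?g"
      by (simp add: o_def)
    fix D assume "D \<in> topspace X"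
    then obtain x where x: "x \<in> carrier G" "D = q x"
      by (auto simp: topspace_X)
    then show "0 \<le> ?g D"
      using Qx qavg_nonneg[OF f] by simp
  qed auto
qed

lemma qavg_continuous:
  assumes f: "f \<in> Cc_nonneg T"
  shows "continuous_map T euclideanreal (qavg f)"
proof -
  have "continuous_map T euclideanreal ((\<lambda>D. Re (Q G \<eta>K \<eta>H (\<lambda>x. complex_of_real (f x)) D)) \<circ> q)"
    by (rule continuous_map_compose[OF continuous_q Cc_nonneg_continuous[OF Q_real_Cc(1)[OF f]]])
  then show ?thesis
    by (rule continuous_map_eq) (simp add: tspace Q_real_Cc(2)[OF f])
qed

lemma continuous_average_orbit:
  assumes "f \<in> Cc_nonneg T"
  shows "continuous_map (prod_topology T (subtopology T K)) euclideanreal (\<lambda>p. H.average f (snd p \<otimes> fst p))"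
  using continuous_map_compose[OF continuous_map_swap_args[OF K.continuous_prod_mult'] H.average_continuous[OF assms]]
  by (simp add: o_def)

lemma continuous_average_K:
  assumes "f \<in> Cc_nonneg T" "x \<in> carrier G"
  shows "continuous_map (subtopology T K) euclideanreal (\<lambda>k. H.average f (k \<otimes> x))"
  using continuous_map_slice[OF continuous_average_orbit[OF assms(1)], of x] assms(2) by (simp add: tspace)

lemma qavg_pos:
  assumes "f \<in> Cc_nonneg T" "x \<in> carrier G" "0 < f x"
  shows "0 < qavg f x"
proof -
  have "0 < H.average f x"
    by (rule H.average_pos[OF assms])
  then show ?thesis
    unfolding qavg_def using assms K.L_carrier K.L_one H.average_nonneg
    by (intro K.M.integral_positive[OF continuous_average_K _ integrable_average, of _ _ \<one>]) auto
qed

lemma inv_\<nu>_real: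
  assumes "k \<in> K" "h \<in> H" "f \<in> Cc_nonneg T"
  shows "(\<integral>x. f (inv k \<otimes> x \<otimes> inv h) \<partial>\<nu>) = \<Delta>K k * \<Delta>H h * (\<integral>x. f x \<partial>\<nu>)"
proof -
  have "complex_of_real (\<integral>x. f (inv k \<otimes> x \<otimes> inv h) \<partial>\<nu>) = complex_of_real (\<Delta>K k * \<Delta>H h * (\<integral>x. f x \<partial>\<nu>))"
    using inv_\<nu>[THEN bspec, OF assms(1), THEN bspec, OF assms(2), THEN bspec,
        OF of_real_Cc_nonneg[OF hd assms(3)]] by simp
  then show ?thesis
    by (simp only: of_real_eq_iff)
qed

lemma right_translate_\<nu>:
  assumes f: "f \<in> Cc_nonneg T" and h: "h \<in> H"
  shows "(\<integral>x. f (x \<otimes> inv h) \<partial>\<nu>) = \<Delta>H h * (\<integral>x. f x \<partial>\<nu>)"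
proof -
  have "(\<integral>x. f (x \<otimes> inv h) \<partial>\<nu>) = (\<integral>x. f (inv \<one> \<otimes> x \<otimes> inv h) \<partial>\<nu>)"
    by (intro radon_integral_cong[OF \<nu>]) (simp add: tspace)
  also have "\<dots> = \<Delta>H h * (\<integral>x. f x \<partial>\<nu>)"
    using inv_\<nu>_real[OF K.L_one h f] K.\<Delta>_one by simp
  finally show ?thesis .
qed

lemma left_translate_\<nu>:
  assumes f: "f \<in> Cc_nonneg T" and k: "k \<in> K"
  shows "(\<integral>x. f (inv k \<otimes> x) \<partial>\<nu>) = \<Delta>K k * (\<integral>x. f x \<partial>\<nu>)"
proof -
  have "(\<integral>x. f (inv k \<otimes> x) \<partial>\<nu>) = (\<integral>x. f (inv k \<otimes> x \<otimes> inv \<one>) \<partial>\<nu>)"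
    using K.L_carrier[OF k] by (intro radon_integral_cong[OF \<nu>]) (simp add: tspace)
  also have "\<dots> = \<Delta>K k * (\<integral>x. f x \<partial>\<nu>)"
    using inv_\<nu>_real[OF k H.L_one f] H.\<Delta>_one by simp
  finally show ?thesis .
qed

lemma continuous_cutoff_average:
  assumes g: "g \<in> Cc_nonneg T" and \<theta>: "\<theta> \<in> Cc_nonneg (subtopology T K)"
  shows "continuous_map T euclideanreal (\<lambda>x. \<integral>k. \<theta> k * H.average g (k \<otimes> x) \<partial>\<eta>K)"
proof -
  obtain D where D: "compactin (subtopology T K) D" "\<And>k. k \<in> topspace (subtopology T K) \<Longrightarrow> k \<notin> D \<Longrightarrow> \<theta> k = 0"
    using Cc_nonneg_support[OF \<theta>] by blast
  have cs: "continuous_map (prod_topology T (subtopology T K)) euclideanreal (\<lambda>p. \<theta> (snd p))"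
    using continuous_map_compose[OF continuous_map_snd Cc_nonneg_continuous[OF \<theta>]] by (simp add: o_def)
  show ?thesis
    by (rule continuous_map_parametric_integral_compact[OF K.M.radon K.M.hd
          continuous_map_real_mult[OF cs continuous_average_orbit[OF g]] D(1)]) (use D(2) in auto)
qed

text \<open>A Dini-type argument: since \<open>qavg g\<close> is continuous, a single compactly supported cutoff on \<open>K\<close>
  captures the integral over \<open>K\<close> up to \<open>e\<close>, uniformly over a compact set of base points. The
  functions \<open>k \<mapsto> \<integral> g(kxh) dh\<close> themselves are not required to have compact support.\<close>

lemma uniform_cutoff:
  assumes g: "g \<in> Cc_nonneg T" and S: "compactin T S" and e: "0 < e"
  obtains \<theta> where "\<theta> \<in> Cc_nonneg (subtopology T K)" "\<And>k. k \<in> K \<Longrightarrow> \<theta> k \<le> 1"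
    "\<And>x. x \<in> S \<Longrightarrow> qavg g x - (\<integral>k. \<theta> k * H.average g (k \<otimes> x) \<partial>\<eta>K) < e"
proof -
  define d where "d = (\<lambda>\<theta> x. qavg g x - (\<integral>k. \<theta> k * H.average g (k \<otimes> x) \<partial>\<eta>K))"
  have Sc: "S \<subseteq> carrier G"
    by (rule compactin_carrier[OF S])
  have int: "integrable \<eta>K (\<lambda>k. \<theta> k * H.average g (k \<otimes> x))"
    if \<theta>: "\<theta> \<in> Cc_nonneg (subtopology T K)" and x: "x \<in> carrier G" for \<theta> x
    using H.average_nonneg[OF g] K.L_carrier x K.topspace_L
    by (intro radon_integrable_Cc[OF K.M.radon K.M.hd] Cc_nonneg_mult[OF \<theta>] continuous_average_K[OF g x]) auto
  have dc: "continuous_map T euclideanreal (d \<theta>)" if "\<theta> \<in> Cc_nonneg (subtopology T K)" for \<theta>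
    unfolding d_def by (intro continuous_map_diff qavg_continuous continuous_cutoff_average g that)
  have mono: "d \<theta> x \<le> d \<theta>' x"
    if "\<theta> \<in> Cc_nonneg (subtopology T K)" "\<theta>' \<in> Cc_nonneg (subtopology T K)" "x \<in> carrier G"
      "\<And>k. k \<in> K \<Longrightarrow> \<theta>' k \<le> \<theta> k" for \<theta> \<theta>' x
  proof -
    have "(\<integral>k. \<theta>' k * H.average g (k \<otimes> x) \<partial>\<eta>K) \<le> (\<integral>k. \<theta> k * H.average g (k \<otimes> x) \<partial>\<eta>K)"
      using that H.average_nonneg[OF g] K.L_carrier K.topspace_L
      by (intro radon_integral_mono[OF K.M.radon int int] mult_right_mono) auto
    then show ?thesis
      by (simp add: d_def)
  qed
  have "\<exists>\<theta>. \<theta> \<in> Cc_nonneg (subtopology T K) \<and> (\<forall>k\<in>K. \<theta> k \<le> 1) \<and> d \<theta> x < e" if x: "x \<in> S" for x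
  proof -
    have xc: "x \<in> carrier G"
      using x Sc by auto
    have "0 \<le> H.average g (k \<otimes> x)" if "k \<in> topspace (subtopology T K)" for k
      using H.average_nonneg[OF g] K.L_carrier xc that K.topspace_L by auto
    then obtain \<theta> where "\<theta> \<in> Cc_nonneg (subtopology T K)" "\<And>k. k \<in> topspace (subtopology T K) \<Longrightarrow> \<theta> k \<le> 1"
      "(\<integral>k. H.average g (k \<otimes> x) \<partial>\<eta>K) - (\<integral>k. \<theta> k * H.average g (k \<otimes> x) \<partial>\<eta>K) < e"
      using radon_cutoff[OF K.M.lc K.M.hd K.M.radon continuous_average_K[OF g xc] _ integrable_average[OF g xc] e]
      by blast
    then show ?thesis
      using K.topspace_L by (auto simp: d_def qavg_def)
  qed
  then obtain \<theta> where \<theta>: "\<And>x. x \<in> S \<Longrightarrow> \<theta> x \<in> Cc_nonneg (subtopology T K)"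
    "\<And>x k. x \<in> S \<Longrightarrow> k \<in> K \<Longrightarrow> \<theta> x k \<le> 1" "\<And>x. x \<in> S \<Longrightarrow> d (\<theta> x) x < e"
    by metis
  define U where "U = (\<lambda>x. {y \<in> topspace T. d (\<theta> x) y < e})"
  have oU: "openin T (U x)" if "x \<in> S" for x
    unfolding U_def using dc[OF \<theta>(1)[OF that]] continuous_map_upper_lower_semicontinuous_lt by blast
  have cov: "S \<subseteq> (\<Union>x\<in>S. U x)"
    using \<theta>(3) Sc by (auto simp: U_def tspace)
  obtain F where F: "finite F" "F \<subseteq> S" "S \<subseteq> (\<Union>x\<in>F. U x)"
    by (rule compactin_finite_subcover[OF S oU cov])
  define \<theta>' where "\<theta>' = (\<lambda>k. min (\<Sum>x\<in>F. \<theta> x k) 1)"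
  have \<theta>': "\<theta>' \<in> Cc_nonneg (subtopology T K)"
    unfolding \<theta>'_def using F(1,2) \<theta>(1) by (intro Cc_nonneg_min_const Cc_nonneg_sum) auto
  show ?thesis
  proof (rule that[OF \<theta>'])
    show "\<theta>' k \<le> 1" for k
      by (simp add: \<theta>'_def)
    fix y assume y: "y \<in> S"
    then obtain x where x: "x \<in> F" "y \<in> U x"
      using F(3) by auto
    then have xS: "x \<in> S"
      using F(2) by auto
    have "\<theta> x k \<le> \<theta>' k" if k: "k \<in> K" for k
    proof -
      have "\<theta> x k \<le> (\<Sum>x\<in>F. \<theta> x k)"
        using x(1) F(1,2) Cc_nonneg_nonneg[OF \<theta>(1)] k K.topspace_L by (intro member_le_sum) auto
      then show ?thesis
        using \<theta>(2)[OF xS k] by (simp add: \<theta>'_def)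
    qed
    then have "d \<theta>' y \<le> d (\<theta> x) y"
      using y Sc by (intro mono \<theta>' \<theta>(1) xS) auto
    then show "qavg g y - (\<integral>k. \<theta>' k * H.average g (k \<otimes> y) \<partial>\<eta>K) < e"
      using x(2) by (simp add: U_def d_def)
  qed
qed

lemma swap_K:
  assumes f: "f \<in> Cc_nonneg T" and g: "g \<in> Cc_nonneg T" and \<theta>: "\<theta> \<in> Cc_nonneg (subtopology T K)"
  shows "(\<integral>x. f x * (\<integral>k. \<theta> k * H.average g (k \<otimes> x) \<partial>\<eta>K) \<partial>\<nu>)
      = (\<integral>k. \<theta> k * (\<integral>x. f x * H.average g (k \<otimes> x) \<partial>\<nu>) \<partial>\<eta>K)"
    and "continuous_map (subtopology T K) euclideanreal (\<lambda>k. \<integral>x. f x * H.average g (k \<otimes> x) \<partial>\<nu>)"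
proof -
  obtain S where S: "compactin T S" "\<And>x. x \<in> topspace T \<Longrightarrow> x \<notin> S \<Longrightarrow> f x = 0"
    using Cc_nonneg_support[OF f] by blast
  obtain D where D: "compactin (subtopology T K) D" "\<And>k. k \<in> topspace (subtopology T K) \<Longrightarrow> k \<notin> D \<Longrightarrow> \<theta> k = 0"
    using Cc_nonneg_support[OF \<theta>] by blast
  have cs: "continuous_map (prod_topology T (subtopology T K)) euclideanreal (\<lambda>p. \<theta> (snd p))"
    using continuous_map_compose[OF continuous_map_snd Cc_nonneg_continuous[OF \<theta>]] by (simp add: o_def)
  have cf: "continuous_map (prod_topology T (subtopology T K)) euclideanreal (\<lambda>p. f (fst p))"
    using continuous_map_compose[OF continuous_map_fst Cc_nonneg_continuous[OF f]] by (simp add: o_def)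
  note ca = continuous_average_orbit[OF g]
  have "(\<integral>x. f x * (\<integral>k. \<theta> k * H.average g (k \<otimes> x) \<partial>\<eta>K) \<partial>\<nu>)
      = (\<integral>x. (\<integral>k. f x * (\<theta> k * H.average g (k \<otimes> x)) \<partial>\<eta>K) \<partial>\<nu>)"
    by simp
  also have "\<dots> = (\<integral>k. (\<integral>x. f x * (\<theta> k * H.average g (k \<otimes> x)) \<partial>\<nu>) \<partial>\<eta>K)"
    by (rule radon_integral_swap[OF \<nu> hd K.M.radon K.M.hd
          continuous_map_real_mult[OF cf continuous_map_real_mult[OF cs ca]] S(1) D(1)])
      (use S(2) D(2) in auto)
  also have "\<dots> = (\<integral>k. \<theta> k * (\<integral>x. f x * H.average g (k \<otimes> x) \<partial>\<nu>) \<partial>\<eta>K)"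
    by (simp add: mult.left_commute)
  finally show "(\<integral>x. f x * (\<integral>k. \<theta> k * H.average g (k \<otimes> x) \<partial>\<eta>K) \<partial>\<nu>)
      = (\<integral>k. \<theta> k * (\<integral>x. f x * H.average g (k \<otimes> x) \<partial>\<nu>) \<partial>\<eta>K)" .
  show "continuous_map (subtopology T K) euclideanreal (\<lambda>k. \<integral>x. f x * H.average g (k \<otimes> x) \<partial>\<nu>)"
    by (rule continuous_map_parametric_integral_compact[OF \<nu> hd
          continuous_map_swap_args[OF continuous_map_real_mult[OF cf ca]] S(1)]) (use S(2) in auto)
qed

text \<open>For fixed \<open>k\<close>, exchanging \<open>f\<close> and \<open>g\<close> replaces \<open>k\<close> by its inverse and produces the factor
  \<open>1/\<Delta>\<^sub>K(k)\<close>: translate by \<open>k\<close>, then apply the symmetry of averaging over \<open>H\<close>.\<close>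

lemma flip_K:
  assumes f: "f \<in> Cc_nonneg T" and g: "g \<in> Cc_nonneg T" and k: "k \<in> K"
  shows "(\<integral>x. f x * H.average g (k \<otimes> x) \<partial>\<nu>) = (\<integral>x. g x * H.average f (inv k \<otimes> x) \<partial>\<nu>) / \<Delta>K k"
proof -
  have kc: "k \<in> carrier G"
    using k by (rule K.L_carrier)
  have fk: "(\<lambda>x. f (inv k \<otimes> x)) \<in> Cc_nonneg T"
    using kc by (intro Cc_nonneg_translate f) simp
  have "continuous_map T T (\<lambda>x. k \<otimes> x)"
    using kc by (intro group_continuous)
  then have "continuous_map T euclideanreal (H.average g \<circ> (\<lambda>x. k \<otimes> x))"
    using H.average_continuous[OF g] by (rule continuous_map_compose)
  then have "(\<lambda>x. f x * H.average g (k \<otimes> x)) \<in> Cc_nonneg T"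
    using H.average_nonneg[OF g] kc by (intro Cc_nonneg_mult f) (auto simp: o_def tspace)
  from left_translate_\<nu>[OF this k]
  have "\<Delta>K k * (\<integral>x. f x * H.average g (k \<otimes> x) \<partial>\<nu>)
      = (\<integral>x. f (inv k \<otimes> x) * H.average g (k \<otimes> (inv k \<otimes> x)) \<partial>\<nu>)"
    by simp
  also have "\<dots> = (\<integral>x. f (inv k \<otimes> x) * H.average g x \<partial>\<nu>)"
    using kc by (intro radon_integral_cong[OF \<nu>]) (simp add: tspace flip: m_assoc)
  also have "\<dots> = (\<integral>x. g x * H.average (\<lambda>x. f (inv k \<otimes> x)) x \<partial>\<nu>)"
    by (rule H.average_symmetric[OF \<nu> right_translate_\<nu> fk g])
  also have "\<dots> = (\<integral>x. g x * H.average f (inv k \<otimes> x) \<partial>\<nu>)"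
  proof (rule radon_integral_cong[OF \<nu>])
    fix x assume "x \<in> topspace T"
    then have "H.average (\<lambda>x. f (inv k \<otimes> x)) x = H.average f (inv k \<otimes> x)"
      unfolding H.average_def using kc H.L_carrier H.topspace_L
      by (intro radon_integral_cong[OF H.M.radon]) (simp add: tspace m_assoc)
    then show "g x * H.average (\<lambda>x. f (inv k \<otimes> x)) x = g x * H.average f (inv k \<otimes> x)"
      by simp
  qed
  finally show ?thesis
    using K.\<Delta>_pos[OF k] by (simp add: field_simps)
qed

text \<open>One inequality suffices, since it may be applied with \<open>f\<close> and \<open>g\<close> exchanged. Hence the
  cutoff \<open>\<theta>\<close>, needed to exchange integrals, can afterwards be discarded by \<open>\<theta> \<le> 1\<close>.\<close>

lemma qavg_symmetric_le:
  assumes f: "f \<in> Cc_nonneg T" and g: "g \<in> Cc_nonneg T"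
  shows "(\<integral>x. f x * qavg g x \<partial>\<nu>) \<le> (\<integral>x. g x * qavg f x \<partial>\<nu>)"
proof -
  obtain S where S: "compactin T S" "\<And>x. x \<in> topspace T \<Longrightarrow> x \<notin> S \<Longrightarrow> f x = 0"
    using Cc_nonneg_support[OF f] by blast
  have le: "(\<integral>x. f x * qavg g x \<partial>\<nu>) \<le> (\<integral>x. g x * qavg f x \<partial>\<nu>) + e * (\<integral>x. f x \<partial>\<nu>)" if e: "0 < e" for e
  proof -
    obtain \<theta> where \<theta>: "\<theta> \<in> Cc_nonneg (subtopology T K)" "\<And>k. k \<in> K \<Longrightarrow> \<theta> k \<le> 1"
      "\<And>x. x \<in> S \<Longrightarrow> qavg g x - (\<integral>k. \<theta> k * H.average g (k \<otimes> x) \<partial>\<eta>K) < e"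
      using uniform_cutoff[OF g S(1) e] by blast
    define \<theta>' where "\<theta>' = (\<lambda>k. \<theta> (inv k))"
    have \<theta>': "\<theta>' \<in> Cc_nonneg (subtopology T K)"
      unfolding \<theta>'_def by (rule K.Cc_nonneg_inverse_L[OF \<theta>(1)])
    have \<theta>'1: "0 \<le> \<theta>' k" "\<theta>' k \<le> 1" if "k \<in> K" for k
      using \<theta>(2) Cc_nonneg_nonneg[OF \<theta>'] that K.L_inv K.topspace_L by (auto simp: \<theta>'_def)
    define N where "N = (\<lambda>k. \<integral>x. g x * H.average f (k \<otimes> x) \<partial>\<nu>)"
    have nn: "0 \<le> (\<integral>k. t k * H.average u (k \<otimes> x) \<partial>\<eta>K)"
      if "t \<in> Cc_nonneg (subtopology T K)" "u \<in> Cc_nonneg T" "x \<in> carrier G" for t u x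
      using that Cc_nonneg_nonneg[OF that(1)] H.average_nonneg[OF that(2)] K.L_carrier K.topspace_L K.space_L
      by (intro Bochner_Integration.integral_nonneg mult_nonneg_nonneg) auto
    have i1: "integrable \<nu> (\<lambda>x. f x * (\<integral>k. \<theta> k * H.average g (k \<otimes> x) \<partial>\<eta>K))"
      using nn[OF \<theta>(1) g] tspace
      by (intro radon_integrable_Cc[OF \<nu> hd] Cc_nonneg_mult[OF f] continuous_cutoff_average[OF g \<theta>(1)]) auto
    have i2: "integrable \<nu> (\<lambda>x. e * f x)"
      using radon_integrable_Cc[OF \<nu> hd f] by simp
    have "(\<integral>x. f x * qavg g x \<partial>\<nu>)
        \<le> (\<integral>x. f x * (\<integral>k. \<theta> k * H.average g (k \<otimes> x) \<partial>\<eta>K) + e * f x \<partial>\<nu>)"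
    proof (rule radon_integral_mono[OF \<nu>])
      show "integrable \<nu> (\<lambda>x. f x * qavg g x)"
        using qavg_nonneg[OF g] tspace
        by (intro radon_integrable_Cc[OF \<nu> hd] Cc_nonneg_mult[OF f] qavg_continuous[OF g]) auto
      show "integrable \<nu> (\<lambda>x. f x * (\<integral>k. \<theta> k * H.average g (k \<otimes> x) \<partial>\<eta>K) + e * f x)"
        using i1 i2 by simp
      fix x assume x: "x \<in> topspace T"
      show "f x * qavg g x \<le> f x * (\<integral>k. \<theta> k * H.average g (k \<otimes> x) \<partial>\<eta>K) + e * f x"
      proof (cases "x \<in> S")
        case True
        have "f x * qavg g x \<le> f x * ((\<integral>k. \<theta> k * H.average g (k \<otimes> x) \<partial>\<eta>K) + e)"
          using \<theta>(3)[OF True] Cc_nonneg_nonneg[OF f x] by (intro mult_left_mono) auto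
        then show ?thesis
          by (simp add: distrib_left mult.commute)
      qed (use S(2)[OF x] in simp)
    qed
    also have "\<dots> = (\<integral>x. f x * (\<integral>k. \<theta> k * H.average g (k \<otimes> x) \<partial>\<eta>K) \<partial>\<nu>) + e * (\<integral>x. f x \<partial>\<nu>)"
      using i1 i2 by simp
    also have "(\<integral>x. f x * (\<integral>k. \<theta> k * H.average g (k \<otimes> x) \<partial>\<eta>K) \<partial>\<nu>)
        = (\<integral>k. \<theta> k * (\<integral>x. f x * H.average g (k \<otimes> x) \<partial>\<nu>) \<partial>\<eta>K)"
      by (rule swap_K(1)[OF f g \<theta>(1)])
    also have "\<dots> = (\<integral>k. (\<theta>' (inv k) * N (inv k)) / \<Delta>K k \<partial>\<eta>K)"
      using K.L_carrier K.topspace_L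
      by (intro radon_integral_cong[OF K.M.radon]) (simp add: flip_K[OF f g] \<theta>'_def N_def)
    also have "\<dots> = (\<integral>k. \<theta>' k * N k \<partial>\<eta>K)"
    proof (rule K.inverse_integral_L)
      have "0 \<le> N k" if "k \<in> K" for k
        unfolding N_def using that radon_space[OF \<nu>] Cc_nonneg_nonneg[OF g] H.average_nonneg[OF f] K.L_carrier
        by (intro Bochner_Integration.integral_nonneg mult_nonneg_nonneg) (auto simp: tspace)
      then show "(\<lambda>k. \<theta>' k * N k) \<in> Cc_nonneg (subtopology T K)"
        using K.topspace_L swap_K(2)[OF g f \<theta>'] by (intro Cc_nonneg_mult[OF \<theta>']) (auto simp: N_def)
    qed
    also have "\<dots> = (\<integral>x. g x * (\<integral>k. \<theta>' k * H.average f (k \<otimes> x) \<partial>\<eta>K) \<partial>\<nu>)"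
      unfolding N_def by (rule swap_K(1)[OF g f \<theta>', symmetric])
    also have "\<dots> \<le> (\<integral>x. g x * qavg f x \<partial>\<nu>)"
    proof (rule radon_integral_mono[OF \<nu>])
      show "integrable \<nu> (\<lambda>x. g x * qavg f x)"
        using qavg_nonneg[OF f] tspace
        by (intro radon_integrable_Cc[OF \<nu> hd] Cc_nonneg_mult[OF g] qavg_continuous[OF f]) auto
      show "integrable \<nu> (\<lambda>x. g x * (\<integral>k. \<theta>' k * H.average f (k \<otimes> x) \<partial>\<eta>K))"
        using nn[OF \<theta>' f] tspace
        by (intro radon_integrable_Cc[OF \<nu> hd] Cc_nonneg_mult[OF g] continuous_cutoff_average[OF f \<theta>']) auto
      fix x assume x: "x \<in> topspace T"
      then have xc: "x \<in> carrier G"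
        by (simp add: tspace)
      have a: "0 \<le> H.average f (k \<otimes> x)" if "k \<in> K" for k
        using H.average_nonneg[OF f] K.L_carrier xc that by auto
      have "(\<integral>k. \<theta>' k * H.average f (k \<otimes> x) \<partial>\<eta>K) \<le> qavg f x"
        unfolding qavg_def
      proof (rule radon_integral_mono[OF K.M.radon _ integrable_average[OF f xc]])
        show "integrable \<eta>K (\<lambda>k. \<theta>' k * H.average f (k \<otimes> x))"
          using a K.topspace_L
          by (intro radon_integrable_Cc[OF K.M.radon K.M.hd] Cc_nonneg_mult[OF \<theta>'] continuous_average_K[OF f xc]) auto
        show "\<theta>' k * H.average f (k \<otimes> x) \<le> H.average f (k \<otimes> x)" if "k \<in> topspace (subtopology T K)" for k
          using \<theta>'1[of k] a[of k] that K.topspace_L by (simp add: mult_left_le_one_le)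
      qed
      then show "g x * (\<integral>k. \<theta>' k * H.average f (k \<otimes> x) \<partial>\<eta>K) \<le> g x * qavg f x"
        using Cc_nonneg_nonneg[OF g x] by (rule mult_left_mono)
    qed
    finally show ?thesis
      by simp
  qed
  define c where "c = (\<integral>x. f x \<partial>\<nu>)"
  have c: "0 \<le> c"
    unfolding c_def using Cc_nonneg_nonneg[OF f] radon_space[OF \<nu>]
    by (intro Bochner_Integration.integral_nonneg) auto
  show ?thesis
  proof (rule field_le_epsilon)
    fix e :: real assume e: "0 < e"
    have "e / (c + 1) * c \<le> e"
      using e c by (simp add: field_simps)
    then show "(\<integral>x. f x * qavg g x \<partial>\<nu>) \<le> (\<integral>x. g x * qavg f x \<partial>\<nu>) + e"
      using le[of "e / (c + 1)"] e c by (simp add: c_def)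
  qed
qed

lemma qavg_symmetric:
  assumes "f \<in> Cc_nonneg T" "g \<in> Cc_nonneg T"
  shows "(\<integral>x. f x * qavg g x \<partial>\<nu>) = (\<integral>x. g x * qavg f x \<partial>\<nu>)"
  using qavg_symmetric_le assms by (intro antisym)

section \<open>The quotient measure\<close>

lemma qavg_mult_q:
  assumes f: "f \<in> Cc_nonneg T" and x: "x \<in> carrier G"
  shows "qavg (\<lambda>x. f x * g (q x)) x = qavg f x * g (q x)"
proof -
  have "H.average (\<lambda>x. f x * g (q x)) (k \<otimes> x) = H.average f (k \<otimes> x) * g (q x)" if k: "k \<in> K" for k
  proof -
    have "H.average (\<lambda>x. f x * g (q x)) (k \<otimes> x) = (\<integral>h. f (k \<otimes> x \<otimes> h) * g (q x) \<partial>\<eta>H)"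
      unfolding H.average_def using q_mult[OF x k]
      by (intro radon_integral_cong[OF H.M.radon]) simp
    then show ?thesis
      by (simp add: H.average_def)
  qed
  then have "qavg (\<lambda>x. f x * g (q x)) x = (\<integral>k. H.average f (k \<otimes> x) * g (q x) \<partial>\<eta>K)"
    unfolding qavg_def by (intro radon_integral_cong[OF K.M.radon]) simp
  then show ?thesis
    by (simp add: qavg_def)
qed

lemma qavg_add:
  assumes f: "f \<in> Cc_nonneg T" and g: "g \<in> Cc_nonneg T" and x: "x \<in> carrier G"
  shows "qavg (\<lambda>x. f x + g x) x = qavg f x + qavg g x"
proof -
  have "H.average (\<lambda>x. f x + g x) (k \<otimes> x) = H.average f (k \<otimes> x) + H.average g (k \<otimes> x)" if "k \<in> K" for k
    unfolding H.average_def using that x K.L_carrier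
    by (intro Bochner_Integration.integral_add H.integrable_orbit f g) auto
  then have "qavg (\<lambda>x. f x + g x) x = (\<integral>k. H.average f (k \<otimes> x) + H.average g (k \<otimes> x) \<partial>\<eta>K)"
    unfolding qavg_def by (intro radon_integral_cong[OF K.M.radon]) simp
  also have "\<dots> = qavg f x + qavg g x"
    unfolding qavg_def by (intro Bochner_Integration.integral_add integrable_average f g x)
  finally show ?thesis .
qed

lemma qavg_cmult: "qavg (\<lambda>x. c * f x) x = c * qavg f x"
  by (simp add: qavg_def H.average_def)

text \<open>If \<open>\<psi>\<close> has \<open>Q \<psi> > 0\<close> on \<open>C\<close>, dividing \<open>\<psi>\<close> by \<open>max (Q \<psi>) \<delta>\<close>, where \<open>\<delta>\<close> is the minimum of
  \<open>Q \<psi>\<close> on \<open>C\<close>, gives a function whose double average is \<open>1\<close> on \<open>C\<close>.\<close>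

lemma unit_on_compact:
  assumes C: "compactin X C"
  obtains \<phi> where "\<phi> \<in> Cc_nonneg T" "\<And>x. x \<in> carrier G \<Longrightarrow> q x \<in> C \<Longrightarrow> qavg \<phi> x = 1"
proof (cases "C = {}")
  case True
  show ?thesis
    by (rule that[OF Cc_nonneg_zero]) (use True in auto)
next
  case False
  obtain D where D: "compactin T D" "C \<subseteq> q ` D"
    using compact_lift[OF C] by blast
  have Dc: "D \<subseteq> carrier G"
    by (rule compactin_carrier[OF D(1)])
  obtain \<psi> where \<psi>: "\<psi> \<in> Cc_nonneg T" "\<And>x. x \<in> D \<Longrightarrow> \<psi> x = 1"
    using Urysohn_Cc[OF lc hd D(1) openin_topspace compactin_subset_topspace[OF D(1)]] by metis
  define p where "p = (\<lambda>E. Re (Q G \<eta>K \<eta>H (\<lambda>x. complex_of_real (\<psi> x)) E))"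
  have p: "p \<in> Cc_nonneg X"
    unfolding p_def by (rule Q_real_Cc(1)[OF \<psi>(1)])
  have pq: "p (q x) = qavg \<psi> x" if "x \<in> carrier G" for x
    using Q_real_Cc(2)[OF \<psi>(1) that] by (simp add: p_def)
  have ppos: "0 < p E" if E: "E \<in> C" for E
  proof -
    obtain x where x: "x \<in> D" "E = q x"
      using D(2) E by auto
    then show ?thesis
      using pq[of x] qavg_pos[OF \<psi>(1), of x] \<psi>(2)[of x] Dc by auto
  qed
  have "compact (p ` C)"
    using image_compactin[OF C Cc_nonneg_continuous[OF p]] by simp
  then obtain \<delta> where \<delta>: "\<delta> \<in> p ` C" "\<And>t. t \<in> p ` C \<Longrightarrow> \<delta> \<le> t"
    using compact_attains_inf[of "p ` C"] False by auto
  have \<delta>0: "0 < \<delta>"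
    using \<delta>(1) ppos by auto
  define \<phi> where "\<phi> = (\<lambda>x. \<psi> x * (1 / max (p (q x)) \<delta>))"
  have m: "max t \<delta> > 0" for t
    using \<delta>0 by simp
  have "continuous_map T euclideanreal (p \<circ> q)"
    by (rule continuous_map_compose[OF continuous_q Cc_nonneg_continuous[OF p]])
  then have "continuous_map T euclideanreal (\<lambda>x. 1 / max (p (q x)) \<delta>)"
    using m by (intro continuous_map_real_divide continuous_map_real_max continuous_map_canonical_const)
      (auto simp: o_def less_imp_neq[symmetric])
  then have \<phi>: "\<phi> \<in> Cc_nonneg T"
    unfolding \<phi>_def using m by (intro Cc_nonneg_mult \<psi>) (auto intro: less_imp_le)
  have "qavg \<phi> x = 1" if x: "x \<in> carrier G" "q x \<in> C" for x
  proof -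
    have "qavg \<phi> x = qavg \<psi> x * (1 / max (p (q x)) \<delta>)"
      unfolding \<phi>_def by (rule qavg_mult_q[OF \<psi>(1) x(1)])
    moreover have "\<delta> \<le> p (q x)"
      using \<delta>(2) x(2) by blast
    ultimately show ?thesis
      using pq[OF x(1)] \<delta>0 by simp
  qed
  with \<phi> show ?thesis
    by (rule that)
qed

text \<open>The lift \<open>\<phi> (g \<circ> q)\<close> shows that \<open>Q\<close> maps onto \<open>C\<^sub>c\<close> of the double coset space.\<close>

lemma lift_Cc:
  assumes g: "g \<in> Cc_nonneg X" and z: "\<And>E. E \<in> topspace X \<Longrightarrow> E \<notin> C \<Longrightarrow> g E = 0"
    and \<phi>: "\<phi> \<in> Cc_nonneg T" "\<And>x. x \<in> carrier G \<Longrightarrow> q x \<in> C \<Longrightarrow> qavg \<phi> x = 1"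
  shows "(\<lambda>x. \<phi> x * g (q x)) \<in> Cc_nonneg T"
    and "\<And>x. x \<in> carrier G \<Longrightarrow> qavg (\<lambda>x. \<phi> x * g (q x)) x = g (q x)"
proof -
  have "continuous_map T euclideanreal (g \<circ> q)"
    by (rule continuous_map_compose[OF continuous_q Cc_nonneg_continuous[OF g]])
  then show "(\<lambda>x. \<phi> x * g (q x)) \<in> Cc_nonneg T"
    using Cc_nonneg_nonneg[OF g] topspace_X tspace by (intro Cc_nonneg_mult \<phi>) (auto simp: o_def)
  show "qavg (\<lambda>x. \<phi> x * g (q x)) x = g (q x)" if x: "x \<in> carrier G" for x
    unfolding qavg_mult_q[OF \<phi>(1) x] using \<phi>(2)[OF x] z[of "q x"] x topspace_X by (cases "q x \<in> C") auto
qed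

lemma exists_lift:
  assumes g: "g \<in> Cc_nonneg X"
  obtains f where "f \<in> Cc_nonneg T" "\<And>x. x \<in> carrier G \<Longrightarrow> qavg f x = g (q x)"
proof -
  obtain C where C: "compactin X C" "\<And>E. E \<in> topspace X \<Longrightarrow> E \<notin> C \<Longrightarrow> g E = 0"
    using Cc_nonneg_support[OF g] by blast
  obtain \<phi> where "\<phi> \<in> Cc_nonneg T" "\<And>x. x \<in> carrier G \<Longrightarrow> q x \<in> C \<Longrightarrow> qavg \<phi> x = 1"
    using unit_on_compact[OF C(1)] by blast
  then show ?thesis
    using that lift_Cc[OF g C(2)] by blast
qed

text \<open>The integral of \<open>f\<close> against \<open>\<nu>\<close> depends only on the double average of \<open>f\<close>.\<close>

lemma integral_determined:
  assumes f: "f \<in> Cc_nonneg T" and g: "g \<in> Cc_nonneg T"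
    and eq: "\<And>x. x \<in> carrier G \<Longrightarrow> qavg f x = qavg g x"
  shows "(\<integral>x. f x \<partial>\<nu>) = (\<integral>x. g x \<partial>\<nu>)"
proof -
  obtain S where S: "compactin T S" "\<And>x. x \<in> topspace T \<Longrightarrow> x \<notin> S \<Longrightarrow> f x = 0"
    using Cc_nonneg_support[OF f] by blast
  obtain R where R: "compactin T R" "\<And>x. x \<in> topspace T \<Longrightarrow> x \<notin> R \<Longrightarrow> g x = 0"
    using Cc_nonneg_support[OF g] by blast
  have "compactin X (q ` (S \<union> R))"
    by (intro image_compactin[OF _ continuous_q] compactin_Un S R)
  then obtain \<phi> where \<phi>: "\<phi> \<in> Cc_nonneg T" "\<And>x. x \<in> carrier G \<Longrightarrow> q x \<in> q ` (S \<union> R) \<Longrightarrow> qavg \<phi> x = 1"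
    using unit_on_compact by blast
  have "(\<integral>x. f x \<partial>\<nu>) = (\<integral>x. f x * qavg \<phi> x \<partial>\<nu>)"
  proof (rule radon_integral_cong[OF \<nu>])
    show "f x = f x * qavg \<phi> x" if "x \<in> topspace T" for x
      using S(2)[OF that] \<phi>(2)[of x] that by (cases "x \<in> S") (auto simp: tspace)
  qed
  also have "\<dots> = (\<integral>x. \<phi> x * qavg f x \<partial>\<nu>)"
    by (rule qavg_symmetric[OF f \<phi>(1)])
  also have "\<dots> = (\<integral>x. \<phi> x * qavg g x \<partial>\<nu>)"
    using eq by (intro radon_integral_cong[OF \<nu>]) (simp add: tspace)
  also have "\<dots> = (\<integral>x. g x * qavg \<phi> x \<partial>\<nu>)"
    by (rule qavg_symmetric[OF \<phi>(1) g])
  also have "\<dots> = (\<integral>x. g x \<partial>\<nu>)"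
  proof (rule radon_integral_cong[OF \<nu>])
    show "g x * qavg \<phi> x = g x" if "x \<in> topspace T" for x
      using R(2)[OF that] \<phi>(2)[of x] that by (cases "x \<in> R") (auto simp: tspace)
  qed
  finally show ?thesis .
qed

text \<open>The functional on the double coset space: integrate any lift against \<open>\<nu>\<close>.\<close>

definition quotient_functional :: "('a set \<Rightarrow> real) \<Rightarrow> real" where
  "quotient_functional g =
     (\<integral>x. (SOME f. f \<in> Cc_nonneg T \<and> (\<forall>x\<in>carrier G. qavg f x = g (q x))) x \<partial>\<nu>)"

lemma quotient_functional_eq:
  assumes f: "f \<in> Cc_nonneg T" and eq: "\<And>x. x \<in> carrier G \<Longrightarrow> qavg f x = g (q x)"
  shows "quotient_functional g = (\<integral>x. f x \<partial>\<nu>)"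
proof -
  define P where "P = (\<lambda>f. f \<in> Cc_nonneg T \<and> (\<forall>x\<in>carrier G. qavg f x = g (q x)))"
  have "P f"
    using f eq by (simp add: P_def)
  then have "P (SOME f. P f)"
    by (rule someI[of P])
  then have s: "(SOME f. P f) \<in> Cc_nonneg T" "\<And>x. x \<in> carrier G \<Longrightarrow> qavg (SOME f. P f) x = g (q x)"
    by (simp_all add: P_def)
  have "(\<integral>x. (SOME f. P f) x \<partial>\<nu>) = (\<integral>x. f x \<partial>\<nu>)"
    by (rule integral_determined[OF s(1) f]) (simp add: s(2) eq)
  then show ?thesis
    by (simp add: quotient_functional_def P_def)
qed

lemma positive_functional_quotient: "positive_functional X quotient_functional"
proof
  show "locally_compact_space X" "Hausdorff_space X"
    by (rule lcX hdX)+
next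
  fix g1 g2 assume g: "g1 \<in> Cc_nonneg X" "g2 \<in> Cc_nonneg X"
  obtain f1 where f1: "f1 \<in> Cc_nonneg T" "\<And>x. x \<in> carrier G \<Longrightarrow> qavg f1 x = g1 (q x)"
    using exists_lift[OF g(1)] by blast
  obtain f2 where f2: "f2 \<in> Cc_nonneg T" "\<And>x. x \<in> carrier G \<Longrightarrow> qavg f2 x = g2 (q x)"
    using exists_lift[OF g(2)] by blast
  have "quotient_functional (\<lambda>E. g1 E + g2 E) = (\<integral>x. f1 x + f2 x \<partial>\<nu>)"
    using f1 f2 by (intro quotient_functional_eq Cc_nonneg_add) (auto simp: qavg_add)
  also have "\<dots> = (\<integral>x. f1 x \<partial>\<nu>) + (\<integral>x. f2 x \<partial>\<nu>)"
    by (intro Bochner_Integration.integral_add radon_integrable_Cc[OF \<nu> hd] f1 f2)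
  also have "\<dots> = quotient_functional g1 + quotient_functional g2"
    using quotient_functional_eq[OF f1] quotient_functional_eq[OF f2] by simp
  finally show "quotient_functional (\<lambda>E. g1 E + g2 E) = quotient_functional g1 + quotient_functional g2" .
next
  fix g and c :: real assume g: "g \<in> Cc_nonneg X" and c: "0 \<le> c"
  obtain f where f: "f \<in> Cc_nonneg T" "\<And>x. x \<in> carrier G \<Longrightarrow> qavg f x = g (q x)"
    using exists_lift[OF g] by blast
  have "quotient_functional (\<lambda>E. c * g E) = (\<integral>x. c * f x \<partial>\<nu>)"
    using f c by (intro quotient_functional_eq Cc_nonneg_cmult) (auto simp: qavg_cmult)
  then show "quotient_functional (\<lambda>E. c * g E) = c * quotient_functional g"
    using quotient_functional_eq[OF f] by simp
next
  fix g1 g2 assume g: "g1 \<in> Cc_nonneg X" "g2 \<in> Cc_nonneg X"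
    and le: "\<And>E. E \<in> topspace X \<Longrightarrow> g1 E \<le> g2 E"
  obtain C1 where C1: "compactin X C1" "\<And>E. E \<in> topspace X \<Longrightarrow> E \<notin> C1 \<Longrightarrow> g1 E = 0"
    using Cc_nonneg_support[OF g(1)] by blast
  obtain C2 where C2: "compactin X C2" "\<And>E. E \<in> topspace X \<Longrightarrow> E \<notin> C2 \<Longrightarrow> g2 E = 0"
    using Cc_nonneg_support[OF g(2)] by blast
  \<comment> \<open>Lifting \<open>g1\<close> and \<open>g2\<close> with the same \<open>\<phi>\<close> preserves their order.\<close>
  obtain \<phi> where \<phi>: "\<phi> \<in> Cc_nonneg T" "\<And>x. x \<in> carrier G \<Longrightarrow> q x \<in> C1 \<union> C2 \<Longrightarrow> qavg \<phi> x = 1"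
    using unit_on_compact[OF compactin_Un[OF C1(1) C2(1)]] by blast
  have l1: "(\<lambda>x. \<phi> x * g1 (q x)) \<in> Cc_nonneg T" "\<And>x. x \<in> carrier G \<Longrightarrow> qavg (\<lambda>x. \<phi> x * g1 (q x)) x = g1 (q x)"
    using lift_Cc[OF g(1) _ \<phi>] C1(2) by auto
  have l2: "(\<lambda>x. \<phi> x * g2 (q x)) \<in> Cc_nonneg T" "\<And>x. x \<in> carrier G \<Longrightarrow> qavg (\<lambda>x. \<phi> x * g2 (q x)) x = g2 (q x)"
    using lift_Cc[OF g(2) _ \<phi>] C2(2) by auto
  have "(\<integral>x. \<phi> x * g1 (q x) \<partial>\<nu>) \<le> (\<integral>x. \<phi> x * g2 (q x) \<partial>\<nu>)"
  proof (rule radon_integral_mono[OF \<nu> radon_integrable_Cc[OF \<nu> hd l1(1)] radon_integrable_Cc[OF \<nu> hd l2(1)]])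
    fix x assume x: "x \<in> topspace T"
    then have "q x \<in> topspace X"
      by (simp add: topspace_X tspace)
    then show "\<phi> x * g1 (q x) \<le> \<phi> x * g2 (q x)"
      using le Cc_nonneg_nonneg[OF \<phi>(1) x] by (intro mult_left_mono) auto
  qed
  then show "quotient_functional g1 \<le> quotient_functional g2"
    using quotient_functional_eq[OF l1] quotient_functional_eq[OF l2] by simp
qed

lemma exists_quotient_measure:
  obtains \<mu> where "radon_measure X \<mu>"
    "\<And>f. f \<in> Cc_nonneg T \<Longrightarrow>
      (\<integral>D. Re (Q G \<eta>K \<eta>H (\<lambda>x. complex_of_real (f x)) D) \<partial>\<mu>) = (\<integral>x. f x \<partial>\<nu>)"
proof -
  obtain \<mu> where \<mu>: "radon_measure X \<mu>"
    "\<And>g. g \<in> Cc_nonneg X \<Longrightarrow> (\<integral>D. g D \<partial>\<mu>) = quotient_functional g"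
    using positive_functional.riesz_representation[OF positive_functional_quotient] by blast
  show ?thesis
  proof (rule that[OF \<mu>(1)])
    fix f assume f: "f \<in> Cc_nonneg T"
    show "(\<integral>D. Re (Q G \<eta>K \<eta>H (\<lambda>x. complex_of_real (f x)) D) \<partial>\<mu>) = (\<integral>x. f x \<partial>\<nu>)"
      unfolding \<mu>(2)[OF Q_real_Cc(1)[OF f]]
      by (rule quotient_functional_eq[OF f]) (simp add: Q_real_Cc(2)[OF f])
  qed
qed

text \<open>A function in \<open>C\<^sub>c\<close> is a complex combination of four non-negative ones, so the formula on the
  cone extends to all of \<open>C\<^sub>c(G)\<close>.\<close>

lemma coset_integral_decompose:
  assumes abcd: "a \<in> Cc_nonneg T" "b \<in> Cc_nonneg T" "c \<in> Cc_nonneg T" "d \<in> Cc_nonneg T"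
    and x: "x \<in> carrier G"
  shows "coset_integral G \<eta>K \<eta>H (\<lambda>x. complex_of_real (a x) - complex_of_real (b x)
            + \<i> * (complex_of_real (c x) - complex_of_real (d x))) x
    = complex_of_real (qavg a x) - complex_of_real (qavg b x)
            + \<i> * (complex_of_real (qavg c x) - complex_of_real (qavg d x))"
proof -
  have i: "integrable \<eta>H (\<lambda>h. complex_of_real (f (k \<otimes> x \<otimes> h)))" if "f \<in> Cc_nonneg T" "k \<in> K" for f k
    using H.integrable_orbit[OF that(1), of "k \<otimes> x"] K.L_carrier[OF that(2)] x
    by (simp add: complex_of_real_integrable_eq)
  have j: "integrable \<eta>K (\<lambda>k. complex_of_real (H.average f (k \<otimes> x)))" if "f \<in> Cc_nonneg T" for f
    using integrable_average[OF that x] by (simp add: complex_of_real_integrable_eq)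
  have "coset_integral G \<eta>K \<eta>H (\<lambda>x. complex_of_real (a x) - complex_of_real (b x)
            + \<i> * (complex_of_real (c x) - complex_of_real (d x))) x
      = (\<integral>k. complex_of_real (H.average a (k \<otimes> x)) - complex_of_real (H.average b (k \<otimes> x))
            + \<i> * (complex_of_real (H.average c (k \<otimes> x)) - complex_of_real (H.average d (k \<otimes> x))) \<partial>\<eta>K)"
    unfolding coset_integral_def
  proof (rule radon_integral_cong[OF K.M.radon])
    fix k assume "k \<in> topspace (subtopology T K)"
    then have k: "k \<in> K"
      by simp
    show "(\<integral>h. complex_of_real (a (k \<otimes> x \<otimes> h)) - complex_of_real (b (k \<otimes> x \<otimes> h))
            + \<i> * (complex_of_real (c (k \<otimes> x \<otimes> h)) - complex_of_real (d (k \<otimes> x \<otimes> h))) \<partial>\<eta>H)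
        = complex_of_real (H.average a (k \<otimes> x)) - complex_of_real (H.average b (k \<otimes> x))
            + \<i> * (complex_of_real (H.average c (k \<otimes> x)) - complex_of_real (H.average d (k \<otimes> x)))"
      using i[OF abcd(1) k] i[OF abcd(2) k] i[OF abcd(3) k] i[OF abcd(4) k]
      by (simp add: H.average_def)
  qed
  also have "\<dots> = complex_of_real (qavg a x) - complex_of_real (qavg b x)
            + \<i> * (complex_of_real (qavg c x) - complex_of_real (qavg d x))"
    using j[OF abcd(1)] j[OF abcd(2)] j[OF abcd(3)] j[OF abcd(4)] by (simp add: qavg_def)
  finally show ?thesis .
qed

lemma integral_Q:
  assumes \<mu>: "radon_measure X \<mu>"
    and real: "\<And>f. f \<in> Cc_nonneg T \<Longrightarrow>
      (\<integral>D. Re (Q G \<eta>K \<eta>H (\<lambda>x. complex_of_real (f x)) D) \<partial>\<mu>) = (\<integral>x. f x \<partial>\<nu>)"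
    and f: "f \<in> Cc T"
  shows "(\<integral>x. f x \<partial>\<nu>) = (\<integral>D. Q G \<eta>K \<eta>H f D \<partial>\<mu>)"
proof -
  obtain a b c d where abcd: "a \<in> Cc_nonneg T" "b \<in> Cc_nonneg T" "c \<in> Cc_nonneg T" "d \<in> Cc_nonneg T"
    and f_eq: "f = (\<lambda>x. complex_of_real (a x) - complex_of_real (b x)
            + \<i> * (complex_of_real (c x) - complex_of_real (d x)))"
    by (rule Cc_decompose[OF f])
  define R where "R = (\<lambda>f D. Re (Q G \<eta>K \<eta>H (\<lambda>x. complex_of_real (f x)) D))"
  have Rq: "R f (q x) = qavg f x" if "f \<in> Cc_nonneg T" "x \<in> carrier G" for f x
    using Q_real_Cc(2)[OF that] by (simp add: R_def)
  have i\<mu>: "integrable \<mu> (\<lambda>D. complex_of_real (R f D))" if "f \<in> Cc_nonneg T" for f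
    using radon_integrable_Cc[OF \<mu> hdX Q_real_Cc(1)[OF that]] by (simp add: R_def complex_of_real_integrable_eq)
  have i\<nu>: "integrable \<nu> (\<lambda>x. complex_of_real (f x))" if "f \<in> Cc_nonneg T" for f
    using radon_integrable_Cc[OF \<nu> hd that] by (simp add: complex_of_real_integrable_eq)
  have Rint: "(\<integral>D. R f D \<partial>\<mu>) = (\<integral>x. f x \<partial>\<nu>)" if "f \<in> Cc_nonneg T" for f
    unfolding R_def by (rule real[OF that])
  have "(\<integral>D. Q G \<eta>K \<eta>H f D \<partial>\<mu>) = (\<integral>D. complex_of_real (R a D) - complex_of_real (R b D)
            + \<i> * (complex_of_real (R c D) - complex_of_real (R d D)) \<partial>\<mu>)"
  proof (rule radon_integral_cong[OF \<mu>])
    fix D assume "D \<in> topspace X"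
    then obtain x where x: "x \<in> carrier G" "D = q x"
      by (auto simp: topspace_X)
    have "Q G \<eta>K \<eta>H f D = coset_integral G \<eta>K \<eta>H f x"
      using Q_q[OF f x(1)] x(2) by simp
    then show "Q G \<eta>K \<eta>H f D = complex_of_real (R a D) - complex_of_real (R b D)
            + \<i> * (complex_of_real (R c D) - complex_of_real (R d D))"
      unfolding f_eq coset_integral_decompose[OF abcd x(1)] x(2)
        Rq[OF abcd(1) x(1)] Rq[OF abcd(2) x(1)] Rq[OF abcd(3) x(1)] Rq[OF abcd(4) x(1)] .
  qed
  also have "\<dots> = complex_of_real (\<integral>x. a x \<partial>\<nu>) - complex_of_real (\<integral>x. b x \<partial>\<nu>)
            + \<i> * (complex_of_real (\<integral>x. c x \<partial>\<nu>) - complex_of_real (\<integral>x. d x \<partial>\<nu>))"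
    using i\<mu>[OF abcd(1)] i\<mu>[OF abcd(2)] i\<mu>[OF abcd(3)] i\<mu>[OF abcd(4)] Rint[OF abcd(1)] Rint[OF abcd(2)]
      Rint[OF abcd(3)] Rint[OF abcd(4)] by simp
  also have "\<dots> = (\<integral>x. f x \<partial>\<nu>)"
    unfolding f_eq using i\<nu>[OF abcd(1)] i\<nu>[OF abcd(2)] i\<nu>[OF abcd(3)] i\<nu>[OF abcd(4)] by simp
  finally show ?thesis
    by simp
qed

lemma integral_Q_representative:
  assumes \<mu>: "radon_measure X \<mu>" and f: "f \<in> Cc T" and r: "\<forall>D\<in>topspace X. r D \<in> D"
  shows "(\<integral>D. Q G \<eta>K \<eta>H f D \<partial>\<mu>)
    = (\<integral>D. (\<integral>k. (\<integral>h. f (k \<otimes> r D \<otimes> h) \<partial>\<eta>H) \<partial>\<eta>K) \<partial>\<mu>)"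
proof (rule radon_integral_cong[OF \<mu>])
  fix D assume D: "D \<in> topspace X"
  then obtain x where x: "x \<in> carrier G" "D = q x"
    by (auto simp: topspace_X)
  have "r D \<in> q x"
    using r D x(2) by blast
  then have "coset_integral G \<eta>K \<eta>H f x = coset_integral G \<eta>K \<eta>H f (r D)"
    using q_eq[OF x(1)] by (intro coset_integral_cong[OF f x(1)]) auto
  then show "Q G \<eta>K \<eta>H f D = (\<integral>k. (\<integral>h. f (k \<otimes> r D \<otimes> h) \<partial>\<eta>H) \<partial>\<eta>K)"
    using Q_q[OF f x(1)] x(2) by (simp add: coset_integral_def)
qed

lemma quotient_measure_unique:
  assumes \<mu>: "radon_measure X \<mu>" "\<And>f. f \<in> Cc T \<Longrightarrow> (\<integral>x. f x \<partial>\<nu>) = (\<integral>D. Q G \<eta>K \<eta>H f D \<partial>\<mu>)"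
    and \<mu>': "radon_measure X \<mu>'" "\<And>f. f \<in> Cc T \<Longrightarrow> (\<integral>x. f x \<partial>\<nu>) = (\<integral>D. Q G \<eta>K \<eta>H f D \<partial>\<mu>')"
  shows "\<mu> = \<mu>'"
proof (rule radon_measure_eqI[OF lcX hdX \<mu>(1) \<mu>'(1)])
  fix g assume g: "g \<in> Cc_nonneg X"
  obtain f where f: "f \<in> Cc_nonneg T" "\<And>x. x \<in> carrier G \<Longrightarrow> qavg f x = g (q x)"
    using exists_lift[OF g] by blast
  note fc = of_real_Cc_nonneg[OF hd f(1)]
  have "complex_of_real (\<integral>D. g D \<partial>\<rho>) = (\<integral>x. complex_of_real (f x) \<partial>\<nu>)"
    if \<rho>: "radon_measure X \<rho>" "\<And>f. f \<in> Cc T \<Longrightarrow> (\<integral>x. f x \<partial>\<nu>) = (\<integral>D. Q G \<eta>K \<eta>H f D \<partial>\<rho>)" for \<rho>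
  proof -
    have "(\<integral>D. Q G \<eta>K \<eta>H (\<lambda>x. complex_of_real (f x)) D \<partial>\<rho>) = (\<integral>D. complex_of_real (g D) \<partial>\<rho>)"
    proof (rule radon_integral_cong[OF \<rho>(1)])
      fix D assume "D \<in> topspace X"
      then obtain x where x: "x \<in> carrier G" "D = q x"
        by (auto simp: topspace_X)
      then show "Q G \<eta>K \<eta>H (\<lambda>x. complex_of_real (f x)) D = complex_of_real (g D)"
        using Q_real_Cc(2)[OF f(1) x(1)] f(2)[OF x(1)] by simp
    qed
    then show ?thesis
      using \<rho>(2)[OF fc] by simp
  qed
  from this[OF \<mu>] this[OF \<mu>'] show "(\<integral>D. g D \<partial>\<mu>) = (\<integral>D. g D \<partial>\<mu>')"
    by simp
qed

end

theorem proposition2p2: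
  fixes G :: "('a, 'm) monoid_scheme" and T :: "'a topology"
    and H K :: "'a set" and \<eta>H \<eta>K \<nu> :: "'a measure" and \<Delta>H \<Delta>K :: "'a \<Rightarrow> real"
  assumes "locally_compact_group G T"
    and "closed_subgroup H G T" and "closed_subgroup K G T"
    and "left_haar_measure (G\<lparr>carrier := H\<rparr>) (subtopology T H) \<eta>H"
    and "left_haar_measure (G\<lparr>carrier := K\<rparr>) (subtopology T K) \<eta>K"
    and "modular_function (G\<lparr>carrier := H\<rparr>) (subtopology T H) \<eta>H \<Delta>H"
    and "modular_function (G\<lparr>carrier := K\<rparr>) (subtopology T K) \<eta>K \<Delta>K"
    and "locally_compact_space (double_coset_space G T K H)"
    and "Hausdorff_space (double_coset_space G T K H)"
    and "Q_well_defined G T K H \<eta>K \<eta>H"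
    and "radon_measure T \<nu>"
    and "\<forall>k \<in> K. \<forall>h \<in> H. \<forall>f \<in> Cc T.
           (\<integral>x. f (inv\<^bsub>G\<^esub> k \<otimes>\<^bsub>G\<^esub> x \<otimes>\<^bsub>G\<^esub> inv\<^bsub>G\<^esub> h) \<partial>\<nu>)
             = complex_of_real (\<Delta>K k * \<Delta>H h) * (\<integral>x. f x \<partial>\<nu>)"
  shows "\<exists>!\<mu>. radon_measure (double_coset_space G T K H) \<mu> \<and>
           (\<forall>f \<in> Cc T.
              (\<integral>x. f x \<partial>\<nu>) = (\<integral>D. Q G \<eta>K \<eta>H f D \<partial>\<mu>) \<and>
              (\<forall>r. (\<forall>D \<in> topspace (double_coset_space G T K H). r D \<in> D) \<longrightarrow>
                 (\<integral>D. Q G \<eta>K \<eta>H f D \<partial>\<mu>)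
                   = (\<integral>D. (\<integral>k. (\<integral>h. f (k \<otimes>\<^bsub>G\<^esub> r D \<otimes>\<^bsub>G\<^esub> h) \<partial>\<eta>H) \<partial>\<eta>K) \<partial>\<mu>)))"
proof -
  interpret double_coset_setting G T H K \<eta>H \<eta>K \<Delta>H \<Delta>K \<nu>
    using assms by unfold_locales
  obtain \<mu> where \<mu>: "radon_measure X \<mu>"
    "\<And>f. f \<in> Cc_nonneg T \<Longrightarrow>
      (\<integral>D. Re (Q G \<eta>K \<eta>H (\<lambda>x. complex_of_real (f x)) D) \<partial>\<mu>) = (\<integral>x. f x \<partial>\<nu>)"
    using exists_quotient_measure by blast
  note int = integral_Q[OF \<mu>]
  show ?thesis
  proof (rule ex1I[of _ \<mu>])
    show "radon_measure X \<mu> \<and> (\<forall>f \<in> Cc T. (\<integral>x. f x \<partial>\<nu>) = (\<integral>D. Q G \<eta>K \<eta>H f D \<partial>\<mu>) \<and>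
        (\<forall>r. (\<forall>D \<in> topspace X. r D \<in> D) \<longrightarrow> (\<integral>D. Q G \<eta>K \<eta>H f D \<partial>\<mu>)
          = (\<integral>D. (\<integral>k. (\<integral>h. f (k \<otimes>\<^bsub>G\<^esub> r D \<otimes>\<^bsub>G\<^esub> h) \<partial>\<eta>H) \<partial>\<eta>K) \<partial>\<mu>)))"
      using \<mu>(1) int integral_Q_representative[OF \<mu>(1)] by blast
    fix \<mu>'
    assume \<mu>': "radon_measure X \<mu>' \<and> (\<forall>f \<in> Cc T. (\<integral>x. f x \<partial>\<nu>) = (\<integral>D. Q G \<eta>K \<eta>H f D \<partial>\<mu>') \<and>
        (\<forall>r. (\<forall>D \<in> topspace X. r D \<in> D) \<longrightarrow> (\<integral>D. Q G \<eta>K \<eta>H f D \<partial>\<mu>')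
          = (\<integral>D. (\<integral>k. (\<integral>h. f (k \<otimes>\<^bsub>G\<^esub> r D \<otimes>\<^bsub>G\<^esub> h) \<partial>\<eta>H) \<partial>\<eta>K) \<partial>\<mu>')))"
    show "\<mu>' = \<mu>"
      by (rule quotient_measure_unique[OF _ _ \<mu>(1) int]) (use \<mu>' in blast)+
  qed
qed

end
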